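(* Let $1\le p<\infty$ and $1<r\le p^*$, with $r<\infty$ if $p=1$. For a sequence $(x_n)$ in a Banach space $X$ the following statements are equivalent: (a) $(x_n)$ is weakly $(p,r)$-null; (b) $(x_n)$ is weakly null and relatively weakly $(p,r)$-compact; (c) $(x_n)$ is weakly null and weakly $\mathcal W_{(p,r)}$-compact; (d) $(x_n)$ is weakly $\mathcal W_{(p,r)}$-null; (e) $(x_n)$ is uniformly weakly $(p,r)$-null.
   Context: Banach spaces are over a fixed field, $\mathbb R$ or $\mathbb C$. $p^*$ is the conjugate index of $p$ ($1/p+1/p^*=1$, $1/\infty=0$). $B_Z$ is the closed unit ball of $Z$. $\ell_p^w(X)$ is the Banach space of weakly $p$-summable sequences in $X$, i.e. sequences $(x_k)$ with $\sum_k|x^*(x_k)|^p<\infty$ for all $x^*\in X^*$. For $(x_k)\in\ell_p^w(X)$ let $(p,r)\text{-conv}(x_k)=\{\sum_{k=1}^\infty a_kx_k:(a_k)\in B_{\ell_r}\}$. A subset $K\subset X$ is relatively weakly $(p,r)$-compact if $K\subset(p,r)\text{-conv}(z_k)$ for some $(z_k)\in\ell_p^w(X)$. $\mathcal W_{(p,r)}$ is the operator ideal of weakly $(p,r)$-compact operators: linear $T:Y\to X$ between Banach spaces such that $T(B_Y)$ is relatively weakly $(p,r)$-compact in $X$. $(x_n)$ is weakly $(p,r)$-null if for every $x^*\in X^*$ and every $\varepsilon>0$ there exist $(z_k)\in\ell_p^w(X)$ and $N\in\mathbb N$ such that $|x^*(x_n)|\le\varepsilon$ and $x_n\in(p,r)\text{-conv}(z_k)$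 for all $n\ge N$. $(x_n)$ is uniformly weakly $(p,r)$-null if there exists $(z_k)\in\ell_p^w(X)$ such that for every $x^*\in X^*$ and every $\varepsilon>0$ there exists $N\in\mathbb N$ such that $|x^*(x_n)|\le\varepsilon$ and $x_n\in(p,r)\text{-conv}(z_k)$ for all $n\ge N$. Let $\mathcal A$ be an operator ideal. A sequence $(x_n)$ in $X$ is weakly $\mathcal A$-null if there exist a Banach space $Y$, a weakly null sequence $(y_n)$ in $Y$ and $T\in\mathcal A(Y,X)$ such that $x_n=Ty_n$ for all $n$. A subset $K\subset X$ is weakly $\mathcal A$-compact if $K\subset T(F)$ for some Banach space $Y$, some relatively weakly compact $F\subset Y$ and some $T\in\mathcal A(Y,X)$. A sequence is said to have one of these compactness properties if the set of its terms does. *)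

theory Defs
  imports "HOL-Algebra.Module" "HOL-Analysis.Analysis"
begin

text \<open>
  Banach spaces are carrier-based here (modules over a field in the sense of HOL-Algebra, with a
  norm), because the definitions below quantify existentially over Banach spaces and because the
  library has no type class for complex Banach spaces. The scalar field is a set
  \<open>K\<close> of complex numbers, either \<open>\<real>\<close> or \<open>UNIV\<close>; only scalars in \<open>K\<close> are ever used.
  The ring multiplication and unit of a module record are junk fields and carry no meaning.
\<close>

definition scalar_field :: "complex set \<Rightarrow> complex ring" where
  "scalar_field K = \<lparr>carrier = K, monoid.mult = (*), one = 1, zero = 0, add = (+)\<rparr>"

record 'a normed_module = "(complex, 'a) module" +
  nrm :: "'a \<Rightarrow> real"

text \<open>The distance is cut off outside the carrier since the library locale \<^locale>\<open>Metric_space\<close>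
  asks for symmetry and nonnegativity on the whole type.\<close>

definition norm_dist :: "('a, 'm) normed_module_scheme \<Rightarrow> 'a \<Rightarrow> 'a \<Rightarrow> real" where
  "norm_dist X x y = (if x \<in> carrier X \<and> y \<in> carrier X then nrm X (x \<ominus>\<^bsub>X\<^esub> y) else 0)"

locale banach_space = Module.module "scalar_field K" X
  for K :: "complex set" and X :: "('a, 'm) normed_module_scheme" (structure) +
  assumes nrm_nonneg: "x \<in> carrier X \<Longrightarrow> 0 \<le> nrm X x"
    and nrm_eq_0_iff: "x \<in> carrier X \<Longrightarrow> nrm X x = 0 \<longleftrightarrow> x = \<zero>\<^bsub>X\<^esub>"
    and nrm_smult: "c \<in> K \<Longrightarrow> x \<in> carrier X \<Longrightarrow> nrm X (c \<odot>\<^bsub>X\<^esub> x) = cmod c * nrm X x"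
    and nrm_triangle:
      "x \<in> carrier X \<Longrightarrow> y \<in> carrier X \<Longrightarrow> nrm X (x \<oplus>\<^bsub>X\<^esub> y) \<le> nrm X x + nrm X y"
    and complete: "Metric_space.mcomplete (carrier X) (norm_dist X)"

context banach_space
begin

lemma nrm_minus: "x \<in> carrier X \<Longrightarrow> nrm X (\<ominus> x) = nrm X x"
proof -
  assume x: "x \<in> carrier X"
  have inv: "\<ominus>\<^bsub>scalar_field K\<^esub> \<one>\<^bsub>scalar_field K\<^esub> \<in> carrier (scalar_field K)" by simp
  have "\<ominus>\<^bsub>scalar_field K\<^esub> \<one>\<^bsub>scalar_field K\<^esub> \<oplus>\<^bsub>scalar_field K\<^esub> \<one>\<^bsub>scalar_field K\<^esub> = \<zero>\<^bsub>scalar_field K\<^esub>"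
    by (simp add: R.l_neg)
  hence m: "\<ominus>\<^bsub>scalar_field K\<^esub> \<one>\<^bsub>scalar_field K\<^esub> = -1" by (simp add: scalar_field_def eq_neg_iff_add_eq_0)
  have "\<ominus> x = (\<ominus>\<^bsub>scalar_field K\<^esub> \<one>\<^bsub>scalar_field K\<^esub>) \<odot> x" using x by (simp add: smult_l_minus)
  with m inv x nrm_smult[of "-1" x] show ?thesis by (simp add: scalar_field_def)
qed

lemma Metric_space_norm_dist: "Metric_space (carrier X) (norm_dist X)"
proof
  show "0 \<le> norm_dist X x y" for x y by (simp add: norm_dist_def nrm_nonneg)
  show "norm_dist X x y = norm_dist X y x" for x y
  proof (cases "x \<in> carrier X \<and> y \<in> carrier X")
    case True
    then have "y \<ominus> x = \<ominus> (x \<ominus> y)" by (simp add: M.minus_eq M.minus_add M.a_comm)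
    with True nrm_minus[of "x \<ominus> y"] show ?thesis by (simp add: norm_dist_def)
  qed (auto simp: norm_dist_def)
  show "norm_dist X x y = 0 \<longleftrightarrow> x = y" if "x \<in> carrier X" "y \<in> carrier X" for x y
  proof -
    have "x = (x \<ominus> y) \<oplus> y" using that by (simp add: M.minus_eq M.a_assoc M.l_neg)
    then have "x \<ominus> y = \<zero> \<longleftrightarrow> x = y" using that by (metis M.l_zero M.minus_eq M.r_neg)
    then show ?thesis using that by (simp add: norm_dist_def nrm_eq_0_iff)
  qed
  show "norm_dist X x z \<le> norm_dist X x y + norm_dist X y z" if h: "x \<in> carrier X" "y \<in> carrier X" "z \<in> carrier X" for x y z
  proof -
    have "x \<ominus> z = (x \<ominus> y) \<oplus> (y \<ominus> z)"
      using h by (simp add: M.minus_eq M.a_assoc M.r_neg2 M.r_neg1)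
    with h nrm_triangle[of "x \<ominus> y" "y \<ominus> z"] show ?thesis by (simp add: norm_dist_def)
  qed
qed

end

definition closed_unit_ball :: "('a, 'm) normed_module_scheme \<Rightarrow> 'a set" where
  "closed_unit_ball X = {x \<in> carrier X. nrm X x \<le> 1}"

definition linear_maps ::
  "complex set \<Rightarrow> ('b, 'n) normed_module_scheme \<Rightarrow> ('a, 'm) normed_module_scheme \<Rightarrow> ('b \<Rightarrow> 'a) set" where
  "linear_maps K Y X = {T. T \<in> carrier Y \<rightarrow> carrier X
     \<and> (\<forall>x\<in>carrier Y. \<forall>y\<in>carrier Y. T (x \<oplus>\<^bsub>Y\<^esub> y) = T x \<oplus>\<^bsub>X\<^esub> T y)
     \<and> (\<forall>c\<in>K. \<forall>x\<in>carrier Y. T (c \<odot>\<^bsub>Y\<^esub> x) = c \<odot>\<^bsub>X\<^esub> T x)}"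

text \<open>Functionals are only determined on the carrier; their values elsewhere are irrelevant.\<close>

definition dual :: "complex set \<Rightarrow> ('a, 'm) normed_module_scheme \<Rightarrow> ('a \<Rightarrow> complex) set" where
  "dual K X = {f. f \<in> carrier X \<rightarrow> K
     \<and> (\<forall>x\<in>carrier X. \<forall>y\<in>carrier X. f (x \<oplus>\<^bsub>X\<^esub> y) = f x + f y)
     \<and> (\<forall>c\<in>K. \<forall>x\<in>carrier X. f (c \<odot>\<^bsub>X\<^esub> x) = c * f x)
     \<and> (\<exists>C. \<forall>x\<in>carrier X. cmod (f x) \<le> C * nrm X x)}"

definition weak_topology :: "complex set \<Rightarrow> ('a, 'm) normed_module_scheme \<Rightarrow> 'a topology" where
  "weak_topology K X = topology_generated_by
     {{x \<in> carrier X. f x \<in> U} | f U. f \<in> dual K X \<and> open U}"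

definition relatively_weakly_compact ::
  "complex set \<Rightarrow> ('a, 'm) normed_module_scheme \<Rightarrow> 'a set \<Rightarrow> bool" where
  "relatively_weakly_compact K X F \<longleftrightarrow> F \<subseteq> carrier X
     \<and> compactin (weak_topology K X) (weak_topology K X closure_of F)"

definition weakly_null ::
  "complex set \<Rightarrow> ('a, 'm) normed_module_scheme \<Rightarrow> (nat \<Rightarrow> 'a) \<Rightarrow> bool" where
  "weakly_null K X x \<longleftrightarrow> range x \<subseteq> carrier X \<and> (\<forall>f\<in>dual K X. (\<lambda>n. f (x n)) \<longlonglongrightarrow> 0)"

text \<open>Extended real division has \<open>1 / 0 = \<infinity>\<close>, so the index conjugate to \<open>1\<close> is \<open>\<infinity>\<close>.\<close>

definition conj_index :: "real \<Rightarrow> ereal" where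
  "conj_index p = 1 / (1 - 1 / ereal p)"

lemma conj_index_one: "conj_index 1 = \<infinity>"
  by (simp add: conj_index_def divide_ereal_def)

lemma conj_index_gt_one: "1 < p \<Longrightarrow> conj_index p = ereal (p / (p - 1))"
  by (simp add: conj_index_def one_ereal_def field_simps)

text \<open>Indices \<open>r\<close> range over \<open>[1, \<infinity>]\<close>.\<close>

definition unit_ball_l :: "complex set \<Rightarrow> ereal \<Rightarrow> (nat \<Rightarrow> complex) set" where
  "unit_ball_l K r = {a. range a \<subseteq> K \<and>
     (if r = \<infinity> then \<forall>k. cmod (a k) \<le> 1
      else summable (\<lambda>k. cmod (a k) powr real_of_ereal r)
        \<and> (\<Sum>k. cmod (a k) powr real_of_ereal r) powr (1 / real_of_ereal r) \<le> 1)}"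

definition weakly_summable ::
  "complex set \<Rightarrow> real \<Rightarrow> ('a, 'm) normed_module_scheme \<Rightarrow> (nat \<Rightarrow> 'a) set" where
  "weakly_summable K p X = {z. range z \<subseteq> carrier X
     \<and> (\<forall>f\<in>dual K X. summable (\<lambda>k. cmod (f (z k)) powr p))}"

definition series_sum :: "('a, 'm) normed_module_scheme \<Rightarrow> (nat \<Rightarrow> 'a) \<Rightarrow> 'a \<Rightarrow> bool" where
  "series_sum X u s \<longleftrightarrow> s \<in> carrier X
     \<and> (\<lambda>n. nrm X ((\<Oplus>\<^bsub>X\<^esub>k\<in>{..<n}. u k) \<ominus>\<^bsub>X\<^esub> s)) \<longlonglongrightarrow> 0"

text \<open>The set \<open>(p,r)-conv (z\<^sub>k)\<close>; the index \<open>p\<close> enters only through the condition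
  \<open>z \<in> weakly_summable K p X\<close>, which is imposed wherever the set is used.\<close>

definition conv_r ::
  "complex set \<Rightarrow> ereal \<Rightarrow> ('a, 'm) normed_module_scheme \<Rightarrow> (nat \<Rightarrow> 'a) \<Rightarrow> 'a set" where
  "conv_r K r X z = {s. \<exists>a\<in>unit_ball_l K r. series_sum X (\<lambda>k. a k \<odot>\<^bsub>X\<^esub> z k) s}"

definition relatively_weakly_pr_compact ::
  "complex set \<Rightarrow> real \<Rightarrow> ereal \<Rightarrow> ('a, 'm) normed_module_scheme \<Rightarrow> 'a set \<Rightarrow> bool" where
  "relatively_weakly_pr_compact K p r X S \<longleftrightarrow> (\<exists>z\<in>weakly_summable K p X. S \<subseteq> conv_r K r X z)"

definition weakly_pr_compact_operators ::
  "complex set \<Rightarrow> real \<Rightarrow> ereal \<Rightarrow> ('b, 'n) normed_module_scheme \<Rightarrow> ('a, 'm) normed_module_scheme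
    \<Rightarrow> ('b \<Rightarrow> 'a) set" where
  "weakly_pr_compact_operators K p r Y X =
     {T \<in> linear_maps K Y X. relatively_weakly_pr_compact K p r X (T ` closed_unit_ball Y)}"

definition weakly_pr_null ::
  "complex set \<Rightarrow> real \<Rightarrow> ereal \<Rightarrow> ('a, 'm) normed_module_scheme \<Rightarrow> (nat \<Rightarrow> 'a) \<Rightarrow> bool" where
  "weakly_pr_null K p r X x \<longleftrightarrow>
     (\<forall>f\<in>dual K X. \<forall>\<epsilon>>0. \<exists>z\<in>weakly_summable K p X. \<exists>N. \<forall>n\<ge>N.
        cmod (f (x n)) \<le> \<epsilon> \<and> x n \<in> conv_r K r X z)"

definition uniformly_weakly_pr_null ::
  "complex set \<Rightarrow> real \<Rightarrow> ereal \<Rightarrow> ('a, 'm) normed_module_scheme \<Rightarrow> (nat \<Rightarrow> 'a) \<Rightarrow> bool" where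
  "uniformly_weakly_pr_null K p r X x \<longleftrightarrow>
     (\<exists>z\<in>weakly_summable K p X. \<forall>f\<in>dual K X. \<forall>\<epsilon>>0. \<exists>N. \<forall>n\<ge>N.
        cmod (f (x n)) \<le> \<epsilon> \<and> x n \<in> conv_r K r X z)"

text \<open>
  In the next two definitions \<open>\<A>\<close> stands for the components \<open>\<A>(Y,X)\<close> of an operator ideal. The
  existential quantifier over Banach spaces \<open>Y\<close> ranges over all Banach spaces whose carrier is a
  subset of the type \<open>'b\<close>. HOL cannot quantify over types inside a formula; theorems about these
  notions should therefore keep \<open>'b\<close> as an arbitrary, sufficiently large type.
\<close>

definition weakly_ideal_null ::
  "complex set \<Rightarrow> ('b normed_module \<Rightarrow> ('a, 'm) normed_module_scheme \<Rightarrow> ('b \<Rightarrow> 'a) set)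
    \<Rightarrow> ('a, 'm) normed_module_scheme \<Rightarrow> (nat \<Rightarrow> 'a) \<Rightarrow> bool" where
  "weakly_ideal_null K \<A> X x \<longleftrightarrow>
     (\<exists>Y y T. banach_space K Y \<and> weakly_null K Y y \<and> T \<in> \<A> Y X \<and> (\<forall>n. x n = T (y n)))"

definition weakly_ideal_compact ::
  "complex set \<Rightarrow> ('b normed_module \<Rightarrow> ('a, 'm) normed_module_scheme \<Rightarrow> ('b \<Rightarrow> 'a) set)
    \<Rightarrow> ('a, 'm) normed_module_scheme \<Rightarrow> 'a set \<Rightarrow> bool" where
  "weakly_ideal_compact K \<A> X S \<longleftrightarrow>
     (\<exists>Y F T. banach_space K Y \<and> relatively_weakly_compact K Y F \<and> T \<in> \<A> Y X \<and> S \<subseteq> T ` F)"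

end

theory Submission
  imports Defs
begin

text \<open>
  All conditions say that \<open>x\<close> is weakly null and (up to finitely many terms, which can be
  prepended to \<open>z\<close>) contained in one set \<open>B = (p,r)-conv (z\<^sub>k)\<close>. Operators in \<open>\<W>\<close> map norm bounded
  sets into such sets, and weakly null sequences and relatively weakly compact sets are norm
  bounded, so (c) and (d) imply (b).

  Conversely, \<open>1 < r < \<infinity>\<close> because of \<open>r \<le> p\<^sup>*\<close> (and by assumption if \<open>p = 1\<close>). With the gauge of \<open>B\<close> as norm, the
  span of \<open>B\<close> is a quotient of \<open>\<ell>\<^sub>r\<close>, hence a Banach space, and its inclusion into \<open>X\<close> lies in \<open>\<W>\<close>.
  Bounded sequences in \<open>\<ell>\<^sub>r\<close> have weakly (that is, coordinatewise) convergent subsequences, so a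
  sequence in \<open>B\<close> that is weakly null in \<open>X\<close> is also weakly null in the span, which gives (d).
\<close>

text \<open>A functional on the span of \<open>B\<close> that is continuous for the gauge need not
  be continuous for the norm of \<open>X\<close>, so weak nullity in \<open>X\<close> says nothing
  about it directly. It acts on \<open>B\<close> through coefficients, however: the series \<Sum>
  a_k z_k converges in the gauge as well, and the values of the functional at the \<open>z k\<close>
  are summable with the conjugate exponent. Coefficients are not unique, and those of a weakly null
  sequence need not tend to 0; a limit of a subsequence of them merely represents 0. This suffices,
  because it then represents 0 in the span too.

  On the side of \<open>X\<close> everything is tested on functionals: \<open>B\<close> consists of
  the vectors on which each functional f takes the value \<Sum> a_k f(z_k) for a common
  \<open>a\<close> in the ball. Norm bounds come from weak bounds by uniform boundedness, vector
  identities from Hahn-Banach. The condition on r is used in the form that p is at most the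
  conjugate of r, so that weakly p-summable sequences pair with coefficients in
  \<open>\<ell>\<^sub>r\<close>. The span is built from vectors of \<open>X\<close> and not from
  cosets of sequences, so that any type with room for \<open>X\<close> has room for it.\<close>

locale real_or_complex_banach_space = banach_space K X
  for K and X :: "('a, 'm) normed_module_scheme" (structure) +
  assumes K_cases: "K = \<real> \<or> K = UNIV"
begin

section \<open>Arithmetic with real or complex scalars\<close>

lemma scalar_field_simps [simp]:
  "carrier (scalar_field K) = K" "\<one>\<^bsub>scalar_field K\<^esub> = 1" "\<zero>\<^bsub>scalar_field K\<^esub> = 0"
  "a \<otimes>\<^bsub>scalar_field K\<^esub> b = a * b" "a \<oplus>\<^bsub>scalar_field K\<^esub> b = a + b"
  by (simp_all add: scalar_field_def)

lemma K_of_real [simp, intro]: "complex_of_real t \<in> K"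
  using K_cases by auto

lemma K_closed [intro]:
  "a \<in> K \<Longrightarrow> b \<in> K \<Longrightarrow> a + b \<in> K"
  "a \<in> K \<Longrightarrow> b \<in> K \<Longrightarrow> a - b \<in> K"
  "a \<in> K \<Longrightarrow> b \<in> K \<Longrightarrow> a * b \<in> K"
  "a \<in> K \<Longrightarrow> b \<in> K \<Longrightarrow> a / b \<in> K"
  "a \<in> K \<Longrightarrow> cnj a \<in> K"
  "a \<in> K \<Longrightarrow> - a \<in> K"
  "0 \<in> K" "1 \<in> K"
  using K_cases by (auto simp: Reals_cnj_iff)

lemma K_topologically_closed: "closed K"
  using K_cases closed_complex_Reals by auto

lemma smult_in_carrier [simp, intro]: "c \<in> K \<Longrightarrow> v \<in> carrier X \<Longrightarrow> c \<odot> v \<in> carrier X"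
  using smult_closed by simp

lemma smult_add_left: "a \<in> K \<Longrightarrow> b \<in> K \<Longrightarrow> v \<in> carrier X \<Longrightarrow> (a + b) \<odot> v = a \<odot> v \<oplus> b \<odot> v"
  using smult_l_distr by simp

lemma smult_add_right:
  "a \<in> K \<Longrightarrow> v \<in> carrier X \<Longrightarrow> w \<in> carrier X \<Longrightarrow> a \<odot> (v \<oplus> w) = a \<odot> v \<oplus> a \<odot> w"
  using smult_r_distr by simp

lemma smult_smult: "a \<in> K \<Longrightarrow> b \<in> K \<Longrightarrow> v \<in> carrier X \<Longrightarrow> a \<odot> (b \<odot> v) = (a * b) \<odot> v"
  using smult_assoc1 by simp

lemma smult_1 [simp]: "v \<in> carrier X \<Longrightarrow> 1 \<odot> v = v"
  using smult_one by simp

lemma smult_0 [simp]: "v \<in> carrier X \<Longrightarrow> 0 \<odot> v = \<zero>"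
  using smult_l_null by simp

lemma smult_zero [simp]: "c \<in> K \<Longrightarrow> c \<odot> \<zero> = \<zero>"
  using smult_r_null by simp

lemma smult_minus_1: "v \<in> carrier X \<Longrightarrow> (-1) \<odot> v = \<ominus> v"
proof -
  assume v: "v \<in> carrier X"
  have "(-1) \<odot> v \<oplus> v = (-1 + 1) \<odot> v"
    using v smult_add_left[of "-1" 1 v] K_closed by simp
  also have "\<dots> = \<zero>"
    using v by simp
  finally show ?thesis
    using v K_closed by (metis M.minus_equality smult_in_carrier)
qed

section \<open>The Hahn--Banach theorem\<close>

text \<open>Scalars are real, so over \<complex> the space is treated as a real one. Homogeneity is
  stated as an inequality because this form passes to infima; equality follows by applying it to
  \<open>1/t\<close> as well.\<close>

definition sublinear :: "('a \<Rightarrow> real) \<Rightarrow> bool" where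
  "sublinear q \<longleftrightarrow> (\<forall>v\<in>carrier X. \<forall>w\<in>carrier X. q (v \<oplus> w) \<le> q v + q w)
     \<and> (\<forall>v\<in>carrier X. \<forall>t\<ge>0. q (complex_of_real t \<odot> v) \<le> t * q v)"

lemma sublinear_add: "sublinear q \<Longrightarrow> v \<in> carrier X \<Longrightarrow> w \<in> carrier X \<Longrightarrow> q (v \<oplus> w) \<le> q v + q w"
  by (simp add: sublinear_def)

lemma sublinear_zero: "sublinear q \<Longrightarrow> q \<zero> = 0"
proof -
  assume q: "sublinear q"
  have "q \<zero> \<le> 2 * q \<zero>"
    using sublinear_add[OF q, of \<zero> \<zero>] by simp
  moreover have "q (complex_of_real 0 \<odot> \<zero>) \<le> 0 * q \<zero>"
    using q unfolding sublinear_def by blast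
  ultimately show ?thesis
    by simp
qed

lemma sublinear_scale:
  assumes q: "sublinear q" and v: "v \<in> carrier X" and t: "0 \<le> t"
  shows "q (complex_of_real t \<odot> v) = t * q v"
proof (cases "t = 0")
  case True
  then show ?thesis using sublinear_zero[OF q] v by simp
next
  case False
  have "complex_of_real (1/t) \<odot> (complex_of_real t \<odot> v) = v"
    using False v smult_smult[OF K_of_real K_of_real, of v "1/t" t] by simp
  moreover have "q (complex_of_real (1/t) \<odot> (complex_of_real t \<odot> v)) \<le> (1/t) * q (complex_of_real t \<odot> v)"
    using q v t unfolding sublinear_def by (meson K_of_real smult_in_carrier divide_nonneg_nonneg zero_le_one)
  ultimately have "t * q v \<le> q (complex_of_real t \<odot> v)"
    using False t by (simp add: field_simps)
  moreover have "q (complex_of_real t \<odot> v) \<le> t * q v"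
    using q v t unfolding sublinear_def by blast
  ultimately show ?thesis by simp
qed

lemma sublinear_minus: "sublinear q \<Longrightarrow> v \<in> carrier X \<Longrightarrow> 0 \<le> q v + q (\<ominus> v)"
  using sublinear_add[of q v "\<ominus> v"] sublinear_zero[of q] by (simp add: M.r_neg)

lemma sublinear_nrm: "sublinear (nrm X)"
  by (auto simp: sublinear_def nrm_triangle nrm_smult)

text \<open>This infimum is again sublinear, lies below \<open>q\<close>, and is at most
  \<open>- q w\<close> at \<open>\<ominus> w\<close>. A minimal \<open>q\<close> must equal it for
  every \<open>w\<close>, which makes \<open>q\<close> additive; started from the norm, it makes the
  functional found below it attain the norm at \<open>w\<close>.\<close>

definition directional_inf :: "('a \<Rightarrow> real) \<Rightarrow> 'a \<Rightarrow> 'a \<Rightarrow> real" where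
  "directional_inf q w v = (INF t\<in>{0..}. q (v \<oplus> complex_of_real t \<odot> w) - t * q w)"

context
  fixes q w assumes q: "sublinear q" and w: "w \<in> carrier X"
begin

lemma directional_inf_le:
  assumes v: "v \<in> carrier X" and t: "0 \<le> t"
  shows "directional_inf q w v \<le> q (v \<oplus> complex_of_real t \<odot> w) - t * q w"
  unfolding directional_inf_def
proof (rule cINF_lower)
  show "bdd_below ((\<lambda>t. q (v \<oplus> complex_of_real t \<odot> w) - t * q w) ` {0..})"
  proof (rule bdd_belowI2)
    fix t :: real assume t: "t \<in> {0..}"
    \<comment> \<open>The lower bound \<open>- q (\<ominus> v)\<close> does not depend on
      \<open>t\<close>, so the infimum is finite.\<close>
    have "t * q w = q (complex_of_real t \<odot> w)"
      using sublinear_scale[OF q w, of t] t by simp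
    also have "complex_of_real t \<odot> w = (v \<oplus> complex_of_real t \<odot> w) \<oplus> \<ominus> v"
      using v w by (simp add: M.a_ac M.r_neg1 M.r_neg2)
    also have "q \<dots> \<le> q (v \<oplus> complex_of_real t \<odot> w) + q (\<ominus> v)"
      using v w by (intro sublinear_add[OF q]) auto
    finally show "- q (\<ominus> v) \<le> q (v \<oplus> complex_of_real t \<odot> w) - t * q w"
      by simp
  qed
qed (use t in simp)

lemma directional_inf_greatest:
  assumes "\<And>t. 0 \<le> t \<Longrightarrow> c \<le> q (v \<oplus> complex_of_real t \<odot> w) - t * q w"
  shows "c \<le> directional_inf q w v"
  unfolding directional_inf_def using assms by (intro cINF_greatest) auto

lemma directional_inf_le_self: "v \<in> carrier X \<Longrightarrow> directional_inf q w v \<le> q v"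
  using directional_inf_le[of v 0] w by simp

lemma directional_inf_minus: "directional_inf q w (\<ominus> w) \<le> - q w"
  using directional_inf_le[of "\<ominus> w" 1] w sublinear_zero[OF q] by (simp add: M.l_neg)

lemma directional_inf_add_le:
  assumes v: "v \<in> carrier X" "v' \<in> carrier X"
  shows "directional_inf q w (v \<oplus> v') \<le> directional_inf q w v + directional_inf q w v'"
proof -
  have "directional_inf q w (v \<oplus> v') - (q (v \<oplus> complex_of_real t \<odot> w) - t * q w)
      \<le> directional_inf q w v'" if t: "0 \<le> t" for t
  proof (rule directional_inf_greatest)
    fix t' :: real assume t': "0 \<le> t'"
    have "directional_inf q w (v \<oplus> v') \<le> q ((v \<oplus> v') \<oplus> complex_of_real (t + t') \<odot> w) - (t + t') * q w"
      using v t t' by (intro directional_inf_le) auto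
    also have "(v \<oplus> v') \<oplus> complex_of_real (t + t') \<odot> w
        = (v \<oplus> complex_of_real t \<odot> w) \<oplus> (v' \<oplus> complex_of_real t' \<odot> w)"
      using v w by (simp add: smult_add_left M.a_ac)
    also have "q \<dots> \<le> q (v \<oplus> complex_of_real t \<odot> w) + q (v' \<oplus> complex_of_real t' \<odot> w)"
      using v w by (intro sublinear_add[OF q]) auto
    finally show "directional_inf q w (v \<oplus> v') - (q (v \<oplus> complex_of_real t \<odot> w) - t * q w)
        \<le> q (v' \<oplus> complex_of_real t' \<odot> w) - t' * q w"
      by (simp add: algebra_simps)
  qed
  then have "directional_inf q w (v \<oplus> v') - directional_inf q w v' \<le> directional_inf q w v"
    by (intro directional_inf_greatest) (auto simp: algebra_simps)
  then show ?thesis by simp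
qed

lemma directional_inf_scale_le:
  assumes v: "v \<in> carrier X" and s: "0 \<le> s"
  shows "directional_inf q w (complex_of_real s \<odot> v) \<le> s * directional_inf q w v"
proof (cases "s = 0")
  case True
  then show ?thesis
    using directional_inf_le_self[of \<zero>] v sublinear_zero[OF q] by simp
next
  case False
  with s have s: "0 < s" by simp
  have "directional_inf q w (complex_of_real s \<odot> v) / s \<le> directional_inf q w v"
  proof (rule directional_inf_greatest)
    fix t :: real assume t: "0 \<le> t"
    have "directional_inf q w (complex_of_real s \<odot> v)
        \<le> q (complex_of_real s \<odot> v \<oplus> complex_of_real (s * t) \<odot> w) - (s * t) * q w"
      using v s t by (intro directional_inf_le) auto
    also have "complex_of_real s \<odot> v \<oplus> complex_of_real (s * t) \<odot> w
        = complex_of_real s \<odot> (v \<oplus> complex_of_real t \<odot> w)"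
      using v w by (simp add: smult_add_right smult_smult)
    also have "q \<dots> = s * q (v \<oplus> complex_of_real t \<odot> w)"
      using v w s by (intro sublinear_scale[OF q]) auto
    finally show "directional_inf q w (complex_of_real s \<odot> v) / s \<le> q (v \<oplus> complex_of_real t \<odot> w) - t * q w"
      using s by (simp add: field_simps)
  qed
  then show ?thesis using s by (simp add: field_simps)
qed

lemma sublinear_directional_inf: "sublinear (directional_inf q w)"
  using directional_inf_add_le directional_inf_scale_le by (auto simp: sublinear_def)

end

text \<open>With the value 0 outside the carrier, functions that agree on the carrier are equal, so
  the pointwise order compares exactly the values that matter.\<close>

lemma sublinear_restrict:
  "sublinear (\<lambda>v. if v \<in> carrier X then q v else 0) \<longleftrightarrow> sublinear q"
  by (auto simp: sublinear_def)

lemma minimal_sublinear_exists: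
  assumes p: "sublinear p"
  obtains q where "sublinear q" "\<And>v. v \<in> carrier X \<Longrightarrow> q v \<le> p v"
    "\<And>q'. sublinear q' \<Longrightarrow> (\<And>v. v \<in> carrier X \<Longrightarrow> q' v \<le> q v) \<Longrightarrow> (\<And>v. v \<in> carrier X \<Longrightarrow> q' v = q v)"
proof -
  define A where "A = {q. sublinear q \<and> (\<forall>v\<in>carrier X. q v \<le> p v) \<and> (\<forall>v. v \<notin> carrier X \<longrightarrow> q v = 0)}"
  have "\<exists>m\<in>A. \<forall>a\<in>A. a \<le> m \<longrightarrow> a = m"
  \<comment> \<open>Zorn's lemma for the reversed order: bounds of chains are pointwise infima, and
    a maximal element is a minimal sublinear functional.\<close>
  proof (rule predicate_Zorn[where P = "\<lambda>q q'. q' \<le> q"])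
    show "partial_order_on A (relation_of (\<lambda>q q'. q' \<le> q) A)"
      by (auto simp: partial_order_on_def preorder_on_def refl_on_def trans_def antisym_def relation_of_def)
  next
    fix C assume C: "C \<in> Chains (relation_of (\<lambda>q q'. q' \<le> q) A)"
    have CA: "q \<in> A" if "q \<in> C" for q
      using C that by (auto simp: Chains_def relation_of_def)
    have chain: "q \<le> q' \<or> q' \<le> q" if "q \<in> C" "q' \<in> C" for q q'
      using C that by (auto simp: Chains_def relation_of_def)
    show "\<exists>u\<in>A. \<forall>q\<in>C. u \<le> q"
    proof (cases "C = {}")
      case True
      have "(\<lambda>v. if v \<in> carrier X then p v else 0) \<in> A"
        using p by (simp add: A_def sublinear_restrict)
      with True show ?thesis by auto
    next
      case False
      define u where "u v = (INF q\<in>C. q v)" for v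
      have u_le: "u v \<le> q v" if q: "q \<in> C" for q v
        unfolding u_def
      proof (rule cINF_lower[OF _ q], rule bdd_belowI2)
        fix q' assume "q' \<in> C"
        then have q': "q' \<in> A" by (rule CA)
        \<comment> \<open>Every \<open>q'\<close> in the chain satisfies
          \<open>q' v \<ge> - q' (\<ominus> v) \<ge> - p (\<ominus> v)\<close>, so the infimum is
          finite.\<close>
        show "(if v \<in> carrier X then - p (\<ominus> v) else 0) \<le> q' v"
        proof (cases "v \<in> carrier X")
          case True
          then have "q' (\<ominus> v) \<le> p (\<ominus> v)" "0 \<le> q' v + q' (\<ominus> v)"
            using q' sublinear_minus[of q' v] by (auto simp: A_def)
          then show ?thesis using True by simp
        qed (use q' in \<open>simp add: A_def\<close>)
      qed
      have u_greatest: "c \<le> u v" if "\<And>q. q \<in> C \<Longrightarrow> c \<le> q v" for c v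
        unfolding u_def using False that by (rule cINF_greatest)
      have "u \<in> A"
        unfolding A_def mem_Collect_eq sublinear_def
      proof (intro conjI ballI allI impI)
        fix v w assume vw: "v \<in> carrier X" "w \<in> carrier X"
        \<comment> \<open>Subadditivity needs one functional below both \<open>q\<close> and
          \<open>q'\<close>; in a chain the smaller of the two serves.\<close>
        have le_add: "u (v \<oplus> w) \<le> q v + q' w" if qC: "q \<in> C" "q' \<in> C" for q q'
        proof -
          obtain q0 where q0: "q0 \<in> C" "q0 \<le> q" "q0 \<le> q'"
            using chain[OF qC] qC by (meson order_refl)
          have "u (v \<oplus> w) \<le> q0 (v \<oplus> w)"
            using u_le q0 by blast
          also have "\<dots> \<le> q0 v + q0 w"
            using CA[OF q0(1)] vw by (intro sublinear_add) (auto simp: A_def)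
          also have "\<dots> \<le> q v + q' w"
            using q0 by (simp add: add_mono le_funD)
          finally show ?thesis .
        qed
        have "u (v \<oplus> w) - q v \<le> u w" if "q \<in> C" for q
          using le_add[OF that] by (intro u_greatest) (simp add: algebra_simps)
        then have "u (v \<oplus> w) - u w \<le> u v"
          by (intro u_greatest) (auto simp: algebra_simps)
        then show "u (v \<oplus> w) \<le> u v + u w" by simp
      next
        fix v and t :: real assume v: "v \<in> carrier X" and t: "0 \<le> t"
        have le: "u (complex_of_real t \<odot> v) \<le> t * q v" if "q \<in> C" for q
        proof -
          have "u (complex_of_real t \<odot> v) \<le> q (complex_of_real t \<odot> v)"
            by (rule u_le[OF that])
          also have "\<dots> = t * q v"
            using CA[OF that] v t by (intro sublinear_scale) (auto simp: A_def)
          finally show ?thesis .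
        qed
        show "u (complex_of_real t \<odot> v) \<le> t * u v"
        proof (cases "t = 0")
          case True
          with le False show ?thesis by auto
        next
          case False
          with t have t: "0 < t" by simp
          then have "u (complex_of_real t \<odot> v) / t \<le> u v"
            using le by (intro u_greatest) (auto simp: field_simps)
          then show ?thesis using t by (simp add: field_simps)
        qed
      next
        fix v assume v: "v \<in> carrier X"
        obtain q where "q \<in> C" using False by blast
        with u_le[of q v] CA[of q] v show "u v \<le> p v"
          by (auto simp: A_def intro: order_trans)
      next
        fix v assume "v \<notin> carrier X"
        then have zero: "q v = 0" if "q \<in> C" for q
          using CA[OF that] by (simp add: A_def)
        have "u v = (INF q\<in>C. 0)"
          unfolding u_def by (rule INF_cong[OF refl zero])
        then show "u v = 0"
          using False by simp
      qed
      then show ?thesis using u_le by (auto simp: le_fun_def)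
    qed
  qed
  then obtain q where q: "q \<in> A" and min: "\<And>q'. q' \<in> A \<Longrightarrow> q' \<le> q \<Longrightarrow> q' = q"
    by blast
  show ?thesis
  proof (rule that)
    fix q' v assume q': "sublinear q'" "\<And>v. v \<in> carrier X \<Longrightarrow> q' v \<le> q v" and v: "v \<in> carrier X"
    have "(\<lambda>v. if v \<in> carrier X then q' v else 0) = q"
    proof (rule min)
      show "(\<lambda>v. if v \<in> carrier X then q' v else 0) \<in> A"
        using q q'(1) order_trans[OF q'(2)] by (simp add: A_def sublinear_restrict)
      show "(\<lambda>v. if v \<in> carrier X then q' v else 0) \<le> q"
        using q q'(2) by (simp add: A_def le_fun_def)
    qed
    then have "(if v \<in> carrier X then q' v else 0) = q v"
      by (rule fun_cong)
    then show "q' v = q v" using v by simp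
  qed (use q in \<open>auto simp: A_def\<close>)
qed

text \<open>By minimality \<open>directional_inf q w\<close> equals \<open>q\<close>; its bound at t
  = 1 is the missing superadditivity.\<close>

lemma minimal_sublinear_additive:
  assumes q: "sublinear q"
    and min: "\<And>q' v. sublinear q' \<Longrightarrow> (\<And>v. v \<in> carrier X \<Longrightarrow> q' v \<le> q v) \<Longrightarrow> v \<in> carrier X \<Longrightarrow> q' v = q v"
    and v: "v \<in> carrier X" and w: "w \<in> carrier X"
  shows "q (v \<oplus> w) = q v + q w"
proof -
  have "directional_inf q w v = q v"
    using v by (intro min sublinear_directional_inf[OF q w] directional_inf_le_self[OF q w])
  then have "q v + q w \<le> q (v \<oplus> w)"
    using directional_inf_le[OF q w v, of 1] w by simp
  then show ?thesis
    using sublinear_add[OF q v w] by simp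
qed

text \<open>Minimising below \<open>directional_inf (nrm X) v0\<close> instead of below the norm
  builds in \<open>u (\<ominus> v0) \<le> - nrm X v0\<close>, which forces
  \<open>u v0 = nrm X v0\<close>.\<close>

lemma real_norming_functional:
  assumes v0: "v0 \<in> carrier X"
  obtains u where "\<And>v w. v \<in> carrier X \<Longrightarrow> w \<in> carrier X \<Longrightarrow> u (v \<oplus> w) = u v + u w"
    "\<And>v t. v \<in> carrier X \<Longrightarrow> u (complex_of_real t \<odot> v) = t * u v"
    "\<And>v. v \<in> carrier X \<Longrightarrow> u v \<le> nrm X v" "u v0 = nrm X v0"
proof -
  let ?p = "directional_inf (nrm X) v0"
  obtain u where u: "sublinear u" and le: "\<And>v. v \<in> carrier X \<Longrightarrow> u v \<le> ?p v"
    and min: "\<And>q' v. sublinear q' \<Longrightarrow> (\<And>v. v \<in> carrier X \<Longrightarrow> q' v \<le> u v) \<Longrightarrow> v \<in> carrier X \<Longrightarrow> q' v = u v"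
    by (rule minimal_sublinear_exists[OF sublinear_directional_inf[OF sublinear_nrm v0]]) blast
  have add: "u (v \<oplus> w) = u v + u w" if "v \<in> carrier X" "w \<in> carrier X" for v w
    by (rule minimal_sublinear_additive[OF u _ that]) (rule min)
  have neg: "u (\<ominus> v) = - u v" if "v \<in> carrier X" for v
    using add[of v "\<ominus> v"] that sublinear_zero[OF u] by (simp add: M.r_neg)
  have scale: "u (complex_of_real t \<odot> v) = t * u v" if v: "v \<in> carrier X" for v t
  proof (cases "0 \<le> t")
    case False
    have "complex_of_real t \<odot> v = \<ominus> (complex_of_real (-t) \<odot> v)"
      using v smult_minus_1[of "complex_of_real (-t) \<odot> v"] smult_smult[of "-1" "complex_of_real (-t)" v]
      by (simp add: K_closed)
    moreover have "complex_of_real (-t) \<odot> v \<in> carrier X"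
      using v by blast
    ultimately show ?thesis
      using False neg[of "complex_of_real (-t) \<odot> v"] sublinear_scale[OF u v, of "-t"] v by simp
  qed (use sublinear_scale[OF u v] in simp)
  have le': "u v \<le> nrm X v" if "v \<in> carrier X" for v
    using le[OF that] directional_inf_le_self[OF sublinear_nrm v0 that] by simp
  have "- u v0 \<le> - nrm X v0"
    using le[of "\<ominus> v0"] directional_inf_minus[OF sublinear_nrm v0] neg[OF v0] v0 by simp
  with le'[OF v0] have "u v0 = nrm X v0" by simp
  with add scale le' show ?thesis by (rule that)
qed

section \<open>Continuous linear functionals\<close>

lemma dualD:
  assumes "f \<in> dual K X"
  shows dual_in: "v \<in> carrier X \<Longrightarrow> f v \<in> K"
    and dual_add: "v \<in> carrier X \<Longrightarrow> w \<in> carrier X \<Longrightarrow> f (v \<oplus> w) = f v + f w"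
    and dual_smult: "c \<in> K \<Longrightarrow> v \<in> carrier X \<Longrightarrow> f (c \<odot> v) = c * f v"
  using assms by (auto simp: dual_def)

lemma dual_bound:
  assumes "f \<in> dual K X"
  obtains C where "0 < C" "\<And>v. v \<in> carrier X \<Longrightarrow> cmod (f v) \<le> C * nrm X v"
proof -
  obtain C where C: "\<And>v. v \<in> carrier X \<Longrightarrow> cmod (f v) \<le> C * nrm X v"
    using assms unfolding dual_def by blast
  have "cmod (f v) \<le> (\<bar>C\<bar> + 1) * nrm X v" if "v \<in> carrier X" for v
    using C[OF that] nrm_nonneg[OF that] by (smt (verit) mult_right_mono)
  then show ?thesis using that[of "\<bar>C\<bar> + 1"] by fastforce
qed

lemma dual_minus: "f \<in> dual K X \<Longrightarrow> v \<in> carrier X \<Longrightarrow> f (\<ominus> v) = - f v"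
  using dual_smult[of f "-1" v] by (simp add: smult_minus_1 K_closed)

lemma dual_diff: "f \<in> dual K X \<Longrightarrow> v \<in> carrier X \<Longrightarrow> w \<in> carrier X \<Longrightarrow> f (v \<ominus> w) = f v - f w"
  by (simp add: M.minus_eq dual_add dual_minus)

lemma dual_zero [simp]: "f \<in> dual K X \<Longrightarrow> f \<zero> = 0"
  using dual_smult[of f 0 \<zero>] by (simp add: K_closed)

lemma zero_in_dual: "(\<lambda>v. 0) \<in> dual K X"
  by (auto simp: dual_def K_closed intro!: exI[of _ 0])

text \<open>Over \<open>\<complex>\<close> a functional is recovered from its real part \<open>u\<close> as \<open>u v - i u (i v)\<close>.\<close>

theorem norming_functional:
  assumes v0: "v0 \<in> carrier X"
  obtains f where "f \<in> dual K X" "\<And>v. v \<in> carrier X \<Longrightarrow> cmod (f v) \<le> nrm X v"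
    "cmod (f v0) = nrm X v0"
proof -
  obtain u where add: "\<And>v w. v \<in> carrier X \<Longrightarrow> w \<in> carrier X \<Longrightarrow> u (v \<oplus> w) = u v + u w"
    and scale: "\<And>v t. v \<in> carrier X \<Longrightarrow> u (complex_of_real t \<odot> v) = t * u v"
    and le: "\<And>v. v \<in> carrier X \<Longrightarrow> u v \<le> nrm X v" and eq: "u v0 = nrm X v0"
    using real_norming_functional[OF v0] by metis
  have uneg: "u (\<ominus> v) = - u v" if "v \<in> carrier X" for v
    using scale[OF that, of "-1"] smult_minus_1[OF that] by simp
  have nonneg: "0 \<le> nrm X v0" by (rule nrm_nonneg[OF v0])
  show ?thesis
  proof (cases "K = \<real>")
    case True
    have bd: "cmod (complex_of_real (u v)) \<le> nrm X v" if "v \<in> carrier X" for v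
      using le[OF that] le[of "\<ominus> v"] uneg[OF that] nrm_minus[OF that] that by simp
    have "(\<lambda>v. complex_of_real (u v)) \<in> dual K X"
      unfolding dual_def mem_Collect_eq
      using True add scale bd by (auto simp: Reals_def intro!: exI[of _ 1])
    then show ?thesis using that[of "\<lambda>v. complex_of_real (u v)"] bd eq nonneg by simp
  next
    case False
    then have K: "K = UNIV" using K_cases by simp
    define f where "f v = complex_of_real (u v) - \<i> * complex_of_real (u (\<i> \<odot> v))" for v
    have f_add: "f (v \<oplus> w) = f v + f w" if "v \<in> carrier X" "w \<in> carrier X" for v w
      using that K by (simp add: f_def add smult_add_right algebra_simps)
    have f_smult: "f (c \<odot> v) = c * f v" if v: "v \<in> carrier X" for c v
    proof -
      have *: "u ((a + \<i> * b) \<odot> v) = a * u v + b * u (\<i> \<odot> v)" for a b :: real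
        using v K smult_add_left[of "complex_of_real a" "\<i> * complex_of_real b" v]
          smult_smult[of "complex_of_real b" \<i> v] scale[of v a] scale[of "\<i> \<odot> v" b]
        by (simp add: add mult.commute)
      have c: "c = complex_of_real (Re c) + \<i> * complex_of_real (Im c)"
        by (simp add: complex_eq)
      have "u (c \<odot> v) = Re c * u v + Im c * u (\<i> \<odot> v)"
        using *[of "Re c" "Im c"] c by simp
      moreover have "\<i> * c = complex_of_real (- Im c) + \<i> * complex_of_real (Re c)"
        by (simp add: complex_eq_iff)
      then have "\<i> \<odot> (c \<odot> v) = (complex_of_real (- Im c) + \<i> * complex_of_real (Re c)) \<odot> v"
        using v K smult_smult[of \<i> c v] by simp
      then have "u (\<i> \<odot> (c \<odot> v)) = - Im c * u v + Re c * u (\<i> \<odot> v)"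
        using *[of "- Im c" "Re c"] by simp
      ultimately show ?thesis by (simp add: f_def complex_eq_iff)
    qed
    have f_le: "cmod (f v) \<le> nrm X v" if v: "v \<in> carrier X" for v
    proof (cases "f v = 0")
      case False
      \<comment> \<open>Rotating \<open>v\<close> by the phase \<open>c\<close> makes the value of
        \<open>f\<close> real and nonnegative, where it equals \<open>u\<close> and the bound on
        \<open>u\<close> applies.\<close>
      define c where "c = cnj (f v) / cmod (f v)"
      have c: "cmod c = 1" using False by (simp add: c_def norm_divide)
      have "complex_of_real (cmod (f v)) = c * f v"
        using False by (simp add: c_def complex_norm_square[symmetric] power2_eq_square mult.commute)
      also have "\<dots> = f (c \<odot> v)" by (simp add: f_smult v)
      finally have "cmod (f v) = Re (f (c \<odot> v))" by (metis Re_complex_of_real)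
      also have "\<dots> = u (c \<odot> v)" by (simp add: f_def)
      also have "\<dots> \<le> nrm X (c \<odot> v)" using v K by (intro le) auto
      also have "\<dots> = nrm X v" using v K c by (simp add: nrm_smult)
      finally show ?thesis .
    qed (use nrm_nonneg[OF v] in simp)
    have "f \<in> dual K X"
      unfolding dual_def mem_Collect_eq
      using K f_add f_smult f_le by (auto intro!: exI[of _ 1])
    moreover have "nrm X v0 \<le> cmod (f v0)"
      using eq complex_Re_le_cmod[of "f v0"] by (simp add: f_def)
    ultimately show ?thesis using that[of f] f_le v0 by (auto intro: order_antisym)
  qed
qed

text \<open>Take a norming functional of \<open>v \<ominus> w\<close>. Many vector equations below
  are proved this way: after applying a functional they become identities between numbers.\<close>

lemma dual_separates:
  assumes "v \<in> carrier X" "w \<in> carrier X" "\<And>f. f \<in> dual K X \<Longrightarrow> f v = f w"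
  shows "v = w"
proof -
  obtain f where f: "f \<in> dual K X" "cmod (f (v \<ominus> w)) = nrm X (v \<ominus> w)"
    using norming_functional[of "v \<ominus> w"] assms(1,2) by (metis M.minus_closed)
  then have "nrm X (v \<ominus> w) = 0" using assms(1,2) assms(3)[OF f(1)] by (simp add: dual_diff)
  then show ?thesis using Metric_space.zero[OF Metric_space_norm_dist, of v w] assms
    by (simp add: norm_dist_def)
qed

end

section \<open>Conjugate exponents and the unit ball of \<open>\<ell>\<^sub>q\<close>\<close>

definition lq_ball :: "real \<Rightarrow> (nat \<Rightarrow> complex) set" where
  "lq_ball q = {a. summable (\<lambda>k. cmod (a k) powr q) \<and> (\<Sum>k. cmod (a k) powr q) \<le> 1}"

text \<open>Bounds on finite sums carry over directly to convex combinations, shifts, dominated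
  sequences and coordinatewise limits.\<close>

lemma lq_ball_iff_partial_sums: "a \<in> lq_ball q \<longleftrightarrow> (\<forall>n. (\<Sum>k<n. cmod (a k) powr q) \<le> 1)"
proof
  assume "a \<in> lq_ball q"
  then show "\<forall>n. (\<Sum>k<n. cmod (a k) powr q) \<le> 1"
    by (auto simp: lq_ball_def intro!: order_trans[OF sum_le_suminf])
next
  assume *: "\<forall>n. (\<Sum>k<n. cmod (a k) powr q) \<le> 1"
  then have "summable (\<lambda>k. cmod (a k) powr q)"
    by (intro summableI_nonneg_bounded) auto
  with * show "a \<in> lq_ball q"
    by (simp add: lq_ball_def suminf_le_const)
qed

lemma sum_le_1_of_lq_ball:
  assumes "a \<in> lq_ball q" "finite I"
  shows "(\<Sum>k\<in>I. cmod (a k) powr q) \<le> 1"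
  using assms by (auto simp: lq_ball_def intro!: order_trans[OF sum_le_suminf])

lemma lq_ball_of_finite:
  assumes "finite I" "(\<Sum>k\<in>I. cmod (a k) powr q) \<le> 1" "\<And>k. k \<notin> I \<Longrightarrow> a k = 0"
  shows "a \<in> lq_ball q"
proof -
  have "(\<lambda>k. cmod (a k) powr q) sums (\<Sum>k\<in>I. cmod (a k) powr q)"
    using assms by (intro sums_finite) auto
  then show ?thesis
    using assms by (simp add: lq_ball_def sums_iff)
qed

lemma unit_in_lq_ball: "(\<lambda>k. if k = j then 1 else 0) \<in> lq_ball q"
  by (rule lq_ball_of_finite[of "{j}"]) auto

lemma lq_ball_mono: "a \<in> lq_ball q \<Longrightarrow> 0 \<le> q \<Longrightarrow> (\<And>k. cmod (b k) \<le> cmod (a k)) \<Longrightarrow> b \<in> lq_ball q"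
  unfolding lq_ball_iff_partial_sums
proof
  fix n
  assume a: "\<forall>n. (\<Sum>k<n. cmod (a k) powr q) \<le> 1" and "0 \<le> q" "\<And>k. cmod (b k) \<le> cmod (a k)"
  then have "(\<Sum>k<n. cmod (b k) powr q) \<le> (\<Sum>k<n. cmod (a k) powr q)"
    by (intro sum_mono powr_mono2) auto
  with a show "(\<Sum>k<n. cmod (b k) powr q) \<le> 1"
    using order_trans by blast
qed

lemma lq_ball_shift: "a \<in> lq_ball q \<Longrightarrow> (\<lambda>k. if k < N then 0 else a (k - N)) \<in> lq_ball q"
proof -
  assume a: "a \<in> lq_ball q"
  have "(\<Sum>k<n. cmod (if k < N then 0 else a (k - N)) powr q) \<le> 1" for n
  proof -
    have "(\<Sum>k<n. cmod (if k < N then 0 else a (k - N)) powr q) = (\<Sum>k\<in>{N..<n}. cmod (a (k - N)) powr q)"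
      by (rule sum.mono_neutral_cong_right) auto
    also have "\<dots> = (\<Sum>k<n-N. cmod (a k) powr q)"
      by (rule sum.reindex_bij_witness[of _ "\<lambda>k. k + N" "\<lambda>k. k - N"]) auto
    also have "\<dots> \<le> 1"
      using a by (simp add: lq_ball_iff_partial_sums)
    finally show ?thesis .
  qed
  then show ?thesis by (simp add: lq_ball_iff_partial_sums)
qed

text \<open>If one argument is 0, the claim reduces to \<open>s powr q \<le> s\<close> on [0,1]; the
  interior case is the convexity of the power function on the positive half-line.\<close>

lemma powr_convex_nonneg:
  fixes x y :: real
  assumes "1 \<le> q" "0 \<le> x" "0 \<le> y" "0 \<le> t" "t \<le> 1"
  shows "(t * x + (1 - t) * y) powr q \<le> t * x powr q + (1 - t) * y powr q"
proof -
  have le: "s powr q \<le> s" if "0 \<le> s" "s \<le> 1" for s :: real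
    using powr_mono'[of 1 q s] that assms by simp
  consider "t = 0" | "t = 1" | "x = 0" | "y = 0" | "0 < t" "t < 1" "0 < x" "0 < y"
    using assms by linarith
  then show ?thesis
  proof cases
    case 3
    have "((1 - t) * y) powr q \<le> (1 - t) * y powr q"
      using assms le[of "1 - t"] by (simp add: powr_mult mult_right_mono)
    with 3 show ?thesis by simp
  next
    case 4
    have "(t * x) powr q \<le> t * x powr q"
      using assms le[of t] by (simp add: powr_mult mult_right_mono)
    with 4 show ?thesis by simp
  next
    case 5
    then show ?thesis
      using powr_convex[OF assms(1)] convex_onD[of "{0<..}" "\<lambda>x. x powr q" "1 - t" x y] by simp
  qed auto
qed

lemma lq_ball_convex:
  assumes "1 \<le> q" "a \<in> lq_ball q" "b \<in> lq_ball q" "0 \<le> t" "t \<le> 1"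
  shows "(\<lambda>k. complex_of_real t * a k + complex_of_real (1 - t) * b k) \<in> lq_ball q"
  unfolding lq_ball_iff_partial_sums
proof
  fix n
  have "cmod (complex_of_real t * a k + complex_of_real (1 - t) * b k) powr q
      \<le> t * cmod (a k) powr q + (1 - t) * cmod (b k) powr q" for k
  proof -
    have "cmod (complex_of_real t * a k + complex_of_real (1 - t) * b k)
        \<le> t * cmod (a k) + (1 - t) * cmod (b k)"
      using norm_triangle_ineq[of "complex_of_real t * a k" "complex_of_real (1 - t) * b k"] assms(4,5)
      by (simp add: norm_mult del: of_real_diff)
    then have "cmod (complex_of_real t * a k + complex_of_real (1 - t) * b k) powr q
        \<le> (t * cmod (a k) + (1 - t) * cmod (b k)) powr q"
      using assms by (intro powr_mono2) auto
    also have "\<dots> \<le> t * cmod (a k) powr q + (1 - t) * cmod (b k) powr q"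
      using assms by (intro powr_convex_nonneg) auto
    finally show ?thesis .
  qed
  then have "(\<Sum>k<n. cmod (complex_of_real t * a k + complex_of_real (1 - t) * b k) powr q)
      \<le> (\<Sum>k<n. t * cmod (a k) powr q + (1 - t) * cmod (b k) powr q)"
    by (intro sum_mono)
  also have "\<dots> = t * (\<Sum>k<n. cmod (a k) powr q) + (1 - t) * (\<Sum>k<n. cmod (b k) powr q)"
    by (simp add: sum.distrib sum_distrib_left)
  also have "\<dots> \<le> t * 1 + (1 - t) * 1"
    using assms by (intro add_mono mult_left_mono) (auto simp: lq_ball_iff_partial_sums)
  finally show "(\<Sum>k<n. cmod (complex_of_real t * a k + complex_of_real (1 - t) * b k) powr q) \<le> 1"
    by simp
qed

lemma lq_ball_coordinatewise_limit:
  assumes q: "0 < q" and a: "\<And>n. a n \<in> lq_ball q" and lim: "\<And>k. (\<lambda>n. a n k) \<longlonglongrightarrow> b k"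
  shows "b \<in> lq_ball q"
  unfolding lq_ball_iff_partial_sums
proof
  fix m
  have "(\<lambda>n. \<Sum>k<m. cmod (a n k) powr q) \<longlonglongrightarrow> (\<Sum>k<m. cmod (b k) powr q)"
    using q by (intro tendsto_sum tendsto_powr' tendsto_norm lim tendsto_const) auto
  then show "(\<Sum>k<m. cmod (b k) powr q) \<le> 1"
    using a by (intro LIMSEQ_le_const2) (auto simp: lq_ball_iff_partial_sums)
qed

text \<open>All entries lie in the closed unit disc, so the sequences lie in a countable product of
  discs, which is compact and metrizable; the limit stays in the ball since bounds on finite sums
  pass to the limit.\<close>

lemma lq_ball_sequentially_compact:
  fixes a :: "nat \<Rightarrow> nat \<Rightarrow> complex"
  assumes q: "0 < q" and a: "\<And>n. a n \<in> lq_ball q"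
  obtains \<sigma> b where "strict_mono \<sigma>" "b \<in> lq_ball q" "\<And>k. (\<lambda>n. a (\<sigma> n) k) \<longlonglongrightarrow> b k"
proof -
  have coord: "cmod (a n k) \<le> 1" for n k
  proof (rule ccontr)
    assume "\<not> cmod (a n k) \<le> 1"
    then have "1 < cmod (a n k) powr q"
      using q by simp
    moreover have "(\<Sum>j\<in>{k}. cmod (a n j) powr q) \<le> 1"
      by (rule sum_le_1_of_lq_ball[OF a]) simp
    ultimately show False by simp
  qed
  have "compactin (product_topology (\<lambda>k::nat. euclidean :: complex topology) UNIV)
      (Pi\<^sub>E UNIV (\<lambda>k. cball 0 1))"
    by (simp add: compactin_PiE)
  then have "compact (Pi\<^sub>E UNIV (\<lambda>k::nat. cball (0::complex) 1))"
    by (simp add: euclidean_product_topology)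
  then have "seq_compact (Pi\<^sub>E UNIV (\<lambda>k::nat. cball (0::complex) 1))"
    by (simp only: compact_eq_seq_compact_metric)
  then have "(\<forall>n. a n \<in> Pi\<^sub>E UNIV (\<lambda>k::nat. cball (0::complex) 1)) \<longrightarrow>
      (\<exists>b\<in>Pi\<^sub>E UNIV (\<lambda>k. cball 0 1). \<exists>\<sigma>. strict_mono \<sigma> \<and> (a \<circ> \<sigma>) \<longlonglongrightarrow> b)"
    unfolding seq_compact_def by (rule spec)
  then obtain b \<sigma> where \<sigma>: "strict_mono \<sigma>" and lim: "(a \<circ> \<sigma>) \<longlonglongrightarrow> b"
    using coord by (auto simp: PiE_iff)
  have lim': "(\<lambda>n. a (\<sigma> n) k) \<longlonglongrightarrow> b k" for k
    using continuous_on_tendsto_compose[OF continuous_on_product_coordinates[of k] lim]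
    by (simp add: comp_def)
  have "b \<in> lq_ball q"
    using lq_ball_coordinatewise_limit[OF q, of "\<lambda>n. a (\<sigma> n)" b] a lim' by blast
  with \<sigma> lim' show ?thesis using that by blast
qed

section \<open>Pairing of \<open>\<ell>\<^sub>q\<close> with its conjugate space\<close>

locale conjugate_exponents =
  fixes q q' :: real
  assumes q_gt_1: "1 < q" and q'_gt_1: "1 < q'" and conjugate: "1 / q + 1 / q' = 1"
begin

text \<open>The factors \<open>1/q\<close> and \<open>1/q'\<close> are dropped. This crude form
  takes the place of Hoelder's inequality, since for the bounds below any finite constant will
  do.\<close>

lemma Young: "cmod (c * d) \<le> cmod c powr q + cmod d powr q'"
proof -
  have "cmod (c * d) \<le> cmod c powr q / q + cmod d powr q' / q'"
    using Youngs_inequality[OF q_gt_1 q'_gt_1 conjugate, of "cmod c" "cmod d"] by (simp add: norm_mult)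
  also have "\<dots> \<le> cmod c powr q + cmod d powr q'"
    using q_gt_1 q'_gt_1 by (intro add_mono) (simp_all add: divide_le_eq mult_le_cancel_left1)
  finally show ?thesis .
qed

text \<open>The free weight \<epsilon> makes the contribution of \<open>c\<close> small at the
  expense of that of \<open>d\<close>.\<close>

lemma Young_scaled:
  assumes "0 < \<epsilon>"
  shows "cmod (c * d) \<le> \<epsilon> powr q * cmod c powr q + cmod d powr q' / \<epsilon> powr q'"
proof -
  have "cmod (c * d) = cmod ((complex_of_real \<epsilon> * c) * (d / complex_of_real \<epsilon>))"
    using assms by simp
  also have "\<dots> \<le> cmod (complex_of_real \<epsilon> * c) powr q + cmod (d / complex_of_real \<epsilon>) powr q'"
    by (rule Young)
  finally show ?thesis
    using assms by (simp add: norm_mult norm_divide powr_mult powr_divide)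
qed

lemma
  assumes a: "a \<in> lq_ball q" and b: "summable (\<lambda>k. cmod (b k) powr q')"
  shows summable_norm_pairing: "summable (\<lambda>k. cmod (a k * b k))"
    and summable_pairing: "summable (\<lambda>k. a k * b k)"
    and pairing_bound: "cmod (\<Sum>k. a k * b k) \<le> 1 + (\<Sum>k. cmod (b k) powr q')"
proof -
  have a': "summable (\<lambda>k. cmod (a k) powr q)" "(\<Sum>k. cmod (a k) powr q) \<le> 1"
    using a by (auto simp: lq_ball_def)
  show s: "summable (\<lambda>k. cmod (a k * b k))"
    by (rule summable_comparison_test'[OF summable_add[OF a'(1) b]]) (use Young in simp)
  then show "summable (\<lambda>k. a k * b k)"
    by (rule summable_norm_cancel)
  have "cmod (\<Sum>k. a k * b k) \<le> (\<Sum>k. cmod (a k * b k))"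
    by (rule summable_norm[OF s])
  also have "\<dots> \<le> (\<Sum>k. cmod (a k) powr q + cmod (b k) powr q')"
    by (intro suminf_le s summable_add a' b Young)
  also have "\<dots> = (\<Sum>k. cmod (a k) powr q) + (\<Sum>k. cmod (b k) powr q')"
    by (rule suminf_add[OF a'(1) b, symmetric])
  finally show "cmod (\<Sum>k. a k * b k) \<le> 1 + (\<Sum>k. cmod (b k) powr q')"
    using a'(2) by simp
qed

text \<open>\<open>N\<close> depends on \<open>b\<close> and \<open>e\<close> only. The weight
  satisfies \<open>\<epsilon> powr q = e / 2\<close>, which bounds the share of every
  \<open>a\<close> in the ball; then \<open>N\<close> makes the tail of \<open>b\<close>, divided by
  \<open>\<epsilon> powr q'\<close>, at most \<open>e / 2\<close>.\<close>

lemma uniformly_small_tails: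
  assumes b: "summable (\<lambda>k. cmod (b k) powr q')" and e: "0 < e"
  obtains N where "\<And>a. a \<in> lq_ball q \<Longrightarrow> cmod (\<Sum>k. a (k + N) * b (k + N)) \<le> e"
proof -
  define \<epsilon> where "\<epsilon> = (e / 2) powr (1 / q)"
  have \<epsilon>: "0 < \<epsilon>" "\<epsilon> powr q = e / 2"
    using e q_gt_1 by (auto simp: \<epsilon>_def powr_powr)
  have "0 < e / 2 * \<epsilon> powr q'"
    using e \<epsilon> by simp
  from suminf_exist_split[OF this b] obtain N
    where "norm (\<Sum>k. cmod (b (k + N)) powr q') < e / 2 * \<epsilon> powr q'"
    by blast
  then have N: "(\<Sum>k. cmod (b (k + N)) powr q') / \<epsilon> powr q' \<le> e / 2"
    using \<epsilon> by (simp add: field_simps)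
  show ?thesis
  proof (rule that)
    fix a assume a: "a \<in> lq_ball q"
    have bN: "summable (\<lambda>k. cmod (b (k + N)) powr q')"
      using b summable_iff_shift[of "\<lambda>k. cmod (b k) powr q'" N] by simp
    have aN: "summable (\<lambda>k. cmod (a (k + N)) powr q)"
      using a summable_iff_shift[of "\<lambda>k. cmod (a k) powr q" N] by (simp add: lq_ball_def)
    have s: "summable (\<lambda>k. cmod (a (k + N) * b (k + N)))"
      using summable_iff_shift[of "\<lambda>k. cmod (a k * b k)" N] summable_norm_pairing[OF a b] by simp
    have "(\<Sum>k. cmod (a (k + N)) powr q) \<le> (\<Sum>k. cmod (a k) powr q)"
      using a suminf_split_initial_segment[of "\<lambda>k. cmod (a k) powr q" N]
      by (simp add: lq_ball_def sum_nonneg)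
    then have le1: "(\<Sum>k. cmod (a (k + N)) powr q) \<le> 1"
      using a by (simp add: lq_ball_def)
    have "cmod (\<Sum>k. a (k + N) * b (k + N)) \<le> (\<Sum>k. cmod (a (k + N) * b (k + N)))"
      by (rule summable_norm[OF s])
    also have "\<dots> \<le> (\<Sum>k. \<epsilon> powr q * cmod (a (k + N)) powr q + cmod (b (k + N)) powr q' / \<epsilon> powr q')"
      by (intro suminf_le s summable_add summable_mult summable_divide aN bN Young_scaled \<epsilon>)
    also have "\<dots> = \<epsilon> powr q * (\<Sum>k. cmod (a (k + N)) powr q)
        + (\<Sum>k. cmod (b (k + N)) powr q') / \<epsilon> powr q'"
      using aN bN by (simp add: suminf_add[symmetric] suminf_mult suminf_divide summable_mult summable_divide)
    also have "\<dots> \<le> \<epsilon> powr q * 1 + e / 2"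
      using le1 N by (intro add_mono mult_left_mono) auto
    finally show "cmod (\<Sum>k. a (k + N) * b (k + N)) \<le> e"
      using \<epsilon> by simp
  qed
qed

text \<open>Tails are small uniformly over the ball, because \<open>q'\<close> is finite; the
  finitely many remaining coordinates converge. Each of the two tails may take \<open>e / 4\<close>,
  the finite part \<open>e / 2\<close>.\<close>

lemma pairing_tendsto:
  assumes a: "\<And>n. a n \<in> lq_ball q" and c: "c \<in> lq_ball q" and lim: "\<And>k. (\<lambda>n. a n k) \<longlonglongrightarrow> c k"
    and b: "summable (\<lambda>k. cmod (b k) powr q')"
  shows "(\<lambda>n. \<Sum>k. a n k * b k) \<longlonglongrightarrow> (\<Sum>k. c k * b k)"
proof (rule LIMSEQ_I)
  fix e :: real assume e: "0 < e"
  then have "0 < e / 4" by simp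
  from uniformly_small_tails[OF b this]
  obtain N where N: "\<And>a. a \<in> lq_ball q \<Longrightarrow> cmod (\<Sum>k. a (k + N) * b (k + N)) \<le> e / 4"
    by blast
  have split: "(\<Sum>k. d k * b k) = (\<Sum>k. d (k + N) * b (k + N)) + (\<Sum>k<N. d k * b k)" if "d \<in> lq_ball q" for d
    using suminf_split_initial_segment[OF summable_pairing[OF that b]] .
  have "(\<lambda>n. \<Sum>k<N. a n k * b k) \<longlonglongrightarrow> (\<Sum>k<N. c k * b k)"
    by (intro tendsto_intros lim)
  from LIMSEQ_D[OF this half_gt_zero[OF e]]
  obtain n0 where n0: "\<And>n. n \<ge> n0 \<Longrightarrow> cmod ((\<Sum>k<N. a n k * b k) - (\<Sum>k<N. c k * b k)) < e / 2"
    by blast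
  have "cmod ((\<Sum>k. a n k * b k) - (\<Sum>k. c k * b k)) < e" if "n \<ge> n0" for n
  proof -
    have "cmod ((\<Sum>k. a n k * b k) - (\<Sum>k. c k * b k))
        = cmod (((\<Sum>k. a n (k + N) * b (k + N)) - (\<Sum>k. c (k + N) * b (k + N)))
        + ((\<Sum>k<N. a n k * b k) - (\<Sum>k<N. c k * b k)))"
      by (simp only: split[OF a] split[OF c] add_diff_add)
    also have "\<dots> \<le> cmod ((\<Sum>k. a n (k + N) * b (k + N)) - (\<Sum>k. c (k + N) * b (k + N)))
        + cmod ((\<Sum>k<N. a n k * b k) - (\<Sum>k<N. c k * b k))"
      by (rule norm_triangle_ineq)
    also have "\<dots> \<le> (cmod (\<Sum>k. a n (k + N) * b (k + N)) + cmod (\<Sum>k. c (k + N) * b (k + N)))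
        + cmod ((\<Sum>k<N. a n k * b k) - (\<Sum>k<N. c k * b k))"
      by (rule add_right_mono[OF norm_triangle_ineq4])
    also have "\<dots> < e"
      using N[OF a[of n]] N[OF c] n0[OF that] by linarith
    finally show ?thesis .
  qed
  then show "\<exists>n0. \<forall>n\<ge>n0. cmod ((\<Sum>k. a n k * b k) - (\<Sum>k. c k * b k)) < e"
    by blast
qed

text \<open>Tested on \<open>a\<^sub>k = cnj (b\<^sub>k) |b\<^sub>k|\<^bsup>q'-2\<^esup> / S\<^bsup>1/q\<^esup>\<close> for \<open>k < m\<close>, where \<open>S\<close> is the sum of
  \<open>|b\<^sub>k|\<^bsup>q'\<^esup>\<close> over \<open>k < m\<close>.\<close>

lemma summable_of_bounded_pairing:
  assumes K: "K = \<real> \<or> K = UNIV" and b: "range b \<subseteq> K"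
    and bound: "\<And>a m. a \<in> lq_ball q \<Longrightarrow> range a \<subseteq> K \<Longrightarrow> (\<And>k. m \<le> k \<Longrightarrow> a k = 0)
      \<Longrightarrow> cmod (\<Sum>k<m. a k * b k) \<le> C"
  shows "summable (\<lambda>k. cmod (b k) powr q')"
proof (rule summableI_nonneg_bounded)
  fix m
  define S where "S = (\<Sum>k<m. cmod (b k) powr q')"
  have S_nonneg: "0 \<le> S" by (simp add: S_def sum_nonneg)
  \<comment> \<open>This identity turns \<open>cmod (a k) powr q\<close> into
    \<open>cmod (b k) powr q' / S\<close>, so that \<open>a\<close> lies on the unit sphere.\<close>
  have qq: "(q' - 1) * q = q'"
    using conjugate q_gt_1 q'_gt_1 by (simp add: field_simps)
  show "(\<Sum>k<m. cmod (b k) powr q') \<le> C powr q'"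
  proof (cases "S = 0")
    case False
    with S_nonneg have S: "0 < S" by simp
    \<comment> \<open>If \<open>b k = 0\<close>, the factor \<open>cnj (b k)\<close> makes
      \<open>a k\<close> vanish, also when the exponent \<open>q' - 2\<close> is negative.\<close>
    define a where "a k = (if k < m then cnj (b k) * complex_of_real (cmod (b k) powr (q' - 2) / S powr (1 / q)) else 0)" for k
    have cmod_a: "cmod (a k) = cmod (b k) powr (q' - 1) / S powr (1 / q)" if "k < m" for k
    proof (cases "b k = 0")
      case False
      have "cmod (b k) * cmod (b k) powr (q' - 2) = cmod (b k) powr (q' - 1)"
        using False powr_mult_base[of "cmod (b k)" "q' - 2"] by simp
      then show ?thesis using that by (simp add: a_def norm_mult norm_divide)
    qed (use that in \<open>simp add: a_def\<close>)
    have a_b: "a k * b k = complex_of_real (cmod (b k) powr q' / S powr (1 / q))" if "k < m" for k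
    proof (cases "b k = 0")
      case False
      have "cmod (b k) ^ 2 * cmod (b k) powr (q' - 2) = cmod (b k) powr q'"
        using False by (simp add: powr_diff)
      moreover have "a k * b k = (b k * cnj (b k)) * complex_of_real (cmod (b k) powr (q' - 2) / S powr (1 / q))"
        using that by (simp add: a_def)
      ultimately show ?thesis
        by (simp add: complex_norm_square[symmetric] flip: of_real_power of_real_mult)
    qed (use that q'_gt_1 in \<open>simp add: a_def\<close>)
    have "(\<Sum>k<m. cmod (a k) powr q) = (\<Sum>k<m. cmod (b k) powr q' / S)"
      using S q_gt_1 by (intro sum.cong refl) (simp add: cmod_a powr_divide powr_powr qq)
    also have "\<dots> = 1"
      using S by (simp add: sum_divide_distrib[symmetric] S_def)
    finally have "a \<in> lq_ball q"
      by (intro lq_ball_of_finite[of "{..<m}"]) (auto simp: a_def)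
    moreover have "range a \<subseteq> K"
      using K b by (auto simp: a_def Reals_cnj_iff image_subset_iff intro!: Reals_mult)
    ultimately have "cmod (\<Sum>k<m. a k * b k) \<le> C"
      by (rule bound) (simp add: a_def)
    moreover have "(\<Sum>k<m. a k * b k) = complex_of_real (S / S powr (1 / q))"
      by (simp add: a_b S_def sum_divide_distrib)
    ultimately have "S / S powr (1 / q) \<le> C"
      using S by (simp add: norm_divide)
    moreover have "S / S powr (1 / q) = S powr (1 / q')"
    proof -
      have "1 / q' = 1 - 1 / q" using conjugate by simp
      then show ?thesis using S by (simp add: powr_diff)
    qed
    ultimately have "(S powr (1 / q')) powr q' \<le> C powr q'"
      using q'_gt_1 by (intro powr_mono2) auto
    then show ?thesis
      using S q'_gt_1 by (simp add: powr_powr S_def)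
  qed (use S_def in simp)
qed simp

end

context real_or_complex_banach_space
begin

section \<open>The uniform boundedness principle\<close>

text \<open>Values stay in \<open>K\<close> because \<open>K\<close> is closed. The bound is asked
  of the limit alone, where the gliding sum provides it.\<close>

lemma dualI_of_limit:
  assumes F_in: "\<And>n v. v \<in> carrier X \<Longrightarrow> F n v \<in> K"
    and F_add: "\<And>n v w. v \<in> carrier X \<Longrightarrow> w \<in> carrier X \<Longrightarrow> F n (v \<oplus> w) = F n v + F n w"
    and F_smult: "\<And>n c v. c \<in> K \<Longrightarrow> v \<in> carrier X \<Longrightarrow> F n (c \<odot> v) = c * F n v"
    and lim: "\<And>v. v \<in> carrier X \<Longrightarrow> (\<lambda>n. F n v) \<longlonglongrightarrow> f v"
    and bound: "\<And>v. v \<in> carrier X \<Longrightarrow> cmod (f v) \<le> C * nrm X v"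
  shows "f \<in> dual K X"
  unfolding dual_def mem_Collect_eq
proof (intro conjI ballI)
  show "f \<in> carrier X \<rightarrow> K"
    using closed_sequentially[OF K_topologically_closed F_in lim] by blast
  show "f (v \<oplus> w) = f v + f w" if "v \<in> carrier X" "w \<in> carrier X" for v w
    using LIMSEQ_unique[OF lim[of "v \<oplus> w"]] tendsto_add[OF lim[OF that(1)] lim[OF that(2)]] that F_add
    by simp
  show "f (c \<odot> v) = c * f v" if "c \<in> K" "v \<in> carrier X" for c v
    using LIMSEQ_unique[OF lim[of "c \<odot> v"]] tendsto_mult_left[OF lim[OF that(2)], of c] that F_smult
    by simp
qed (use bound in blast)

text \<open>If the norms on a weakly bounded set were unbounded, a gliding sum \<open>\<Sum> \<plusminus> 3\<^sup>-\<^sup>n g\<^sub>n\<close> of norming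
  functionals would be unbounded on it; the signs are chosen so that earlier terms cannot cancel
  the \<open>n\<close>-th one.\<close>

theorem weakly_bounded_imp_bounded:
  assumes S: "S \<subseteq> carrier X"
    and weak: "\<And>f. f \<in> dual K X \<Longrightarrow> \<exists>C. \<forall>s\<in>S. cmod (f s) \<le> C"
  shows "\<exists>C>0. \<forall>s\<in>S. nrm X s \<le> C"
proof (rule ccontr)
  assume unbounded: "\<not> (\<exists>C>0. \<forall>s\<in>S. nrm X s \<le> C)"
  \<comment> \<open>Growth 4^n against weights 3^-n: at \<open>s n\<close> the \<open>n\<close>-th
    term exceeds (4/3)^n, and all later terms together take away at most half of it.\<close>
  have "\<exists>s. s \<in> S \<and> 4 ^ n < nrm X s" for n :: nat
    using unbounded by (metis not_le zero_less_numeral zero_less_power)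
  then obtain s where sS: "\<And>n. s n \<in> S" and s_large: "\<And>n. 4 ^ n < nrm X (s n)"
    by metis
  have s: "s n \<in> carrier X" for n using sS S by blast
  have "\<exists>g. g \<in> dual K X \<and> (\<forall>v\<in>carrier X. cmod (g v) \<le> nrm X v) \<and> cmod (g (s n)) = nrm X (s n)" for n
    by (rule norming_functional[OF s[of n]]) blast
  then obtain g where g: "\<And>n. g n \<in> dual K X" and g_le: "\<And>n v. v \<in> carrier X \<Longrightarrow> cmod (g n v) \<le> nrm X v"
    and g_s: "\<And>n. cmod (g n (s n)) = nrm X (s n)"
    by metis
  define h where "h n v = complex_of_real ((1/3) ^ n) * g n v" for n v
  define F where "F = rec_nat (\<lambda>v. 0) (\<lambda>n f. if cmod (h n (s n)) \<le> cmod (f (s n) + h n (s n))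
    then (\<lambda>v. f v + h n v) else (\<lambda>v. f v - h n v))"
  have F0: "F 0 v = 0" for v by (simp add: F_def)
  have F_Suc: "F (Suc n) = (if cmod (h n (s n)) \<le> cmod (F n (s n) + h n (s n))
    then (\<lambda>v. F n v + h n v) else (\<lambda>v. F n v - h n v))" for n by (simp add: F_def)
  \<comment> \<open>As \<open>2 h = (F + h) - (F - h)\<close>, one of the two combinations has
    modulus at least that of \<open>h\<close>; the sign in \<open>F\<close> selects it.\<close>
  have F_Suc_ge: "(1/3) ^ n * nrm X (s n) \<le> cmod (F (Suc n) (s n))" for n
  proof -
    have h: "cmod (h n (s n)) = (1/3) ^ n * nrm X (s n)"
      by (simp add: h_def norm_mult g_s norm_power norm_divide)
    have "2 * cmod (h n (s n)) = cmod ((F n (s n) + h n (s n)) - (F n (s n) - h n (s n)))"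
      by (simp add: norm_mult flip: mult_2)
    also have "\<dots> \<le> cmod (F n (s n) + h n (s n)) + cmod (F n (s n) - h n (s n))"
      by (rule norm_triangle_ineq4)
    finally have "cmod (h n (s n)) \<le> cmod (F (Suc n) (s n))"
      by (simp add: F_Suc)
    then show ?thesis by (simp add: h)
  qed
  have F_in: "F n v \<in> K" if v: "v \<in> carrier X" for n v
  proof (induction n)
    case (Suc n)
    have "h n v \<in> K" unfolding h_def using dual_in[OF g v] by (intro K_closed K_of_real)
    with Suc show ?case by (simp add: F_Suc K_closed)
  qed (simp add: F0 K_closed)
  have F_add: "F n (v \<oplus> w) = F n v + F n w" if "v \<in> carrier X" "w \<in> carrier X" for n v w
  proof (induction n)
    case (Suc n)
    have "h n (v \<oplus> w) = h n v + h n w"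
      using that by (simp add: h_def dual_add[OF g] distrib_left)
    with Suc show ?case by (simp add: F_Suc)
  qed (simp add: F0)
  have F_smult: "F n (c \<odot> v) = c * F n v" if "c \<in> K" "v \<in> carrier X" for n c v
  proof (induction n)
    case (Suc n)
    have "h n (c \<odot> v) = c * h n v"
      using that by (simp add: h_def dual_smult[OF g])
    with Suc show ?case by (simp add: F_Suc algebra_simps)
  qed (simp add: F0)
  have step: "cmod (F (Suc n) v - F n v) \<le> (1/3) ^ n * nrm X v" if "v \<in> carrier X" for n v
  proof -
    have "cmod (F (Suc n) v - F n v) = (1/3) ^ n * cmod (g n v)"
      by (simp add: F_Suc h_def norm_mult norm_power norm_divide)
    then show ?thesis using g_le[OF that, of n] by (simp add: mult_left_mono)
  qed
  have geometric: "(\<lambda>k. (1/3) ^ (k + n) * c) sums ((3/2) * (1/3) ^ n * c)" for n and c :: real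
    using sums_mult[OF geometric_sums[of "1/3 :: real"], of "(1/3) ^ n * c"]
    by (simp add: power_add mult_ac)
  define f where "f v = (\<Sum>k. F (Suc k) v - F k v)" for v
  have summ: "summable (\<lambda>k. cmod (F (Suc k) v - F k v))" if "v \<in> carrier X" for v
    by (rule summable_comparison_test'[OF sums_summable[OF geometric[of 0 "nrm X v"]], of 0])
      (use step[OF that] in simp)
  have F_lim: "(\<lambda>n. F n v) \<longlonglongrightarrow> f v" if "v \<in> carrier X" for v
    using summable_LIMSEQ[OF summable_norm_cancel[OF summ[OF that]]]
    by (simp add: sum_lessThan_telescope[of "\<lambda>k. F k v"] F0 f_def)
  have f_diff: "cmod (f v - F n v) \<le> (3/2) * (1/3) ^ n * nrm X v" if v: "v \<in> carrier X" for v n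
  proof -
    have s1: "summable (\<lambda>k. cmod (F (Suc (k + n)) v - F (k + n) v))"
      using summable_iff_shift[of "\<lambda>k. cmod (F (Suc k) v - F k v)" n] summ[OF v] by simp
    have "f v - F n v = (\<Sum>k. F (Suc (k + n)) v - F (k + n) v)"
      using suminf_split_initial_segment[OF summable_norm_cancel[OF summ[OF v]], of n]
      by (simp add: f_def sum_lessThan_telescope[of "\<lambda>k. F k v"] F0)
    also have "cmod (\<Sum>k. F (Suc (k + n)) v - F (k + n) v) \<le> (\<Sum>k. cmod (F (Suc (k + n)) v - F (k + n) v))"
      by (rule summable_norm[OF s1])
    also have "\<dots> \<le> (\<Sum>k. (1/3) ^ (k + n) * nrm X v)"
      by (intro suminf_le step v s1 sums_summable[OF geometric])
    also have "\<dots> = (3/2) * (1/3) ^ n * nrm X v"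
      using geometric by (simp only: sums_iff)
    finally show ?thesis .
  qed
  have "f \<in> dual K X"
    using dualI_of_limit[of F f "3/2"] F_in F_add F_smult F_lim f_diff[of _ 0] by (simp add: F0)
  then obtain C where C: "\<And>t. t \<in> S \<Longrightarrow> cmod (f t) \<le> C"
    using weak by blast
  have "(4/3) ^ n \<le> 2 * C" for n :: nat
  proof -
    have "(1/3) ^ n * nrm X (s n) \<le> cmod (F (Suc n) (s n))"
      by (rule F_Suc_ge)
    also have "\<dots> \<le> cmod (f (s n)) + cmod (f (s n) - F (Suc n) (s n))"
      by (metis norm_minus_commute norm_triangle_sub)
    \<comment> \<open>The tail after step \<open>Suc n\<close> has weight
      \<open>(3/2) * (1/3) ^ Suc n\<close>, half the weight of the \<open>n\<close>-th term.\<close>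
    also have "\<dots> \<le> C + (1/2) * ((1/3) ^ n * nrm X (s n))"
      using C[OF sS[of n]] f_diff[OF s, of n "Suc n"] by simp
    finally have "(1/3) ^ n * nrm X (s n) \<le> 2 * C"
      by simp
    moreover have "(1/3) ^ n * 4 ^ n \<le> (1/3) ^ n * nrm X (s n)"
      using s_large[of n] by (intro mult_left_mono) auto
    moreover have "(1/3) ^ n * 4 ^ n = (4/3 :: real) ^ n"
      by (simp add: power_mult_distrib[symmetric])
    ultimately show ?thesis by simp
  qed
  moreover obtain n where "2 * C < (4/3) ^ n"
    using real_arch_pow[of "4/3" "2 * C"] by auto
  ultimately show False
    by (metis not_le)
qed

section \<open>Norm convergence and series\<close>

lemma minus_in_carrier: "v \<in> carrier X \<Longrightarrow> w \<in> carrier X \<Longrightarrow> v \<ominus> w \<in> carrier X"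
  by simp

lemma nrm_diff_commute: "v \<in> carrier X \<Longrightarrow> w \<in> carrier X \<Longrightarrow> nrm X (v \<ominus> w) = nrm X (w \<ominus> v)"
  using Metric_space.commute[OF Metric_space_norm_dist, of v w] by (simp add: norm_dist_def)

lemma Cauchy_imp_convergent:
  assumes u: "\<And>n. u n \<in> carrier X"
    and Cauchy: "\<And>e. 0 < e \<Longrightarrow> \<exists>N. \<forall>m\<ge>N. \<forall>n\<ge>N. nrm X (u m \<ominus> u n) < e"
  obtains l where "l \<in> carrier X" "(\<lambda>n. nrm X (u n \<ominus> l)) \<longlonglongrightarrow> 0"
proof -
  interpret Metric_space "carrier X" "norm_dist X" by (rule Metric_space_norm_dist)
  have "MCauchy u"
    unfolding MCauchy_def using u Cauchy by (auto simp: norm_dist_def)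
  then obtain l where l: "limitin mtopology u l sequentially"
    using complete unfolding mcomplete_def by blast
  have lX: "l \<in> carrier X" using l limitin_mspace by blast
  have "(\<lambda>n. norm_dist X (u n) l) \<longlonglongrightarrow> 0"
    using l limitin_metric_dist_null by blast
  then show ?thesis using that[OF lX] u lX by (simp add: norm_dist_def)
qed

lemma dual_tendsto:
  assumes f: "f \<in> dual K X" and u: "\<And>n. u n \<in> carrier X" and l: "l \<in> carrier X"
    and lim: "(\<lambda>n. nrm X (u n \<ominus> l)) \<longlonglongrightarrow> 0"
  shows "(\<lambda>n. f (u n)) \<longlonglongrightarrow> f l"
proof -
  obtain C where C: "\<And>v. v \<in> carrier X \<Longrightarrow> cmod (f v) \<le> C * nrm X v"
    by (rule dual_bound[OF f]) blast
  have "(\<lambda>n. f (u n) - f l) \<longlonglongrightarrow> 0"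
  proof (rule Lim_null_comparison)
    show "\<forall>\<^sub>F n in sequentially. cmod (f (u n) - f l) \<le> C * nrm X (u n \<ominus> l)"
      using C[OF minus_in_carrier[OF u l]] by (simp add: dual_diff[OF f] u l)
    show "(\<lambda>n. C * nrm X (u n \<ominus> l)) \<longlonglongrightarrow> 0"
      using tendsto_mult_left[OF lim, of C] by simp
  qed
  then show ?thesis by (simp add: LIM_zero_iff)
qed

text \<open>A norming functional of the limit reduces this to limits of numbers.\<close>

lemma nrm_limit_le:
  assumes u: "\<And>n. u n \<in> carrier X" and l: "l \<in> carrier X"
    and lim: "(\<lambda>n. nrm X (u n \<ominus> l)) \<longlonglongrightarrow> 0" and le: "\<And>n. nrm X (u n) \<le> C"
  shows "nrm X l \<le> C"
proof -
  obtain f where f: "f \<in> dual K X" and f_le: "\<And>v. v \<in> carrier X \<Longrightarrow> cmod (f v) \<le> nrm X v"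
    and f_l: "cmod (f l) = nrm X l"
    by (rule norming_functional[OF l]) blast
  have "(\<lambda>n. cmod (f (u n))) \<longlonglongrightarrow> cmod (f l)"
    by (intro tendsto_norm dual_tendsto[OF f u l lim])
  then have "cmod (f l) \<le> C"
    using order_trans[OF f_le[OF u] le] by (intro LIMSEQ_le_const2) auto
  then show ?thesis by (simp add: f_l)
qed

lemma finsum_in_carrier: "(\<And>k. k \<in> I \<Longrightarrow> g k \<in> carrier X) \<Longrightarrow> finsum X g I \<in> carrier X"
  by (rule M.finsum_closed) auto

lemma dual_finsum:
  assumes f: "f \<in> dual K X" and "finite I" and "\<And>k. k \<in> I \<Longrightarrow> g k \<in> carrier X"
  shows "f (finsum X g I) = (\<Sum>k\<in>I. f (g k))"
  using assms(2,3)
proof (induction I rule: finite_induct)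
  case empty
  then show ?case using f by simp
next
  case (insert k I)
  have "finsum X g (insert k I) = g k \<oplus> finsum X g I"
    using insert by (intro M.finsum_insert) auto
  moreover have "finsum X g I \<in> carrier X"
    using insert by (intro finsum_in_carrier) auto
  ultimately show ?case
    using insert by (simp add: dual_add[OF f])
qed

end

section \<open>Weakly summable sequences and \<open>(p,r)-conv\<close>\<close>

text \<open>\<open>q\<close> is the index r of the coefficients; weak summability enters with the
  conjugate exponent \<open>q'\<close>, the one that pairs with them. Weakly p-summable sequences
  qualify when p is at most \<open>q'\<close>.\<close>

locale weakly_summable_sequence =
  real_or_complex_banach_space K X + conjugate_exponents q q'
  for K and X :: "('a, 'm) normed_module_scheme" (structure) and q q' +
  fixes z :: "nat \<Rightarrow> 'a"
  assumes z_in: "z k \<in> carrier X"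
    and z_weakly_summable: "f \<in> dual K X \<Longrightarrow> summable (\<lambda>k. cmod (f (z k)) powr q')"
begin

definition scalar_ball :: "(nat \<Rightarrow> complex) set" where
  "scalar_ball = {a \<in> lq_ball q. range a \<subseteq> K}"

lemma scalar_ballD: "a \<in> scalar_ball \<Longrightarrow> a \<in> lq_ball q" "a \<in> scalar_ball \<Longrightarrow> a k \<in> K"
  by (auto simp: scalar_ball_def)

lemma smult_z_in: "a k \<in> K \<Longrightarrow> a k \<odot> z k \<in> carrier X"
  by (simp add: z_in)

lemma dual_partial_sum:
  assumes f: "f \<in> dual K X" and I: "finite I" and a: "\<And>k. a k \<in> K"
  shows "f (\<Oplus>k\<in>I. a k \<odot> z k) = (\<Sum>k\<in>I. a k * f (z k))"
proof -
  have "f (\<Oplus>k\<in>I. a k \<odot> z k) = (\<Sum>k\<in>I. f (a k \<odot> z k))"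
    by (rule dual_finsum[OF f I]) (simp add: smult_z_in a)
  then show ?thesis by (simp add: dual_smult[OF f a z_in])
qed

text \<open>Finite combinations with coefficients in the unit ball are weakly bounded by Young's
  inequality, hence norm bounded. Arbitrary finite index sets and the scale \<delta> make the bound
  applicable to blocks of a series.\<close>

lemma partial_sums_bounded:
  obtains C where "0 < C" "\<And>(I :: nat set) a \<delta>. finite I \<Longrightarrow> (\<And>k. a k \<in> K) \<Longrightarrow> 0 < \<delta>
    \<Longrightarrow> (\<Sum>k\<in>I. cmod (a k) powr q) \<le> \<delta> powr q \<Longrightarrow> nrm X (\<Oplus>k\<in>I. a k \<odot> z k) \<le> C * \<delta>"
proof -
  define S where "S = {(\<Oplus>k\<in>I. a k \<odot> z k) | (I :: nat set) a. finite I \<and> (\<forall>k. a k \<in> K)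
    \<and> (\<Sum>k\<in>I. cmod (a k) powr q) \<le> 1}"
  have "\<exists>C>0. \<forall>s\<in>S. nrm X s \<le> C"
  proof (rule weakly_bounded_imp_bounded)
    show "S \<subseteq> carrier X"
      by (auto simp: S_def intro!: finsum_in_carrier smult_z_in)
  next
    fix f assume f: "f \<in> dual K X"
    have "cmod (f (\<Oplus>k\<in>I. a k \<odot> z k)) \<le> 1 + (\<Sum>k. cmod (f (z k)) powr q')"
      if I: "finite I" and a: "\<And>k. a k \<in> K" and le: "(\<Sum>k\<in>I. cmod (a k) powr q) \<le> 1" for I :: "nat set" and a
    proof -
      have "cmod (f (\<Oplus>k\<in>I. a k \<odot> z k)) \<le> (\<Sum>k\<in>I. cmod (a k * f (z k)))"
        by (simp add: dual_partial_sum[OF f I a] norm_sum)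
      also have "\<dots> \<le> (\<Sum>k\<in>I. cmod (a k) powr q + cmod (f (z k)) powr q')"
        by (intro sum_mono Young)
      also have "\<dots> = (\<Sum>k\<in>I. cmod (a k) powr q) + (\<Sum>k\<in>I. cmod (f (z k)) powr q')"
        by (rule sum.distrib)
      also have "\<dots> \<le> 1 + (\<Sum>k. cmod (f (z k)) powr q')"
        using le I z_weakly_summable[OF f] by (intro add_mono sum_le_suminf) auto
      finally show ?thesis .
    qed
    then show "\<exists>C. \<forall>s\<in>S. cmod (f s) \<le> C"
      by (intro exI[of _ "1 + (\<Sum>k. cmod (f (z k)) powr q')"]) (auto simp: S_def)
  qed
  then obtain C where C: "0 < C" "\<And>s. s \<in> S \<Longrightarrow> nrm X s \<le> C" by blast
  show ?thesis
  proof (rule that[OF C(1)])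
    fix I :: "nat set" and a and \<delta> :: real
    assume I: "finite I" and a: "\<And>k. a k \<in> K" and \<delta>: "0 < \<delta>"
      and le: "(\<Sum>k\<in>I. cmod (a k) powr q) \<le> \<delta> powr q"
    define b where "b k = a k / complex_of_real \<delta>" for k
    have b: "b k \<in> K" for k
      unfolding b_def by (intro K_closed a K_of_real)
    have "(\<Sum>k\<in>I. cmod (b k) powr q) = (\<Sum>k\<in>I. cmod (a k) powr q) / \<delta> powr q"
      using \<delta> by (simp add: b_def norm_divide powr_divide sum_divide_distrib)
    also have "\<dots> \<le> 1" using le \<delta> by simp
    finally have "(\<Oplus>k\<in>I. b k \<odot> z k) \<in> S"
      unfolding S_def using I b by blast
    then have "nrm X (\<Oplus>k\<in>I. b k \<odot> z k) \<le> C" by (rule C(2))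
    moreover have "(\<Oplus>k\<in>I. a k \<odot> z k) = complex_of_real \<delta> \<odot> (\<Oplus>k\<in>I. b k \<odot> z k)"
    proof (rule dual_separates)
      show "(\<Oplus>k\<in>I. a k \<odot> z k) \<in> carrier X"
        by (intro finsum_in_carrier smult_z_in a)
      have *: "(\<Oplus>k\<in>I. b k \<odot> z k) \<in> carrier X"
        by (intro finsum_in_carrier smult_z_in b)
      then show "complex_of_real \<delta> \<odot> (\<Oplus>k\<in>I. b k \<odot> z k) \<in> carrier X"
        by blast
      fix f assume f: "f \<in> dual K X"
      show "f (\<Oplus>k\<in>I. a k \<odot> z k) = f (complex_of_real \<delta> \<odot> (\<Oplus>k\<in>I. b k \<odot> z k))"
      proof -
        have "f (complex_of_real \<delta> \<odot> (\<Oplus>k\<in>I. b k \<odot> z k)) = (\<Sum>k\<in>I. complex_of_real \<delta> * (b k * f (z k)))"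
          by (simp only: dual_smult[OF f K_of_real *] dual_partial_sum[OF f I b] sum_distrib_left)
        also have "\<dots> = (\<Sum>k\<in>I. a k * f (z k))"
          using \<delta> by (simp add: b_def)
        finally show ?thesis by (simp only: dual_partial_sum[OF f I a])
      qed
    qed
    moreover have "(\<Oplus>k\<in>I. b k \<odot> z k) \<in> carrier X"
      by (intro finsum_in_carrier smult_z_in b)
    ultimately show "nrm X (\<Oplus>k\<in>I. a k \<odot> z k) \<le> C * \<delta>"
      using \<delta> by (simp add: nrm_smult mult.commute)
  qed
qed

text \<open>Weak summability of \<open>z\<close> gives norm convergence: \<open>q\<close> is finite,
  so late blocks of coefficients are small in \<open>\<ell>\<^sub>q\<close>, and
  \<open>partial_sums_bounded\<close> transfers this to the blocks of the series.\<close>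

lemma series_converges:
  assumes a: "a \<in> scalar_ball"
  obtains s where "series_sum X (\<lambda>k. a k \<odot> z k) s"
proof -
  note aK = scalar_ballD(2)[OF a]
  define u where "u n = (\<Oplus>k\<in>{..<n}. a k \<odot> z k)" for n :: nat
  have u: "u n \<in> carrier X" for n
    unfolding u_def by (intro finsum_in_carrier smult_z_in aK)
  obtain C where C: "0 < C" and bound: "\<And>(I :: nat set) a \<delta>. finite I \<Longrightarrow> (\<And>k. a k \<in> K) \<Longrightarrow> 0 < \<delta>
    \<Longrightarrow> (\<Sum>k\<in>I. cmod (a k) powr q) \<le> \<delta> powr q \<Longrightarrow> nrm X (\<Oplus>k\<in>I. a k \<odot> z k) \<le> C * \<delta>"
    by (rule partial_sums_bounded) blast
  have Cauchy: "\<exists>N. \<forall>m\<ge>N. \<forall>n\<ge>N. nrm X (u m \<ominus> u n) < e" if e: "0 < e" for e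
  proof -
    define \<delta> where "\<delta> = e / (2 * C)"
    have \<delta>: "0 < \<delta>" using e C by (simp add: \<delta>_def)
    have "summable (\<lambda>k. cmod (a k) powr q)"
      using scalar_ballD(1)[OF a] by (simp add: lq_ball_def)
    moreover have "0 < \<delta> powr q" using \<delta> by simp
    ultimately obtain N where N: "\<And>m n. N \<le> m \<Longrightarrow> norm (\<Sum>k=m..<n. cmod (a k) powr q) < \<delta> powr q"
      unfolding summable_Cauchy by blast
    have *: "nrm X (u n \<ominus> u m) < e" if "N \<le> m" "m \<le> n" for m n
    proof -
      have "u n \<ominus> u m = (\<Oplus>k\<in>{m..<n}. a k \<odot> z k)"
      proof (rule dual_separates)
        show "(\<Oplus>k\<in>{m..<n}. a k \<odot> z k) \<in> carrier X"
          by (intro finsum_in_carrier smult_z_in aK)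
        fix f assume f: "f \<in> dual K X"
        have "(\<Sum>k<n. a k * f (z k)) - (\<Sum>k<m. a k * f (z k)) = (\<Sum>k=m..<n. a k * f (z k))"
          using sum_diff_nat_ivl[of 0 m n "\<lambda>k. a k * f (z k)"] that by (simp add: atLeast0LessThan)
        then show "f (u n \<ominus> u m) = f (\<Oplus>k\<in>{m..<n}. a k \<odot> z k)"
          unfolding dual_diff[OF f u u] by (simp add: u_def dual_partial_sum[OF f _ aK])
      qed (use u in simp)
      moreover have "(\<Sum>k=m..<n. cmod (a k) powr q) \<le> \<delta> powr q"
        using N[OF that(1), of n] by simp
      ultimately have "nrm X (u n \<ominus> u m) \<le> C * \<delta>"
        using bound[of "{m..<n}" a \<delta>] aK \<delta> by simp
      also have "\<dots> < e" using C e by (simp add: \<delta>_def)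
      finally show ?thesis .
    qed
    have "nrm X (u m \<ominus> u n) < e" if "N \<le> m" "N \<le> n" for m n
      using *[of m n] *[of n m] that nrm_diff_commute[OF u u, of m n] by (cases "m \<le> n") auto
    then show ?thesis by blast
  qed
  obtain s where "s \<in> carrier X" "(\<lambda>n. nrm X (u n \<ominus> s)) \<longlonglongrightarrow> 0"
    by (rule Cauchy_imp_convergent[OF u Cauchy])
  then show ?thesis
    by (intro that) (simp add: series_sum_def u_def)
qed

lemma dual_series_sum:
  assumes a: "a \<in> scalar_ball" and s: "series_sum X (\<lambda>k. a k \<odot> z k) s" and f: "f \<in> dual K X"
  shows "f s = (\<Sum>k. a k * f (z k))"
proof -
  note aK = scalar_ballD(2)[OF a]
  have "(\<lambda>n. f (\<Oplus>k\<in>{..<n}. a k \<odot> z k)) \<longlonglongrightarrow> f s"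
    using s unfolding series_sum_def
    by (intro dual_tendsto[OF f]) (auto intro!: finsum_in_carrier smult_z_in aK)
  then have "(\<lambda>n. \<Sum>k<n. a k * f (z k)) \<longlonglongrightarrow> f s"
    by (simp add: dual_partial_sum[OF f _ aK])
  then show ?thesis
    by (simp add: sums_def[symmetric] sums_iff)
qed

text \<open>Convergence in norm is replaced by a test on functionals. The converse holds because
  every coefficient sequence in the ball has a sum, which the functionals identify with
  \<open>s\<close>.\<close>

lemma mem_conv_iff:
  "s \<in> conv_r K (ereal q) X z \<longleftrightarrow>
    s \<in> carrier X \<and> (\<exists>a\<in>scalar_ball. \<forall>f\<in>dual K X. f s = (\<Sum>k. a k * f (z k)))"
proof -
  have ball: "unit_ball_l K (ereal q) = scalar_ball"
  proof -
    \<comment> \<open>Taking the \<open>q\<close>-th root does not affect a bound by 1, so the two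
      unit balls coincide.\<close>
    have "(x powr (1 / q) \<le> 1) = (x \<le> 1)" if "0 \<le> x" for x :: real
    proof (cases "x \<le> 1")
      case False
      then have "1 < x powr (1 / q)" using q_gt_1 by simp
      with False show ?thesis by simp
    qed (use q_gt_1 that powr_le1 in simp)
    then show ?thesis
      unfolding unit_ball_l_def scalar_ball_def lq_ball_def
      by (auto simp: suminf_nonneg)
  qed
  show ?thesis
  proof
    assume "s \<in> conv_r K (ereal q) X z"
    then show "s \<in> carrier X \<and> (\<exists>a\<in>scalar_ball. \<forall>f\<in>dual K X. f s = (\<Sum>k. a k * f (z k)))"
      unfolding conv_r_def ball using dual_series_sum by (auto simp: series_sum_def)
  next
    assume "s \<in> carrier X \<and> (\<exists>a\<in>scalar_ball. \<forall>f\<in>dual K X. f s = (\<Sum>k. a k * f (z k)))"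
    then obtain a where s: "s \<in> carrier X" and a: "a \<in> scalar_ball"
      and eq: "\<And>f. f \<in> dual K X \<Longrightarrow> f s = (\<Sum>k. a k * f (z k))" by blast
    obtain t where t: "series_sum X (\<lambda>k. a k \<odot> z k) t"
      by (rule series_converges[OF a])
    then have "s = t"
      using s eq dual_series_sum[OF a t] by (intro dual_separates) (auto simp: series_sum_def)
    with t a show "s \<in> conv_r K (ereal q) X z"
      unfolding conv_r_def ball by blast
  qed
qed

lemma mem_convI:
  "s \<in> carrier X \<Longrightarrow> a \<in> scalar_ball \<Longrightarrow> (\<And>f. f \<in> dual K X \<Longrightarrow> f s = (\<Sum>k. a k * f (z k)))
    \<Longrightarrow> s \<in> conv_r K (ereal q) X z"
  unfolding mem_conv_iff by blast

lemma conv_in_carrier: "conv_r K (ereal q) X z \<subseteq> carrier X"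
  using mem_conv_iff by blast

lemma convE:
  assumes "s \<in> conv_r K (ereal q) X z"
  obtains a where "a \<in> scalar_ball" "\<And>f. f \<in> dual K X \<Longrightarrow> f s = (\<Sum>k. a k * f (z k))"
  using assms mem_conv_iff by blast

lemma summable_dual_pairing:
  "a \<in> scalar_ball \<Longrightarrow> f \<in> dual K X \<Longrightarrow> summable (\<lambda>k. a k * f (z k))"
  by (intro summable_pairing scalar_ballD z_weakly_summable)

lemma conv_weakly_bounded:
  assumes f: "f \<in> dual K X" and s: "s \<in> conv_r K (ereal q) X z"
  shows "cmod (f s) \<le> 1 + (\<Sum>k. cmod (f (z k)) powr q')"
proof -
  obtain a where a: "a \<in> scalar_ball" and eq: "f s = (\<Sum>k. a k * f (z k))"
    by (rule convE[OF s]) (use f in blast)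
  show ?thesis
    unfolding eq by (rule pairing_bound[OF scalar_ballD(1)[OF a] z_weakly_summable[OF f]])
qed

lemma conv_bounded: "\<exists>C>0. \<forall>s\<in>conv_r K (ereal q) X z. nrm X s \<le> C"
  by (rule weakly_bounded_imp_bounded[OF conv_in_carrier]) (use conv_weakly_bounded in blast)

lemma conv_scale:
  assumes s: "s \<in> conv_r K (ereal q) X z" and c: "c \<in> K" "cmod c \<le> 1"
  shows "c \<odot> s \<in> conv_r K (ereal q) X z"
proof -
  obtain a where a: "a \<in> scalar_ball" and eq: "\<And>f. f \<in> dual K X \<Longrightarrow> f s = (\<Sum>k. a k * f (z k))"
    by (rule convE[OF s]) blast
  have "(\<lambda>k. c * a k) \<in> lq_ball q"
    using q_gt_1 c by (intro lq_ball_mono[OF scalar_ballD(1)[OF a]]) (auto simp: norm_mult intro: mult_left_le_one_le)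
  then have b: "(\<lambda>k. c * a k) \<in> scalar_ball"
    using scalar_ballD(2)[OF a] c by (auto simp: scalar_ball_def)
  have "f (c \<odot> s) = (\<Sum>k. (c * a k) * f (z k))" if f: "f \<in> dual K X" for f
    using suminf_mult[OF summable_dual_pairing[OF a f], of c] s c conv_in_carrier
    by (auto simp: dual_smult[OF f] eq[OF f] mult.assoc)
  moreover have "c \<odot> s \<in> carrier X" using s c conv_in_carrier by blast
  ultimately show ?thesis using b by (intro mem_convI[of _ "\<lambda>k. c * a k"])
qed

lemma conv_convex:
  assumes s: "s \<in> conv_r K (ereal q) X z" and s': "s' \<in> conv_r K (ereal q) X z" and t: "0 \<le> t" "t \<le> 1"
  shows "complex_of_real t \<odot> s \<oplus> complex_of_real (1 - t) \<odot> s' \<in> conv_r K (ereal q) X z"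
proof -
  obtain a where a: "a \<in> scalar_ball" and eq: "\<And>f. f \<in> dual K X \<Longrightarrow> f s = (\<Sum>k. a k * f (z k))"
    by (rule convE[OF s]) blast
  obtain a' where a': "a' \<in> scalar_ball" and eq': "\<And>f. f \<in> dual K X \<Longrightarrow> f s' = (\<Sum>k. a' k * f (z k))"
    by (rule convE[OF s']) blast
  define b where "b k = complex_of_real t * a k + complex_of_real (1 - t) * a' k" for k
  have "b \<in> lq_ball q"
    unfolding b_def using q_gt_1 t a a' by (intro lq_ball_convex scalar_ballD) auto
  then have b: "b \<in> scalar_ball"
    unfolding scalar_ball_def b_def using scalar_ballD(2)[OF a] scalar_ballD(2)[OF a'] by blast
  have sX: "s \<in> carrier X" "s' \<in> carrier X"
    using s s' conv_in_carrier by auto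
  have "f (complex_of_real t \<odot> s \<oplus> complex_of_real (1 - t) \<odot> s') = (\<Sum>k. b k * f (z k))"
    if f: "f \<in> dual K X" for f
  proof -
    have "f (complex_of_real t \<odot> s \<oplus> complex_of_real (1 - t) \<odot> s')
        = complex_of_real t * f s + complex_of_real (1 - t) * f s'"
      using sX by (simp only: dual_add[OF f] dual_smult[OF f] smult_in_carrier K_of_real)
    also have "\<dots> = (\<Sum>k. complex_of_real t * (a k * f (z k)) + complex_of_real (1 - t) * (a' k * f (z k)))"
      unfolding eq[OF f] eq'[OF f]
      by (subst suminf_add[symmetric], (intro summable_mult summable_dual_pairing a a' f)+)
        (simp only: suminf_mult[OF summable_dual_pairing[OF a f]] suminf_mult[OF summable_dual_pairing[OF a' f]])
    also have "\<dots> = (\<Sum>k. b k * f (z k))"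
      by (simp add: b_def algebra_simps)
    finally show ?thesis .
  qed
  moreover have "complex_of_real t \<odot> s \<oplus> complex_of_real (1 - t) \<odot> s' \<in> carrier X"
    by (intro M.a_closed smult_in_carrier K_of_real sX)
  ultimately show ?thesis using b by (intro mem_convI[of _ b])
qed

lemma z_in_conv: "z j \<in> conv_r K (ereal q) X z"
proof -
  let ?a = "\<lambda>k. if k = j then 1 else (0::complex)"
  have "?a \<in> scalar_ball"
    using K_closed by (auto simp: scalar_ball_def unit_in_lq_ball)
  moreover have "f (z j) = (\<Sum>k. ?a k * f (z k))" for f
    using suminf_finite[of "{j}" "\<lambda>k. ?a k * f (z k)"] by auto
  ultimately show ?thesis
    using z_in by (intro mem_convI[of _ ?a])
qed

lemma zero_in_conv: "\<zero> \<in> conv_r K (ereal q) X z"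
  using conv_scale[OF z_in_conv, of 0 0] z_in K_closed by simp

text \<open>Coefficient sequences of a vector are not unique, so those of a weakly convergent
  sequence need not converge; a subsequence does, and its limit is one representation of the weak
  limit.\<close>

lemma weakly_convergent_subsequence:
  assumes a: "\<And>n. a n \<in> scalar_ball" and eq: "\<And>n f. f \<in> dual K X \<Longrightarrow> f (s n) = (\<Sum>k. a n k * f (z k))"
    and lim: "\<And>f. f \<in> dual K X \<Longrightarrow> (\<lambda>n. f (s n)) \<longlonglongrightarrow> f l" and l: "l \<in> carrier X"
  obtains \<sigma> b where "strict_mono \<sigma>" "b \<in> scalar_ball" "\<And>k. (\<lambda>n. a (\<sigma> n) k) \<longlonglongrightarrow> b k"
    "\<And>f. f \<in> dual K X \<Longrightarrow> f l = (\<Sum>k. b k * f (z k))"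
proof -
  obtain \<sigma> b where \<sigma>: "strict_mono (\<sigma> :: nat \<Rightarrow> nat)" and b: "b \<in> lq_ball q" and coord: "\<And>k. (\<lambda>n. a (\<sigma> n) k) \<longlonglongrightarrow> b k"
    by (rule lq_ball_sequentially_compact[of q a]) (use q_gt_1 scalar_ballD(1)[OF a] in auto)
  have "b k \<in> K" for k
    by (rule closed_sequentially[OF K_topologically_closed scalar_ballD(2)[OF a] coord])
  with b have b': "b \<in> scalar_ball" by (auto simp: scalar_ball_def)
  have "f l = (\<Sum>k. b k * f (z k))" if f: "f \<in> dual K X" for f
  proof (rule LIMSEQ_unique)
    show "(\<lambda>n. f (s (\<sigma> n))) \<longlonglongrightarrow> f l"
      using LIMSEQ_subseq_LIMSEQ[OF lim[OF f] \<sigma>] by (simp add: comp_def)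
    show "(\<lambda>n. f (s (\<sigma> n))) \<longlonglongrightarrow> (\<Sum>k. b k * f (z k))"
      unfolding eq[OF f] by (rule pairing_tendsto[OF scalar_ballD(1)[OF a] b coord z_weakly_summable[OF f]])
  qed
  with \<sigma> b' coord show ?thesis by (rule that)
qed

text \<open>Norm limits are weak limits, so this gives the closedness required of a Banach
  disk.\<close>

lemma conv_weakly_closed:
  assumes s: "\<And>n. s n \<in> conv_r K (ereal q) X z"
    and lim: "\<And>f. f \<in> dual K X \<Longrightarrow> (\<lambda>n. f (s n)) \<longlonglongrightarrow> f l" and l: "l \<in> carrier X"
  shows "l \<in> conv_r K (ereal q) X z"
proof -
  have "\<exists>a. a \<in> scalar_ball \<and> (\<forall>f\<in>dual K X. f (s n) = (\<Sum>k. a k * f (z k)))" for n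
    by (rule convE[OF s[of n]]) blast
  then obtain a where a: "\<And>n. a n \<in> scalar_ball"
    and eq: "\<And>n f. f \<in> dual K X \<Longrightarrow> f (s n) = (\<Sum>k. a n k * f (z k))"
    by metis
  obtain b where "b \<in> scalar_ball" "\<And>f. f \<in> dual K X \<Longrightarrow> f l = (\<Sum>k. b k * f (z k))"
    by (rule weakly_convergent_subsequence[OF a eq lim l]) blast+
  then show ?thesis
    unfolding mem_conv_iff using l by blast
qed

end

section \<open>Banach disks\<close>

context real_or_complex_banach_space
begin

lemma cring_scalar_field: "cring (scalar_field K)"
  by (rule R.cring_axioms)

text \<open>The algebraic laws of \<open>Y\<close> are inherited from \<open>X\<close> through an injective linear map.\<close>

lemma banach_space_of_injective:
  fixes Y :: "('b, 'n) normed_module_scheme" and i :: "'b \<Rightarrow> 'a"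
  assumes inj: "inj_on i (carrier Y)" and i_in: "\<And>u. u \<in> carrier Y \<Longrightarrow> i u \<in> carrier X"
    and zero: "\<zero>\<^bsub>Y\<^esub> \<in> carrier Y" "i \<zero>\<^bsub>Y\<^esub> = \<zero>"
    and add: "\<And>u v. u \<in> carrier Y \<Longrightarrow> v \<in> carrier Y \<Longrightarrow> u \<oplus>\<^bsub>Y\<^esub> v \<in> carrier Y"
      "\<And>u v. u \<in> carrier Y \<Longrightarrow> v \<in> carrier Y \<Longrightarrow> i (u \<oplus>\<^bsub>Y\<^esub> v) = i u \<oplus> i v"
    and smult: "\<And>c u. c \<in> K \<Longrightarrow> u \<in> carrier Y \<Longrightarrow> c \<odot>\<^bsub>Y\<^esub> u \<in> carrier Y"
      "\<And>c u. c \<in> K \<Longrightarrow> u \<in> carrier Y \<Longrightarrow> i (c \<odot>\<^bsub>Y\<^esub> u) = c \<odot> i u"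
    and norm: "\<And>u. u \<in> carrier Y \<Longrightarrow> 0 \<le> nrm Y u"
      "\<And>u. u \<in> carrier Y \<Longrightarrow> nrm Y u = 0 \<longleftrightarrow> i u = \<zero>"
      "\<And>c u. c \<in> K \<Longrightarrow> u \<in> carrier Y \<Longrightarrow> nrm Y (c \<odot>\<^bsub>Y\<^esub> u) = cmod c * nrm Y u"
      "\<And>u v. u \<in> carrier Y \<Longrightarrow> v \<in> carrier Y \<Longrightarrow> nrm Y (u \<oplus>\<^bsub>Y\<^esub> v) \<le> nrm Y u + nrm Y v"
    and complete: "\<And>\<sigma>. (\<And>n. \<sigma> n \<in> carrier Y) \<Longrightarrow>
      (\<And>e. 0 < e \<Longrightarrow> \<exists>N. \<forall>m\<ge>N. \<forall>n\<ge>N. nrm Y (\<sigma> m \<oplus>\<^bsub>Y\<^esub> (-1) \<odot>\<^bsub>Y\<^esub> \<sigma> n) < e) \<Longrightarrow>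
      \<exists>l\<in>carrier Y. (\<lambda>n. nrm Y (\<sigma> n \<oplus>\<^bsub>Y\<^esub> (-1) \<odot>\<^bsub>Y\<^esub> l)) \<longlonglongrightarrow> 0"
  shows "banach_space K Y"
proof -
  have neg1: "-1 \<in> K" using K_closed by auto
  have eqI: "u = v" if "u \<in> carrier Y" "v \<in> carrier Y" "i u = i v" for u v
    using inj_onD[OF inj that(3,1,2)] .
  note simps = i_in zero add smult neg1 K_closed M.a_ac smult_add_left smult_add_right smult_smult smult_minus_1
  have group: "abelian_group Y"
  proof (rule abelian_groupI)
    show "\<exists>v\<in>carrier Y. v \<oplus>\<^bsub>Y\<^esub> u = \<zero>\<^bsub>Y\<^esub>" if "u \<in> carrier Y" for u
    proof
      show "(-1) \<odot>\<^bsub>Y\<^esub> u \<oplus>\<^bsub>Y\<^esub> u = \<zero>\<^bsub>Y\<^esub>"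
        using that by (intro eqI) (simp_all add: simps M.l_neg M.r_neg)
    qed (use that in \<open>simp add: simps\<close>)
  qed (auto intro!: eqI simp: simps)
  have modul: "Module.module (scalar_field K) Y"
  proof (rule moduleI[OF cring_scalar_field group])
  qed (auto intro!: eqI simp: simps)
  interpret Y: Module.module "scalar_field K" Y by (rule modul)
  \<comment> \<open>The hypotheses speak of \<open>(-1) \<odot>\<close>, since nothing is known
    about \<open>\<ominus>\<close> in \<open>Y\<close> before \<open>Y\<close> is a group; here the
    two are identified.\<close>
  have minus: "u \<ominus>\<^bsub>Y\<^esub> v = u \<oplus>\<^bsub>Y\<^esub> (-1) \<odot>\<^bsub>Y\<^esub> v" if "u \<in> carrier Y" "v \<in> carrier Y" for u v
  proof -
    have "(-1) \<odot>\<^bsub>Y\<^esub> v \<oplus>\<^bsub>Y\<^esub> v = \<zero>\<^bsub>Y\<^esub>"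
      using that by (intro eqI) (simp_all add: simps M.l_neg M.r_neg)
    then have "\<ominus>\<^bsub>Y\<^esub> v = (-1) \<odot>\<^bsub>Y\<^esub> v"
      by (rule Y.M.minus_equality) (use that smult(1)[OF neg1] in auto)
    then show ?thesis by (simp add: Y.M.minus_eq)
  qed
  have i_minus: "i (u \<ominus>\<^bsub>Y\<^esub> v) = i u \<ominus> i v" if "u \<in> carrier Y" "v \<in> carrier Y" for u v
    using that by (simp add: minus add smult neg1 smult_minus_1 i_in M.minus_eq)
  have nrm_minus: "nrm Y (\<ominus>\<^bsub>Y\<^esub> u) = nrm Y u" if "u \<in> carrier Y" for u
  proof -
    have "\<ominus>\<^bsub>Y\<^esub> u = (-1) \<odot>\<^bsub>Y\<^esub> u"
      using minus[OF zero(1) that] that smult(1)[OF neg1 that] by (simp add: Y.M.minus_eq)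
    then show ?thesis using norm(3)[OF neg1 that] by simp
  qed
  have metric: "Metric_space (carrier Y) (norm_dist Y)"
  proof
    show "0 \<le> norm_dist Y u v" for u v
      by (simp add: norm_dist_def norm)
    show "norm_dist Y u v = norm_dist Y v u" for u v
    proof (cases "u \<in> carrier Y \<and> v \<in> carrier Y")
      case True
      then have "u \<ominus>\<^bsub>Y\<^esub> v = \<ominus>\<^bsub>Y\<^esub> (v \<ominus>\<^bsub>Y\<^esub> u)"
        by (simp add: Y.M.minus_eq Y.M.minus_add Y.M.a_comm)
      with True nrm_minus[of "v \<ominus>\<^bsub>Y\<^esub> u"] show ?thesis by (simp add: norm_dist_def)
    qed (auto simp: norm_dist_def)
    show "norm_dist Y u v = 0 \<longleftrightarrow> u = v" if uv: "u \<in> carrier Y" "v \<in> carrier Y" for u v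
    proof -
      have "nrm Y (u \<ominus>\<^bsub>Y\<^esub> v) = 0 \<longleftrightarrow> i u \<ominus> i v = \<zero>"
        using norm(2)[of "u \<ominus>\<^bsub>Y\<^esub> v"] uv by (simp add: i_minus)
      also have "\<dots> \<longleftrightarrow> i u = i v"
        using uv i_in Metric_space.zero[OF Metric_space_norm_dist, of "i u" "i v"] nrm_eq_0_iff[of "i u \<ominus> i v"]
        by (simp add: norm_dist_def)
      finally show ?thesis using uv eqI by (auto simp: norm_dist_def)
    qed
    show "norm_dist Y u w \<le> norm_dist Y u v + norm_dist Y v w"
      if h: "u \<in> carrier Y" "v \<in> carrier Y" "w \<in> carrier Y" for u v w
    proof -
      have "u \<ominus>\<^bsub>Y\<^esub> w = (u \<ominus>\<^bsub>Y\<^esub> v) \<oplus>\<^bsub>Y\<^esub> (v \<ominus>\<^bsub>Y\<^esub> w)"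
        using h by (simp add: Y.M.minus_eq Y.M.a_assoc Y.M.r_neg2 Y.M.r_neg1)
      then show ?thesis
        using h norm(4)[of "u \<ominus>\<^bsub>Y\<^esub> v" "v \<ominus>\<^bsub>Y\<^esub> w"] by (simp add: norm_dist_def)
    qed
  qed
  interpret Y: Metric_space "carrier Y" "norm_dist Y" by (rule metric)
  have mcomplete: "Y.mcomplete"
    unfolding Y.mcomplete_def
  proof (intro allI impI)
    fix \<sigma> assume \<sigma>: "Y.MCauchy \<sigma>"
    then have \<sigma>Y: "\<And>n. \<sigma> n \<in> carrier Y" by (auto simp: Y.MCauchy_def)
    have Cauchy: "\<exists>N. \<forall>m\<ge>N. \<forall>n\<ge>N. nrm Y (\<sigma> m \<oplus>\<^bsub>Y\<^esub> (-1) \<odot>\<^bsub>Y\<^esub> \<sigma> n) < e" if "0 < e" for e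
      using \<sigma> that \<sigma>Y by (auto simp: Y.MCauchy_def norm_dist_def minus)
    obtain l where l: "l \<in> carrier Y" "(\<lambda>n. nrm Y (\<sigma> n \<oplus>\<^bsub>Y\<^esub> (-1) \<odot>\<^bsub>Y\<^esub> l)) \<longlonglongrightarrow> 0"
    proof -
      have "\<exists>l\<in>carrier Y. (\<lambda>n. nrm Y (\<sigma> n \<oplus>\<^bsub>Y\<^esub> (-1) \<odot>\<^bsub>Y\<^esub> l)) \<longlonglongrightarrow> 0"
        by (rule complete[OF \<sigma>Y]) (rule Cauchy)
      then show ?thesis using that by blast
    qed
    then have "(\<lambda>n. norm_dist Y (\<sigma> n) l) \<longlonglongrightarrow> 0"
      using \<sigma>Y by (simp add: norm_dist_def minus)
    then show "\<exists>l. limitin Y.mtopology \<sigma> l sequentially"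
      unfolding Y.limitin_metric_dist_null using l \<sigma>Y by auto
  qed
  show "banach_space K Y"
  proof (intro banach_space.intro banach_space_axioms.intro modul mcomplete)
    show "nrm Y u = 0 \<longleftrightarrow> u = \<zero>\<^bsub>Y\<^esub>" if "u \<in> carrier Y" for u
      using norm(2)[OF that] eqI[OF that zero(1)] zero by auto
  qed (fact norm)+
qed

end

text \<open>An absolutely convex, bounded, norm closed set. Boundedness makes the gauge a norm,
  closedness makes its infimum attained and the span complete; \<open>emb\<close> moves the span
  into the type of the auxiliary spaces.\<close>

locale banach_disk = real_or_complex_banach_space K X
  for K and X :: "('a, 'm) normed_module_scheme" (structure) +
  fixes B :: "'a set" and emb :: "'a \<Rightarrow> 'b"
  assumes B_in: "B \<subseteq> carrier X" and B_zero: "\<zero> \<in> B"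
    and B_scale: "b \<in> B \<Longrightarrow> c \<in> K \<Longrightarrow> cmod c \<le> 1 \<Longrightarrow> c \<odot> b \<in> B"
    and B_convex: "b \<in> B \<Longrightarrow> b' \<in> B \<Longrightarrow> 0 \<le> t \<Longrightarrow> t \<le> 1
      \<Longrightarrow> complex_of_real t \<odot> b \<oplus> complex_of_real (1 - t) \<odot> b' \<in> B"
    and B_bounded: "\<exists>C>0. \<forall>b\<in>B. nrm X b \<le> C"
    and B_closed: "(\<And>n. s n \<in> B) \<Longrightarrow> l \<in> carrier X \<Longrightarrow> (\<lambda>n. nrm X (s n \<ominus> l)) \<longlonglongrightarrow> 0 \<Longrightarrow> l \<in> B"
    and emb_inj: "inj_on emb (carrier X)"
begin

text \<open>Membership in \<open>t B\<close>. Norm estimates in the span are stated in this form;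
  the gauge is the least such \<open>t\<close>, and for t = 0 only the zero vector is left.\<close>

definition dilate :: "real \<Rightarrow> 'a \<Rightarrow> bool" where
  "dilate t v \<longleftrightarrow> 0 \<le> t \<and> (\<exists>b\<in>B. v = complex_of_real t \<odot> b)"

lemma dilate_in: "dilate t v \<Longrightarrow> v \<in> carrier X"
  using B_in by (auto simp: dilate_def)

lemma dilate_nonneg: "dilate t v \<Longrightarrow> 0 \<le> t"
  by (simp add: dilate_def)

lemma dilate_0_iff: "dilate 0 v \<longleftrightarrow> v = \<zero>"
proof
  assume "dilate 0 v"
  then obtain b where "b \<in> B" "v = complex_of_real 0 \<odot> b" unfolding dilate_def by blast
  moreover from this(1) B_in have "b \<in> carrier X" by blast
  ultimately show "v = \<zero>" by simp
next
  assume "v = \<zero>"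
  then have "v = complex_of_real 0 \<odot> \<zero>" by simp
  with B_zero show "dilate 0 v" unfolding dilate_def by blast
qed

lemma dilate_pos_iff:
  assumes "0 < t" "v \<in> carrier X"
  shows "dilate t v \<longleftrightarrow> complex_of_real (1 / t) \<odot> v \<in> B"
proof
  assume "dilate t v"
  then obtain b where b: "b \<in> B" "v = complex_of_real t \<odot> b" by (auto simp: dilate_def)
  have "complex_of_real (1 / t) \<odot> v = b"
    using assms b B_in smult_smult[OF K_of_real K_of_real, of b "1 / t" t] by auto
  with b show "complex_of_real (1 / t) \<odot> v \<in> B" by simp
next
  assume "complex_of_real (1 / t) \<odot> v \<in> B"
  moreover have "v = complex_of_real t \<odot> (complex_of_real (1 / t) \<odot> v)"
    using assms smult_smult[OF K_of_real K_of_real, of v t "1 / t"] by simp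
  ultimately show "dilate t v"
    using assms by (auto simp: dilate_def)
qed

lemma dilate_1_iff: "dilate 1 v \<longleftrightarrow> v \<in> B"
proof -
  have "v \<in> carrier X" if "v \<in> B" using that B_in by blast
  then show ?thesis using dilate_pos_iff[of 1 v] dilate_in[of 1 v] by (cases "v \<in> carrier X") auto
qed

lemma dilate_add:
  assumes v: "dilate s v" and w: "dilate t w"
  shows "dilate (s + t) (v \<oplus> w)"
proof (cases "s = 0 \<or> t = 0")
  case True
  then show ?thesis
    using v w dilate_in[OF v] dilate_in[OF w] by (auto simp: dilate_0_iff)
next
  case False
  then have pos: "0 < s" "0 < t" using dilate_nonneg[OF v] dilate_nonneg[OF w] by auto
  obtain b b' where b: "b \<in> B" "v = complex_of_real s \<odot> b" and b': "b' \<in> B" "w = complex_of_real t \<odot> b'"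
    using v w by (auto simp: dilate_def)
  have bX: "b \<in> carrier X" "b' \<in> carrier X" using b b' B_in by auto
  \<comment> \<open>Weights proportional to \<open>s\<close> and \<open>t\<close>, so that the
    convex combination scaled by \<open>s + t\<close> is \<open>v \<oplus> w\<close>.\<close>
  define \<theta> where "\<theta> = s / (s + t)"
  have \<theta>: "0 \<le> \<theta>" "\<theta> \<le> 1" "(s + t) * \<theta> = s" "(s + t) * (1 - \<theta>) = t"
    using pos by (auto simp: \<theta>_def field_simps)
  have "complex_of_real (s + t) \<odot> (complex_of_real \<theta> \<odot> b \<oplus> complex_of_real (1 - \<theta>) \<odot> b')
      = complex_of_real ((s + t) * \<theta>) \<odot> b \<oplus> complex_of_real ((s + t) * (1 - \<theta>)) \<odot> b'"
    by (simp only: of_real_mult smult_add_right smult_smult smult_in_carrier K_of_real bX)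
  also have "\<dots> = v \<oplus> w"
    by (simp only: \<theta> b b')
  finally have eq: "v \<oplus> w = complex_of_real (s + t) \<odot> (complex_of_real \<theta> \<odot> b \<oplus> complex_of_real (1 - \<theta>) \<odot> b')" ..
  show ?thesis
    unfolding dilate_def using pos eq B_convex[OF b(1) b'(1) \<theta>(1,2)] by (intro conjI bexI[where x = "complex_of_real \<theta> \<odot> b \<oplus> complex_of_real (1 - \<theta>) \<odot> b'"]) auto
qed

lemma dilate_smult:
  assumes v: "dilate t v" and c: "c \<in> K"
  shows "dilate (cmod c * t) (c \<odot> v)"
proof (cases "cmod c * t = 0")
  case True
  then show ?thesis
    using v c dilate_in[OF v] by (auto simp: dilate_0_iff)
next
  case False
  then have t: "0 < t" and c0: "c \<noteq> 0" using dilate_nonneg[OF v] by auto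
  have vX: "v \<in> carrier X" by (rule dilate_in[OF v])
  \<comment> \<open>\<open>c\<close> is split into its modulus, which changes the dilation factor,
    and a unimodular factor, which maps \<open>B\<close> into itself.\<close>
  have sgn: "c / complex_of_real (cmod c) \<in> K" using c K_of_real by (rule K_closed)
  have "complex_of_real (1 / t) \<odot> v \<in> B" using v dilate_pos_iff[OF t vX] by blast
  then have "(c / complex_of_real (cmod c)) \<odot> (complex_of_real (1 / t) \<odot> v) \<in> B"
    by (rule B_scale[OF _ sgn]) (use c0 in \<open>simp add: norm_divide\<close>)
  also have "(c / complex_of_real (cmod c)) \<odot> (complex_of_real (1 / t) \<odot> v)
      = complex_of_real (1 / (cmod c * t)) \<odot> (c \<odot> v)"
    unfolding smult_smult[OF sgn K_of_real vX] smult_smult[OF K_of_real c vX]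
    by (simp add: field_simps)
  finally show ?thesis
    using t c0 c vX by (subst dilate_pos_iff) auto
qed

lemma dilate_mono:
  assumes v: "dilate s v" and le: "s \<le> t"
  shows "dilate t v"
proof -
  \<comment> \<open>Adding \<zero> as an element of \<open>(t - s) B\<close> raises the factor from
    \<open>s\<close> to \<open>t\<close>.\<close>
  have "dilate (t - s) \<zero>"
    unfolding dilate_def using le by (intro conjI bexI[OF _ B_zero]) (simp_all only: smult_zero K_of_real diff_ge_0_iff_ge)
  from dilate_add[OF v this] show ?thesis
    using dilate_in[OF v] by simp
qed

lemma dilate_bounded:
  obtains C where "0 < C" "\<And>t v. dilate t v \<Longrightarrow> nrm X v \<le> C * t"
proof -
  obtain C where C: "0 < C" "\<And>b. b \<in> B \<Longrightarrow> nrm X b \<le> C" using B_bounded by blast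
  have "nrm X v \<le> C * t" if v: "dilate t v" for t v
  proof -
    obtain b where b: "b \<in> B" "v = complex_of_real t \<odot> b" "0 \<le> t"
      using v unfolding dilate_def by blast
    then have "nrm X v = t * nrm X b" using B_in by (auto simp: nrm_smult)
    also have "\<dots> \<le> t * C" using C(2)[OF b(1)] b(3) by (rule mult_left_mono)
    finally show ?thesis by (simp add: mult.commute)
  qed
  with C(1) show ?thesis by (rule that)
qed

lemma dilate_closed:
  assumes v: "\<And>n. dilate t (v n)" and l: "l \<in> carrier X" and lim: "(\<lambda>n. nrm X (v n \<ominus> l)) \<longlonglongrightarrow> 0"
  shows "dilate t l"
proof (cases "t = 0")
  case True
  have "nrm X l \<le> 0"
  proof (rule nrm_limit_le[OF dilate_in[OF v] l lim])
    show "nrm X (v n) \<le> 0" for n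
      using v[of n] True nrm_eq_0_iff[OF M.zero_closed] by (simp add: dilate_0_iff)
  qed
  then have "l = \<zero>" using nrm_nonneg[OF l] nrm_eq_0_iff[OF l] by simp
  then show ?thesis by (simp add: True dilate_0_iff)
next
  case False
  then have t: "0 < t" using dilate_nonneg[OF v] by force
  have vX: "v n \<in> carrier X" for n by (rule dilate_in[OF v])
  have "complex_of_real (1 / t) \<odot> l \<in> B"
  proof (rule B_closed)
    show "complex_of_real (1 / t) \<odot> v n \<in> B" for n
      using v[of n] vX t by (simp only: dilate_pos_iff)
    have "complex_of_real (1 / t) \<odot> v n \<ominus> complex_of_real (1 / t) \<odot> l = complex_of_real (1 / t) \<odot> (v n \<ominus> l)" for n
    proof (rule dual_separates)
      fix f assume f: "f \<in> dual K X"
      show "f (complex_of_real (1 / t) \<odot> v n \<ominus> complex_of_real (1 / t) \<odot> l) = f (complex_of_real (1 / t) \<odot> (v n \<ominus> l))"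
        by (simp only: dual_diff[OF f] dual_smult[OF f] smult_in_carrier K_of_real vX l M.minus_closed right_diff_distrib)
    qed (intro M.minus_closed smult_in_carrier K_of_real vX l)+
    then have "nrm X (complex_of_real (1 / t) \<odot> v n \<ominus> complex_of_real (1 / t) \<odot> l) = (1 / t) * nrm X (v n \<ominus> l)" for n
      using nrm_smult[OF K_of_real minus_in_carrier[OF vX l], of "1 / t" n] t by (simp add: norm_divide)
    then show "(\<lambda>n. nrm X (complex_of_real (1 / t) \<odot> v n \<ominus> complex_of_real (1 / t) \<odot> l)) \<longlonglongrightarrow> 0"
      using tendsto_mult_left[OF lim, of "1 / t"] by simp
  qed (intro smult_in_carrier K_of_real l)
  then show ?thesis using t l by (simp only: dilate_pos_iff)
qed

text \<open>The Minkowski functional of \<open>B\<close>, meaningful on the span, where the set is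
  nonempty.\<close>

definition gauge :: "'a \<Rightarrow> real" where
  "gauge v = Inf {t. dilate t v}"

lemma gauge_le: "dilate t v \<Longrightarrow> gauge v \<le> t"
  unfolding gauge_def by (rule cInf_lower) (auto intro!: bdd_belowI[of _ 0] dest: dilate_nonneg)

text \<open>The infimum is attained because \<open>B\<close> is closed.\<close>

lemma dilate_gauge:
  assumes v: "dilate t v"
  shows "dilate (gauge v) v"
proof -
  have vX: "v \<in> carrier X" by (rule dilate_in[OF v])
  have gauge: "0 \<le> gauge v"
    unfolding gauge_def using v by (intro cInf_greatest) (auto dest: dilate_nonneg)
  have near: "dilate (gauge v + e) v" if e: "0 < e" for e
  proof -
    obtain s where "dilate s v" "s < gauge v + e"
      using cInf_lessD[of "{t. dilate t v}" "gauge v + e"] v e by (auto simp: gauge_def)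
    then show ?thesis using dilate_mono by (meson less_imp_le)
  qed
  show ?thesis
  proof (cases "gauge v = 0")
    case True
    \<comment> \<open>\<open>v\<close> lies in \<open>e B\<close> for every e > 0, so boundedness of
      \<open>B\<close> forces \<open>v = \<zero>\<close>.\<close>
    obtain C where C: "0 < C" "\<And>t v. dilate t v \<Longrightarrow> nrm X v \<le> C * t"
      by (rule dilate_bounded) blast
    have "nrm X v \<le> 0"
    proof (rule field_le_epsilon)
      fix e :: real assume "0 < e"
      then show "nrm X v \<le> 0 + e" using C(2)[OF near[of "e / C"]] C(1) True by simp
    qed
    then have "v = \<zero>" using nrm_nonneg[OF vX] nrm_eq_0_iff[OF vX] by simp
    then show ?thesis using True by (simp add: dilate_0_iff)
  next
    case False
    with gauge have g: "0 < gauge v" by simp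
    \<comment> \<open>Multiplication by \<open>c n\<close> lowers the dilation factor from
      \<open>gauge v + 1 / Suc n\<close> to \<open>gauge v\<close>. Since \<open>c n\<close> tends
      to 1, \<open>v\<close> is a limit of elements of \<open>gauge v\<close> times
      \<open>B\<close>, which is closed.\<close>
    define c where "c n = gauge v / (gauge v + 1 / real (Suc n))" for n
    have pos: "0 < gauge v + 1 / real (Suc n)" for n using g by (simp add: add_pos_pos)
    have c_nonneg: "0 \<le> c n" for n using g pos[of n] by (simp add: c_def)
    show ?thesis
    proof (rule dilate_closed[OF _ vX])
      have "cmod (complex_of_real (c n)) * (gauge v + 1 / real (Suc n)) = gauge v" for n
      proof -
        have "cmod (complex_of_real (c n)) = c n" using c_nonneg by simp
        then show ?thesis using pos[of n] by (simp only: c_def) simp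
      qed
      then show "dilate (gauge v) (complex_of_real (c n) \<odot> v)" for n
        using dilate_smult[OF near[of "1 / real (Suc n)"] K_of_real[of "c n"]] by simp
      have "(\<lambda>n. 1 / real (Suc n)) \<longlonglongrightarrow> 0"
        using LIMSEQ_inverse_real_of_nat by (simp add: inverse_eq_divide)
      then have "c \<longlonglongrightarrow> gauge v / (gauge v + 0)"
        unfolding c_def using g by (intro tendsto_intros) auto
      then have "(\<lambda>n. \<bar>c n - 1\<bar> * nrm X v) \<longlonglongrightarrow> \<bar>1 - 1\<bar> * nrm X v"
        using g by (intro tendsto_intros) simp
      moreover have "nrm X (complex_of_real (c n) \<odot> v \<ominus> v) = \<bar>c n - 1\<bar> * nrm X v" for n
      proof -
        have "complex_of_real (c n) \<odot> v \<ominus> v = complex_of_real (c n - 1) \<odot> v"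
        proof (rule dual_separates)
          fix f assume f: "f \<in> dual K X"
          show "f (complex_of_real (c n) \<odot> v \<ominus> v) = f (complex_of_real (c n - 1) \<odot> v)"
            using vX by (simp only: dual_diff[OF f] dual_smult[OF f] smult_in_carrier K_of_real) (simp add: algebra_simps)
        qed (intro M.minus_closed smult_in_carrier K_of_real vX)+
        then show ?thesis by (simp only: nrm_smult[OF K_of_real vX] norm_of_real)
      qed
      ultimately show "(\<lambda>n. nrm X (complex_of_real (c n) \<odot> v \<ominus> v)) \<longlonglongrightarrow> 0" by simp
    qed
  qed
qed

lemma gauge_le_iff: "dilate s v \<Longrightarrow> gauge v \<le> t \<longleftrightarrow> dilate t v"
  using dilate_gauge[of s v] dilate_mono[of "gauge v" v t] gauge_le[of t v] by blast

section \<open>The Banach space spanned by a disk\<close>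

abbreviation "coord \<equiv> inv_into (carrier X) emb"

lemma coord_emb [simp]: "v \<in> carrier X \<Longrightarrow> coord (emb v) = v"
  by (rule inv_into_f_f[OF emb_inj])

text \<open>The span of \<open>B\<close> with the gauge as norm, copied by \<open>emb\<close>
  because an auxiliary space must have its carrier in \<open>'b\<close>.\<close>

definition disk_space :: "'b normed_module" where
  "disk_space = \<lparr>carrier = emb ` {v. \<exists>t. dilate t v}, monoid.mult = undefined, one = undefined,
     zero = emb \<zero>, add = \<lambda>u v. emb (coord u \<oplus> coord v), module.smult = \<lambda>c u. emb (c \<odot> coord u),
     nrm = \<lambda>u. gauge (coord u)\<rparr>"

lemma disk_space_carrierE:
  assumes "u \<in> carrier disk_space"
  obtains t v where "u = emb v" "dilate t v" "v \<in> carrier X" "coord u = v"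
  using assms dilate_in by (auto simp: disk_space_def)

lemma emb_in_disk_space: "dilate t v \<Longrightarrow> emb v \<in> carrier disk_space"
  by (auto simp: disk_space_def)

lemma coord_in: "u \<in> carrier disk_space \<Longrightarrow> coord u \<in> carrier X"
  by (erule disk_space_carrierE) simp

lemma coord_inj: "inj_on coord (carrier disk_space)"
  by (rule inj_onI) (metis disk_space_carrierE)

lemma dilate_coord: "u \<in> carrier disk_space \<Longrightarrow> dilate (nrm disk_space u) (coord u)"
  by (erule disk_space_carrierE) (use dilate_gauge in \<open>auto simp: disk_space_def\<close>)

lemma nrm_disk_space_le_iff: "u \<in> carrier disk_space \<Longrightarrow> nrm disk_space u \<le> t \<longleftrightarrow> dilate t (coord u)"
  by (erule disk_space_carrierE) (use gauge_le_iff in \<open>auto simp: disk_space_def\<close>)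

lemma disk_space_add:
  assumes "u \<in> carrier disk_space" "v \<in> carrier disk_space"
  shows "u \<oplus>\<^bsub>disk_space\<^esub> v \<in> carrier disk_space" "coord (u \<oplus>\<^bsub>disk_space\<^esub> v) = coord u \<oplus> coord v"
proof -
  have eq: "u \<oplus>\<^bsub>disk_space\<^esub> v = emb (coord u \<oplus> coord v)" by (simp add: disk_space_def)
  show "u \<oplus>\<^bsub>disk_space\<^esub> v \<in> carrier disk_space"
    unfolding eq using assms by (intro emb_in_disk_space[OF dilate_add[OF dilate_coord dilate_coord]])
  show "coord (u \<oplus>\<^bsub>disk_space\<^esub> v) = coord u \<oplus> coord v"
    unfolding eq using coord_in[OF assms(1)] coord_in[OF assms(2)] by simp
qed

lemma disk_space_smult:
  assumes "c \<in> K" "u \<in> carrier disk_space"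
  shows "c \<odot>\<^bsub>disk_space\<^esub> u \<in> carrier disk_space" "coord (c \<odot>\<^bsub>disk_space\<^esub> u) = c \<odot> coord u"
proof -
  have eq: "c \<odot>\<^bsub>disk_space\<^esub> u = emb (c \<odot> coord u)" by (simp add: disk_space_def)
  show "c \<odot>\<^bsub>disk_space\<^esub> u \<in> carrier disk_space"
    unfolding eq using assms by (intro emb_in_disk_space[OF dilate_smult[OF dilate_coord]])
  show "coord (c \<odot>\<^bsub>disk_space\<^esub> u) = c \<odot> coord u"
    unfolding eq using assms coord_in[OF assms(2)] by simp
qed

lemma coord_linear: "coord \<in> linear_maps K disk_space X"
  by (auto simp: linear_maps_def coord_in disk_space_add disk_space_smult)

lemma coord_diff:
  assumes "u \<in> carrier disk_space" "v \<in> carrier disk_space"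
  shows "u \<oplus>\<^bsub>disk_space\<^esub> (-1) \<odot>\<^bsub>disk_space\<^esub> v \<in> carrier disk_space"
    "coord (u \<oplus>\<^bsub>disk_space\<^esub> (-1) \<odot>\<^bsub>disk_space\<^esub> v) = coord u \<ominus> coord v"
  using assms disk_space_add[OF assms(1) disk_space_smult(1)[OF _ assms(2), of "-1"]]
    disk_space_smult(2)[OF _ assms(2), of "-1"] coord_in[OF assms(2)] K_closed(6)[OF K_closed(8)]
  by (auto simp: smult_minus_1 M.minus_eq)

text \<open>For completeness, boundedness of \<open>B\<close> makes a Cauchy sequence in the gauge
  Cauchy in \<open>X\<close>; closedness of the dilates lets one index go to infinity, so the limit
  in \<open>X\<close> is also the limit in the gauge.\<close>

lemma banach_space_disk_space: "banach_space K disk_space"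
proof (rule banach_space_of_injective[where i = coord and Y = disk_space,
      OF coord_inj coord_in _ _ disk_space_add disk_space_smult])
  show "\<zero>\<^bsub>disk_space\<^esub> \<in> carrier disk_space" "coord \<zero>\<^bsub>disk_space\<^esub> = \<zero>"
    using dilate_0_iff by (auto simp: disk_space_def)
  show nonneg: "0 \<le> nrm disk_space u" if "u \<in> carrier disk_space" for u
    using dilate_nonneg[OF dilate_coord[OF that]] .
  show "nrm disk_space u = 0 \<longleftrightarrow> coord u = \<zero>" if "u \<in> carrier disk_space" for u
    using nrm_disk_space_le_iff[OF that, of 0] nonneg[OF that] by (auto simp: dilate_0_iff)
  have smult_le: "nrm disk_space (c \<odot>\<^bsub>disk_space\<^esub> u) \<le> cmod c * nrm disk_space u"
    if "c \<in> K" "u \<in> carrier disk_space" for c u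
    using that dilate_smult[OF dilate_coord] by (simp add: nrm_disk_space_le_iff disk_space_smult)
  show "nrm disk_space (c \<odot>\<^bsub>disk_space\<^esub> u) = cmod c * nrm disk_space u"
    if c: "c \<in> K" and u: "u \<in> carrier disk_space" for c u
  proof (rule antisym[OF smult_le[OF that]])
    \<comment> \<open>For \<open>c \<noteq> 0\<close> the reverse inequality is the first one
      applied to \<open>1 / c\<close>.\<close>
    show "cmod c * nrm disk_space u \<le> nrm disk_space (c \<odot>\<^bsub>disk_space\<^esub> u)"
    proof (cases "c = 0")
      case True
      then show ?thesis using nonneg[OF disk_space_smult(1)[OF that]] by simp
    next
      case False
      have c': "1 / c \<in> K" using c K_closed by blast
      have "coord ((1 / c) \<odot>\<^bsub>disk_space\<^esub> (c \<odot>\<^bsub>disk_space\<^esub> u)) = coord u"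
        using False disk_space_smult[OF c' disk_space_smult(1)[OF that]] disk_space_smult(2)[OF that]
          smult_smult[OF c' c coord_in[OF u]] coord_in[OF u] by simp
      then have "(1 / c) \<odot>\<^bsub>disk_space\<^esub> (c \<odot>\<^bsub>disk_space\<^esub> u) = u"
        using coord_inj disk_space_smult(1)[OF c' disk_space_smult(1)[OF that]] u by (simp add: inj_onD)
      then have "nrm disk_space u \<le> cmod (1 / c) * nrm disk_space (c \<odot>\<^bsub>disk_space\<^esub> u)"
        using smult_le[OF c' disk_space_smult(1)[OF that]] by simp
      then show ?thesis using False by (simp add: norm_divide field_simps)
    qed
  qed
  show "nrm disk_space (u \<oplus>\<^bsub>disk_space\<^esub> v) \<le> nrm disk_space u + nrm disk_space v"
    if "u \<in> carrier disk_space" "v \<in> carrier disk_space" for u v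
    using that dilate_add[OF dilate_coord dilate_coord] by (simp add: nrm_disk_space_le_iff disk_space_add)
  fix \<sigma> :: "nat \<Rightarrow> 'b"
  assume \<sigma>: "\<And>n. \<sigma> n \<in> carrier disk_space"
    and Cauchy: "\<And>e. 0 < e \<Longrightarrow> \<exists>N. \<forall>m\<ge>N. \<forall>n\<ge>N. nrm disk_space (\<sigma> m \<oplus>\<^bsub>disk_space\<^esub> (-1) \<odot>\<^bsub>disk_space\<^esub> \<sigma> n) < e"
  define s where "s n = coord (\<sigma> n)" for n
  have s: "s n \<in> carrier X" for n unfolding s_def by (rule coord_in[OF \<sigma>])
  have dilate_s: "\<exists>N. \<forall>m\<ge>N. \<forall>n\<ge>N. dilate e (s m \<ominus> s n)" if e: "0 < e" for e
  proof -
    obtain N where "\<And>m n. N \<le> m \<Longrightarrow> N \<le> n \<Longrightarrow> nrm disk_space (\<sigma> m \<oplus>\<^bsub>disk_space\<^esub> (-1) \<odot>\<^bsub>disk_space\<^esub> \<sigma> n) < e"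
      using Cauchy[OF e] by blast
    then show ?thesis
      using nrm_disk_space_le_iff[OF coord_diff(1)[OF \<sigma> \<sigma>]] coord_diff(2)[OF \<sigma> \<sigma>]
      unfolding s_def by (metis less_imp_le)
  qed
  obtain C where C: "0 < C" "\<And>t v. dilate t v \<Longrightarrow> nrm X v \<le> C * t"
    by (rule dilate_bounded) blast
  have Cauchy_s: "\<exists>N. \<forall>m\<ge>N. \<forall>n\<ge>N. nrm X (s m \<ominus> s n) < e" if e: "0 < e" for e
  proof -
    have "0 < e / (2 * C)" using e C(1) by simp
    from dilate_s[OF this] obtain N where N: "\<And>m n. N \<le> m \<Longrightarrow> N \<le> n \<Longrightarrow> dilate (e / (2 * C)) (s m \<ominus> s n)"
      by blast
    have "nrm X (s m \<ominus> s n) < e" if "N \<le> m" "N \<le> n" for m n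
      using C(2)[OF N[OF that]] C(1) e by simp
    then show ?thesis by blast
  qed
  obtain l where l: "l \<in> carrier X" and lim: "(\<lambda>n. nrm X (s n \<ominus> l)) \<longlonglongrightarrow> 0"
    by (rule Cauchy_imp_convergent[OF s Cauchy_s])
  have dilate_l: "\<exists>N. \<forall>n\<ge>N. dilate e (s n \<ominus> l)" if e: "0 < e" for e
  proof -
    obtain N where N: "\<And>m n. N \<le> m \<Longrightarrow> N \<le> n \<Longrightarrow> dilate e (s m \<ominus> s n)"
      using dilate_s[OF e] by blast
    \<comment> \<open>Fix \<open>n\<close> and let the second index \<open>N + k\<close> tend to
      infinity; the differences stay in the closed set \<open>e B\<close>.\<close>
    have "dilate e (s n \<ominus> l)" if "N \<le> n" for n
    proof (rule dilate_closed)
      show "dilate e (s n \<ominus> s (N + k))" for k by (rule N) (use that in auto)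
      show "s n \<ominus> l \<in> carrier X" using s l by simp
      have eq: "(s n \<ominus> s (N + k)) \<ominus> (s n \<ominus> l) = l \<ominus> s (N + k)" for k
      proof (rule dual_separates)
        fix f assume f: "f \<in> dual K X"
        show "f ((s n \<ominus> s (N + k)) \<ominus> (s n \<ominus> l)) = f (l \<ominus> s (N + k))"
          using s l by (simp add: dual_diff[OF f])
      qed (use s l in simp_all)
      have "nrm X ((s n \<ominus> s (N + k)) \<ominus> (s n \<ominus> l)) = nrm X (s (k + N) \<ominus> l)" for k
        unfolding eq using nrm_diff_commute[OF s l, of "N + k"] by (simp add: add.commute)
      then show "(\<lambda>k. nrm X ((s n \<ominus> s (N + k)) \<ominus> (s n \<ominus> l))) \<longlonglongrightarrow> 0"
        using LIMSEQ_ignore_initial_segment[OF lim, of N] by simp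
    qed
    then show ?thesis by blast
  qed
  \<comment> \<open>The limit \<open>l\<close> belongs to the span: it is \<open>s N\<close> minus
    an element of \<open>B\<close>.\<close>
  obtain N where "dilate 1 (s N \<ominus> l)" using dilate_l[of 1] by auto
  from dilate_add[OF dilate_smult[OF this, of "-1"] dilate_coord[OF \<sigma>[of N]]]
  have "dilate (1 + nrm disk_space (\<sigma> N)) ((-1) \<odot> (s N \<ominus> l) \<oplus> s N)"
    using K_closed(6)[OF K_closed(8)] by (simp add: s_def)
  also have "(-1) \<odot> (s N \<ominus> l) \<oplus> s N = l"
  proof (rule dual_separates)
    fix f assume f: "f \<in> dual K X"
    show "f ((-1) \<odot> (s N \<ominus> l) \<oplus> s N) = f l"
      using s l K_closed(6)[OF K_closed(8)] by (simp add: dual_add[OF f] dual_smult[OF f] dual_diff[OF f])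
  qed (use s l K_closed(6)[OF K_closed(8)] in auto)
  finally have embl: "emb l \<in> carrier disk_space" by (rule emb_in_disk_space)
  have "(\<lambda>n. nrm disk_space (\<sigma> n \<oplus>\<^bsub>disk_space\<^esub> (-1) \<odot>\<^bsub>disk_space\<^esub> emb l)) \<longlonglongrightarrow> 0"
  proof (rule LIMSEQ_I)
    fix e :: real assume "0 < e"
    then have "0 < e / 2" by simp
    from dilate_l[OF this] obtain N where N: "\<And>n. N \<le> n \<Longrightarrow> dilate (e / 2) (s n \<ominus> l)"
      by blast
    have "norm (nrm disk_space (\<sigma> n \<oplus>\<^bsub>disk_space\<^esub> (-1) \<odot>\<^bsub>disk_space\<^esub> emb l) - 0) < e" if "N \<le> n" for n
    proof -
      have "nrm disk_space (\<sigma> n \<oplus>\<^bsub>disk_space\<^esub> (-1) \<odot>\<^bsub>disk_space\<^esub> emb l) \<le> e / 2"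
        using N[OF that] l nrm_disk_space_le_iff[OF coord_diff(1)[OF \<sigma> embl], of n "e / 2"]
        by (simp only: coord_diff(2)[OF \<sigma> embl] coord_emb s_def)
      then show ?thesis
        using nonneg[OF coord_diff(1)[OF \<sigma> embl], of n] \<open>0 < e\<close> by simp
    qed
    then show "\<exists>N. \<forall>n\<ge>N. norm (nrm disk_space (\<sigma> n \<oplus>\<^bsub>disk_space\<^esub> (-1) \<odot>\<^bsub>disk_space\<^esub> emb l) - 0) < e"
      by blast
  qed
  with embl show "\<exists>l\<in>carrier disk_space. (\<lambda>n. nrm disk_space (\<sigma> n \<oplus>\<^bsub>disk_space\<^esub> (-1) \<odot>\<^bsub>disk_space\<^esub> l)) \<longlonglongrightarrow> 0"
    by blast
qed

text \<open>Attainment of the infimum places the closed unit ball in \<open>B\<close> itself and not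
  only in its dilates by factors above 1.\<close>

lemma coord_unit_ball: "coord ` closed_unit_ball disk_space \<subseteq> B"
  by (auto simp: closed_unit_ball_def nrm_disk_space_le_iff dilate_1_iff)

lemma emb_B_in: "b \<in> B \<Longrightarrow> emb b \<in> carrier disk_space"
  using dilate_1_iff emb_in_disk_space by blast

end

section \<open>The weak topology\<close>

context real_or_complex_banach_space
begin

lemma topspace_weak_topology [simp]: "topspace (weak_topology K X) = carrier X"
proof -
  have "\<Union>{{x \<in> carrier X. f x \<in> U} | f U. f \<in> dual K X \<and> open U} = carrier X" (is "\<Union>?S = _")
  proof
    \<comment> \<open>With the zero functional the carrier itself is a subbasic open set.\<close>
    have "{x \<in> carrier X. (\<lambda>v. 0) x \<in> (UNIV :: complex set)} \<in> ?S"
      using zero_in_dual by blast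
    then show "carrier X \<subseteq> \<Union>?S" by auto
  qed auto
  then show ?thesis
    unfolding weak_topology_def topology_generated_by_topspace .
qed

lemma openin_weak_topology:
  "f \<in> dual K X \<Longrightarrow> open U \<Longrightarrow> openin (weak_topology K X) {x \<in> carrier X. f x \<in> U}"
  unfolding weak_topology_def by (rule topology_generated_by_Basis) blast

lemma continuous_map_weak_topology:
  "f \<in> dual K X \<Longrightarrow> continuous_map (weak_topology K X) euclidean f"
  using openin_weak_topology by (auto simp: continuous_map_def)

lemma Hausdorff_weak_topology: "Hausdorff_space (weak_topology K X)"
  unfolding Hausdorff_space_def
proof (intro allI impI, elim conjE)
  fix v w assume vw: "v \<in> topspace (weak_topology K X)" "w \<in> topspace (weak_topology K X)" "v \<noteq> w"
  then obtain f where f: "f \<in> dual K X" "f v \<noteq> f w"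
    using dual_separates[of v w] by auto
  obtain U V where UV: "open U" "open V" "f v \<in> U" "f w \<in> V" "U \<inter> V = {}"
    using hausdorff[OF f(2)] by blast
  show "\<exists>U V. openin (weak_topology K X) U \<and> openin (weak_topology K X) V \<and> v \<in> U \<and> w \<in> V \<and> disjnt U V"
  proof (intro exI conjI)
    show "openin (weak_topology K X) {x \<in> carrier X. f x \<in> U}" "openin (weak_topology K X) {x \<in> carrier X. f x \<in> V}"
      by (rule openin_weak_topology[OF f(1)], fact)+
    show "disjnt {x \<in> carrier X. f x \<in> U} {x \<in> carrier X. f x \<in> V}"
      using UV(5) by (auto simp: disjnt_def)
  qed (use UV vw in auto)
qed

text \<open>Induction over the generation of the topology reduces arbitrary open sets to preimages
  under a single functional, where the hypothesis applies.\<close>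

lemma weakly_null_limitin:
  assumes y: "weakly_null K X y"
  shows "limitin (weak_topology K X) y \<zero> sequentially"
  unfolding limitin_def
proof (intro conjI allI impI)
  show "\<zero> \<in> topspace (weak_topology K X)" by simp
  fix U assume U: "openin (weak_topology K X) U \<and> \<zero> \<in> U"
  then have "generate_topology_on {{x \<in> carrier X. f x \<in> U} | f U. f \<in> dual K X \<and> open U} U"
    by (simp add: weak_topology_def openin_topology_generated_by_iff)
  then show "\<forall>\<^sub>F n in sequentially. y n \<in> U"
    using conjunct2[OF U]
  proof (induction rule: generate_topology_on.induct)
    case (Int A B)
    then show ?case by (auto intro: eventually_conj)
  next
    case (UN S)
    then obtain A where "A \<in> S" "\<zero> \<in> A" by blast
    with UN.IH have "\<forall>\<^sub>F n in sequentially. y n \<in> A" by blast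
    then show ?case by eventually_elim (use \<open>A \<in> S\<close> in blast)
  next
    case (Basis A)
    then obtain f W where f: "f \<in> dual K X" and W: "open W" and A: "A = {x \<in> carrier X. f x \<in> W}"
      by blast
    have "0 \<in> W" using Basis(2) f by (simp add: A)
    moreover have "(\<lambda>n. f (y n)) \<longlonglongrightarrow> 0" using y f by (simp add: weakly_null_def)
    ultimately have "\<forall>\<^sub>F n in sequentially. f (y n) \<in> W" using W topological_tendstoD by blast
    then show ?case
      by eventually_elim (use y A in \<open>auto simp: weakly_null_def\<close>)
  qed simp
qed

text \<open>A sequence together with its limit is compact; in a Hausdorff topology it is then closed
  and contains the closure.\<close>

lemma weakly_null_relatively_weakly_compact:
  assumes y: "weakly_null K X y"
  shows "relatively_weakly_compact K X (range y)"
proof -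
  let ?W = "weak_topology K X"
  have yX: "range y \<subseteq> carrier X" using y by (simp add: weakly_null_def)
  have compact: "compactin ?W (insert \<zero> (range y))"
    using yX by (intro compactin_sequence_with_limit[OF weakly_null_limitin[OF y]]) auto
  then have "closedin ?W (insert \<zero> (range y))"
    by (rule compactin_imp_closedin[OF Hausdorff_weak_topology])
  then have "?W closure_of range y \<subseteq> insert \<zero> (range y)"
    by (intro closure_of_minimal) auto
  then have "compactin ?W (?W closure_of range y)"
    by (rule closed_compactin[OF compact]) simp
  with yX show ?thesis by (simp add: relatively_weakly_compact_def)
qed

text \<open>Functionals are weakly continuous, hence bounded on the compact closure, and uniform
  boundedness applies.\<close>

lemma relatively_weakly_compact_bounded:
  assumes F: "relatively_weakly_compact K X F"
  shows "\<exists>C>0. \<forall>v\<in>F. nrm X v \<le> C"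
proof (rule weakly_bounded_imp_bounded)
  show FX: "F \<subseteq> carrier X" using F by (simp add: relatively_weakly_compact_def)
  fix f assume f: "f \<in> dual K X"
  have "compactin euclidean (f ` (weak_topology K X closure_of F))"
    using F by (intro image_compactin[OF _ continuous_map_weak_topology[OF f]])
      (simp add: relatively_weakly_compact_def)
  then have "bounded (f ` (weak_topology K X closure_of F))"
    by (simp add: compact_imp_bounded)
  moreover have "F \<subseteq> weak_topology K X closure_of F"
    using FX by (intro closure_of_subset) simp
  ultimately show "\<exists>C. \<forall>v\<in>F. cmod (f v) \<le> C"
    unfolding bounded_iff by blast
qed

text \<open>Homogeneity of the modulus for real scalars is available for a functional composed with
  a linear map before continuity of the composition is known.\<close>

lemma bounded_on_ball:
  assumes h: "\<And>t u. u \<in> carrier X \<Longrightarrow> cmod (h (complex_of_real t \<odot> u)) = \<bar>t\<bar> * cmod (h u)"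
    and le: "\<And>u. u \<in> closed_unit_ball X \<Longrightarrow> cmod (h u) \<le> C" and v: "v \<in> carrier X"
  shows "cmod (h v) \<le> C * nrm X v"
proof (cases "nrm X v = 0")
  case True
  then have "cmod (h (complex_of_real 0 \<odot> v)) = cmod (h v)"
    using nrm_eq_0_iff[OF v] v by simp
  then show ?thesis using True h[OF v, of 0] by simp
next
  case False
  then have pos: "0 < nrm X v" using nrm_nonneg[OF v] by simp
  have "complex_of_real (1 / nrm X v) \<odot> v \<in> closed_unit_ball X"
    unfolding closed_unit_ball_def mem_Collect_eq using v pos
    by (simp only: nrm_smult K_of_real smult_in_carrier norm_of_real) simp
  from le[OF this] have "\<bar>1 / nrm X v\<bar> * cmod (h v) \<le> C" by (simp only: h[OF v])
  then show ?thesis using pos by (simp add: field_simps)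
qed

end

section \<open>Weakly \<open>(p,r)\<close>-compact operators\<close>

text \<open>The terms are eventually at most 1, where a larger exponent gives a smaller
  power.\<close>

lemma summable_powr_mono:
  fixes c :: "nat \<Rightarrow> real"
  assumes c: "\<And>k. 0 \<le> c k" and p: "0 < p" "p \<le> q" and s: "summable (\<lambda>k. c k powr p)"
  shows "summable (\<lambda>k. c k powr q)"
proof (rule summable_comparison_test_ev[OF _ s])
  have "\<forall>\<^sub>F k in sequentially. c k powr p < 1"
    using order_tendstoD(2)[OF summable_LIMSEQ_zero[OF s], of 1] by simp
  then show "\<forall>\<^sub>F k in sequentially. norm (c k powr q) \<le> c k powr p"
  proof eventually_elim
    case (elim k)
    have "c k \<le> 1"
    proof (rule ccontr)
      assume "\<not> c k \<le> 1"
      then have "1 < c k powr p" using p(1) by simp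
      with elim show False by simp
    qed
    then show ?case using powr_mono'[OF p(2) c] by simp
  qed
qed

text \<open>Conjugation reverses the order, so the bound on \<open>r\<close> becomes one on
  \<open>p\<close>. Finiteness of \<open>r\<close> comes from that of \<open>conj_index p\<close> if
  p > 1, and by assumption if p = 1.\<close>

lemma conjugate_real_exponent:
  assumes "1 \<le> p" "1 < r" "r \<le> conj_index p" "p = 1 \<Longrightarrow> r < \<infinity>"
  obtains q where "r = ereal q" "conjugate_exponents q (q / (q - 1))" "p \<le> q / (q - 1)"
proof -
  have "r < \<infinity>"
  proof (cases "p = 1")
    case False
    with assms(1) have "conj_index p = ereal (p / (p - 1))" by (intro conj_index_gt_one) simp
    with assms(3) show ?thesis using le_less_trans[of r "ereal (p / (p - 1))" \<infinity>] by simp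
  qed (use assms in simp)
  with assms(2) obtain q where q: "r = ereal q" by (cases r) auto
  with assms(2) have q1: "1 < q" by (simp add: one_ereal_def)
  have "conjugate_exponents q (q / (q - 1))"
    using q1 by unfold_locales (simp_all add: field_simps)
  moreover have "p \<le> q / (q - 1)"
  proof (cases "p = 1")
    case False
    with assms(1) have p: "1 < p" by simp
    then have "q \<le> p / (p - 1)" using assms(3) q by (simp add: conj_index_gt_one)
    then have "q * (p - 1) \<le> p" using p by (simp add: pos_le_divide_eq)
    then have "p * (q - 1) \<le> q" by (simp add: algebra_simps)
    then show ?thesis using q1 by (simp add: pos_le_divide_eq)
  qed (use q1 in simp)
  ultimately show ?thesis using q by (rule that[rotated])
qed

locale conjugate_banach_space =
  real_or_complex_banach_space K X + conjugate_exponents q q'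
  for K and X :: "('a, 'm) normed_module_scheme" (structure) and q q' +
  fixes p :: real
  assumes p_ge_1: "1 \<le> p" and p_le: "p \<le> q'"
begin

lemma weakly_summable_sequence:
  assumes z: "z \<in> weakly_summable K p X"
  shows "weakly_summable_sequence K X q q' z"
proof
  show "z k \<in> carrier X" for k using z by (auto simp: weakly_summable_def)
  show "summable (\<lambda>k. cmod (f (z k)) powr q')" if "f \<in> dual K X" for f
    by (rule summable_powr_mono[of "\<lambda>k. cmod (f (z k))" p])
      (use z that p_ge_1 p_le in \<open>auto simp: weakly_summable_def\<close>)
qed

lemma weakly_summable_smult:
  assumes z: "z \<in> weakly_summable K p X" and c: "c \<in> K"
  shows "(\<lambda>k. c \<odot> z k) \<in> weakly_summable K p X"
proof -
  have zX: "z k \<in> carrier X" for k using z by (auto simp: weakly_summable_def)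
  have "summable (\<lambda>k. cmod (f (c \<odot> z k)) powr p)" if f: "f \<in> dual K X" for f
  proof -
    have "summable (\<lambda>k. cmod c powr p * cmod (f (z k)) powr p)"
      using z f by (intro summable_mult) (auto simp: weakly_summable_def)
    then show ?thesis
      by (simp add: dual_smult[OF f c zX] norm_mult powr_mult)
  qed
  with zX c show ?thesis by (auto simp: weakly_summable_def)
qed

lemma conv_smult:
  assumes z: "z \<in> weakly_summable K p X" and c: "c \<in> K" and s: "s \<in> conv_r K (ereal q) X z"
  shows "c \<odot> s \<in> conv_r K (ereal q) X (\<lambda>k. c \<odot> z k)"
proof -
  interpret z: weakly_summable_sequence K X q q' z
    by (rule weakly_summable_sequence[OF z])
  interpret cz: weakly_summable_sequence K X q q' "\<lambda>k. c \<odot> z k"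
    by (rule weakly_summable_sequence[OF weakly_summable_smult[OF z c]])
  obtain a where a: "a \<in> z.scalar_ball" and eq: "\<And>f. f \<in> dual K X \<Longrightarrow> f s = (\<Sum>k. a k * f (z k))"
    by (rule z.convE[OF s]) blast
  have sX: "s \<in> carrier X" using s z.conv_in_carrier by blast
  show ?thesis
  proof (rule cz.mem_convI[OF _ a])
    show "c \<odot> s \<in> carrier X" using c sX by simp
    fix f assume f: "f \<in> dual K X"
    have "f (c \<odot> s) = c * (\<Sum>k. a k * f (z k))" by (simp add: dual_smult[OF f c sX] eq[OF f])
    also have "\<dots> = (\<Sum>k. c * (a k * f (z k)))"
      by (rule suminf_mult[OF z.summable_dual_pairing[OF a f], symmetric])
    finally show "f (c \<odot> s) = (\<Sum>k. a k * f (c \<odot> z k))"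
      by (simp add: dual_smult[OF f c z.z_in] mult_ac)
  qed
qed

text \<open>The first \<open>N\<close> terms are reached by unit coefficient sequences, the others
  by their coefficients shifted by \<open>N\<close>; no term uses both blocks, so the coefficients
  stay in the ball.\<close>

lemma conv_prepend:
  fixes x :: "nat \<Rightarrow> 'a"
  assumes z: "z \<in> weakly_summable K p X" and x: "range x \<subseteq> carrier X"
    and conv: "\<And>n. N \<le> n \<Longrightarrow> x n \<in> conv_r K (ereal q) X z"
  shows "relatively_weakly_pr_compact K p (ereal q) X (range x)"
proof -
  define w where "w k = (if k < N then x k else z (k - N))" for k
  have w: "w \<in> weakly_summable K p X"
    unfolding weakly_summable_def mem_Collect_eq
  proof (intro conjI ballI)
    show "range w \<subseteq> carrier X"
      using z x by (auto simp: w_def weakly_summable_def)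
    fix f assume f: "f \<in> dual K X"
    have "summable (\<lambda>k. cmod (f (w (k + N))) powr p)"
      using z f by (simp add: w_def weakly_summable_def)
    then show "summable (\<lambda>k. cmod (f (w k)) powr p)"
      using summable_iff_shift[of "\<lambda>k. cmod (f (w k)) powr p" N] by simp
  qed
  interpret z: weakly_summable_sequence K X q q' z
    by (rule weakly_summable_sequence[OF z])
  interpret w: weakly_summable_sequence K X q q' w
    by (rule weakly_summable_sequence[OF w])
  have "x n \<in> conv_r K (ereal q) X w" for n
  proof (cases "n < N")
    case True
    then show ?thesis using w.z_in_conv[of n] by (simp add: w_def)
  next
    case False
    then have xn: "x n \<in> conv_r K (ereal q) X z" by (intro conv) simp
    obtain a where a: "a \<in> z.scalar_ball" and eq: "\<And>f. f \<in> dual K X \<Longrightarrow> f (x n) = (\<Sum>k. a k * f (z k))"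
      by (rule z.convE[OF xn]) blast
    define b where "b k = (if k < N then 0 else a (k - N))" for k
    have "b \<in> lq_ball q"
      unfolding b_def by (rule lq_ball_shift[OF z.scalar_ballD(1)[OF a]])
    then have b: "b \<in> w.scalar_ball"
      using z.scalar_ballD(2)[OF a] K_closed by (auto simp: w.scalar_ball_def b_def)
    show ?thesis
    proof (rule w.mem_convI[OF _ b])
      show "x n \<in> carrier X" using x by blast
      fix f assume f: "f \<in> dual K X"
      have "(\<Sum>k. b k * f (w k)) = (\<Sum>k. b (k + N) * f (w (k + N))) + (\<Sum>k<N. b k * f (w k))"
        by (rule suminf_split_initial_segment[OF w.summable_dual_pairing[OF b f]])
      also have "\<dots> = f (x n)"
        by (simp add: b_def w_def eq[OF f])
      finally show "f (x n) = (\<Sum>k. b k * f (w k))" ..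
    qed
  qed
  with w show ?thesis unfolding relatively_weakly_pr_compact_def by blast
qed

text \<open>Operators are defined as linear maps only. Continuity of \<open>f \<circ> T\<close>
  follows because \<open>T\<close> sends the unit ball into a weakly bounded set. Bounded sets are
  scaled into the ball, and \<open>z\<close> is scaled back.\<close>

lemma
  assumes Y: "real_or_complex_banach_space K Y"
    and T: "T \<in> weakly_pr_compact_operators K p (ereal q) Y X"
  shows weakly_pr_compact_operator_bounded_image:
      "\<And>F. F \<subseteq> carrier Y \<Longrightarrow> \<exists>C>0. \<forall>u\<in>F. nrm Y u \<le> C
        \<Longrightarrow> relatively_weakly_pr_compact K p (ereal q) X (T ` F)"
    and weakly_pr_compact_operator_adjoint: "\<And>f. f \<in> dual K X \<Longrightarrow> f \<circ> T \<in> dual K Y"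
proof -
  interpret Y: real_or_complex_banach_space K Y by (rule Y)
  have T_in: "T u \<in> carrier X" if "u \<in> carrier Y" for u
    using T that by (auto simp: weakly_pr_compact_operators_def linear_maps_def)
  have T_add: "T (u \<oplus>\<^bsub>Y\<^esub> v) = T u \<oplus> T v" if "u \<in> carrier Y" "v \<in> carrier Y" for u v
    using T that by (auto simp: weakly_pr_compact_operators_def linear_maps_def)
  have T_smult: "T (c \<odot>\<^bsub>Y\<^esub> u) = c \<odot> T u" if "c \<in> K" "u \<in> carrier Y" for c u
    using T that by (auto simp: weakly_pr_compact_operators_def linear_maps_def)
  obtain z where z: "z \<in> weakly_summable K p X" and ball: "T ` closed_unit_ball Y \<subseteq> conv_r K (ereal q) X z"
    using T by (auto simp: weakly_pr_compact_operators_def relatively_weakly_pr_compact_def)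
  interpret z: weakly_summable_sequence K X q q' z
    by (rule weakly_summable_sequence[OF z])
  show "relatively_weakly_pr_compact K p (ereal q) X (T ` F)"
    if F: "F \<subseteq> carrier Y" and bdd: "\<exists>C>0. \<forall>u\<in>F. nrm Y u \<le> C" for F
  proof -
    obtain C where C: "0 < C" and le: "\<And>u. u \<in> F \<Longrightarrow> nrm Y u \<le> C" using bdd by blast
    have "T u \<in> conv_r K (ereal q) X (\<lambda>k. complex_of_real C \<odot> z k)" if u: "u \<in> F" for u
    proof -
      have uY: "u \<in> carrier Y" using u F by blast
      have vY: "complex_of_real (1 / C) \<odot>\<^bsub>Y\<^esub> u \<in> carrier Y"
        using uY by (intro Y.smult_in_carrier K_of_real)
      have "nrm Y (complex_of_real (1 / C) \<odot>\<^bsub>Y\<^esub> u) = \<bar>1 / C\<bar> * nrm Y u"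
        using uY by (simp only: Y.nrm_smult K_of_real norm_of_real)
      also have "\<dots> \<le> 1" using le[OF u] C by simp
      finally have "complex_of_real (1 / C) \<odot>\<^bsub>Y\<^esub> u \<in> closed_unit_ball Y"
        using vY by (simp add: closed_unit_ball_def)
      then have "T (complex_of_real (1 / C) \<odot>\<^bsub>Y\<^esub> u) \<in> conv_r K (ereal q) X z"
        using ball by blast
      from conv_smult[OF z K_of_real this, of C]
      have "T (complex_of_real C \<odot>\<^bsub>Y\<^esub> (complex_of_real (1 / C) \<odot>\<^bsub>Y\<^esub> u))
          \<in> conv_r K (ereal q) X (\<lambda>k. complex_of_real C \<odot> z k)"
        by (simp only: T_smult[OF K_of_real vY])
      also have "complex_of_real C \<odot>\<^bsub>Y\<^esub> (complex_of_real (1 / C) \<odot>\<^bsub>Y\<^esub> u) = u"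
        using C uY Y.smult_smult[OF K_of_real K_of_real uY, of C "1 / C"] by simp
      finally show ?thesis .
    qed
    then show ?thesis
      unfolding relatively_weakly_pr_compact_def using weakly_summable_smult[OF z K_of_real[of C]] by blast
  qed
  show "f \<circ> T \<in> dual K Y" if f: "f \<in> dual K X" for f
  proof -
    define C where "C = 1 + (\<Sum>k. cmod (f (z k)) powr q')"
    have bound: "cmod ((f \<circ> T) v) \<le> C * nrm Y v" if "v \<in> carrier Y" for v
    proof (rule Y.bounded_on_ball[OF _ _ that])
      show "cmod ((f \<circ> T) (complex_of_real t \<odot>\<^bsub>Y\<^esub> u)) = \<bar>t\<bar> * cmod ((f \<circ> T) u)" if "u \<in> carrier Y" for t u
        using that by (simp add: T_smult T_in dual_smult[OF f] norm_mult)
      show "cmod ((f \<circ> T) u) \<le> C" if "u \<in> closed_unit_ball Y" for u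
        unfolding C_def comp_def using that ball by (intro z.conv_weakly_bounded[OF f]) blast
    qed
    show ?thesis
      unfolding dual_def mem_Collect_eq
    proof (intro conjI ballI exI[of _ C] bound)
      show "f \<circ> T \<in> carrier Y \<rightarrow> K"
        using T_in dual_in[OF f] by simp
      show "(f \<circ> T) (u \<oplus>\<^bsub>Y\<^esub> v) = (f \<circ> T) u + (f \<circ> T) v" if "u \<in> carrier Y" "v \<in> carrier Y" for u v
        using that by (simp add: T_add T_in dual_add[OF f])
      show "(f \<circ> T) (c \<odot>\<^bsub>Y\<^esub> u) = c * (f \<circ> T) u" if "c \<in> K" "u \<in> carrier Y" for c u
        using that by (simp add: T_smult T_in dual_smult[OF f])
    qed
  qed
qed

lemma weakly_null_image:
  assumes Y: "real_or_complex_banach_space K Y" and y: "weakly_null K Y y"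
    and T: "T \<in> weakly_pr_compact_operators K p (ereal q) Y X"
  shows "weakly_null K X (\<lambda>n. T (y n))"
  unfolding weakly_null_def
proof (intro conjI ballI)
  show "range (\<lambda>n. T (y n)) \<subseteq> carrier X"
    using T y by (auto simp: weakly_pr_compact_operators_def linear_maps_def weakly_null_def)
  show "(\<lambda>n. f (T (y n))) \<longlonglongrightarrow> 0" if "f \<in> dual K X" for f
    using weakly_pr_compact_operator_adjoint[OF Y T that] y by (auto simp: weakly_null_def comp_def)
qed

end

section \<open>Factoring weakly null sequences through the span of \<open>(p,r)-conv\<close>\<close>

context banach_disk
begin

text \<open>On the span the norm of \<open>X\<close> is at most a multiple of the gauge.\<close>

lemma dual_comp_coord:
  assumes f: "f \<in> dual K X"
  shows "f \<circ> coord \<in> dual K disk_space"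
proof -
  obtain C where C: "0 < C" "\<And>v. v \<in> carrier X \<Longrightarrow> cmod (f v) \<le> C * nrm X v"
    by (rule dual_bound[OF f]) blast
  obtain D where D: "\<And>t v. dilate t v \<Longrightarrow> nrm X v \<le> D * t"
    by (rule dilate_bounded) blast
  have bound: "cmod ((f \<circ> coord) u) \<le> (C * D) * nrm disk_space u" if u: "u \<in> carrier disk_space" for u
  proof -
    have "cmod ((f \<circ> coord) u) \<le> C * nrm X (coord u)"
      using C(2)[OF coord_in[OF u]] by simp
    also have "\<dots> \<le> C * (D * nrm disk_space u)"
      using D[OF dilate_coord[OF u]] C(1) by (intro mult_left_mono) auto
    finally show ?thesis by (simp add: mult_ac)
  qed
  show ?thesis
    unfolding dual_def mem_Collect_eq
  proof (intro conjI ballI exI[of _ "C * D"] bound)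
    show "f \<circ> coord \<in> carrier disk_space \<rightarrow> K"
      using coord_in dual_in[OF f] by simp
    show "(f \<circ> coord) (u \<oplus>\<^bsub>disk_space\<^esub> v) = (f \<circ> coord) u + (f \<circ> coord) v"
      if "u \<in> carrier disk_space" "v \<in> carrier disk_space" for u v
      using that by (simp add: disk_space_add coord_in dual_add[OF f])
    show "(f \<circ> coord) (c \<odot>\<^bsub>disk_space\<^esub> u) = c * (f \<circ> coord) u"
      if "c \<in> K" "u \<in> carrier disk_space" for c u
      using that by (simp add: disk_space_smult coord_in dual_smult[OF f])
  qed
qed

end

locale conv_disk = weakly_summable_sequence K X q q' z
  for K and X :: "('a, 'm) normed_module_scheme" (structure) and q q' and z :: "nat \<Rightarrow> 'a" +
  fixes emb :: "'a \<Rightarrow> 'b"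
  assumes inj: "inj_on emb (carrier X)"
begin

abbreviation "B \<equiv> conv_r K (ereal q) X z"

sublocale banach_disk K X B emb
proof
  show "l \<in> B" if "\<And>n. s n \<in> B" "l \<in> carrier X" "(\<lambda>n. nrm X (s n \<ominus> l)) \<longlonglongrightarrow> 0" for s l
  proof (rule conv_weakly_closed[OF that(1) _ that(2)])
    show "(\<lambda>n. f (s n)) \<longlonglongrightarrow> f l" if "f \<in> dual K X" for f
      using \<open>\<And>n. s n \<in> B\<close> conv_in_carrier
      by (intro dual_tendsto[OF that _ \<open>l \<in> carrier X\<close> \<open>(\<lambda>n. nrm X (s n \<ominus> l)) \<longlonglongrightarrow> 0\<close>]) blast
  qed
qed (use conv_in_carrier zero_in_conv conv_scale conv_convex conv_bounded inj in auto)

sublocale disk: real_or_complex_banach_space K disk_space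
  by (intro real_or_complex_banach_space.intro real_or_complex_banach_space_axioms.intro
      banach_space_disk_space K_cases)

lemma emb_z_in: "emb (z k) \<in> carrier disk_space"
  by (rule emb_B_in[OF z_in_conv])

definition partial_sum :: "(nat \<Rightarrow> complex) \<Rightarrow> nat \<Rightarrow> 'b" where
  "partial_sum a n = (\<Oplus>\<^bsub>disk_space\<^esub>k\<in>{..<n}. a k \<odot>\<^bsub>disk_space\<^esub> emb (z k))"

lemma partial_sum_in: "(\<And>k. a k \<in> K) \<Longrightarrow> partial_sum a n \<in> carrier disk_space"
  unfolding partial_sum_def by (intro disk.finsum_in_carrier disk.smult_in_carrier emb_z_in)

lemma disk_dual_partial_sum:
  assumes g: "g \<in> dual K disk_space" and a: "\<And>k. a k \<in> K"
  shows "g (partial_sum a n) = (\<Sum>k<n. a k * g (emb (z k)))"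
proof -
  have "g (partial_sum a n) = (\<Sum>k<n. g (a k \<odot>\<^bsub>disk_space\<^esub> emb (z k)))"
    unfolding partial_sum_def
    by (rule disk.dual_finsum[OF g]) (simp_all add: disk.smult_in_carrier a emb_z_in)
  then show ?thesis by (simp add: disk.dual_smult[OF g a emb_z_in])
qed

lemma dual_coord_partial_sum:
  "f \<in> dual K X \<Longrightarrow> (\<And>k. a k \<in> K) \<Longrightarrow> f (coord (partial_sum a n)) = (\<Sum>k<n. a k * f (z k))"
  using disk_dual_partial_sum[OF dual_comp_coord, of f a n] by (simp add: z_in)

text \<open>The remainder has the coefficients of \<open>a\<close> from index \<open>n\<close> on.
  Divided by \<epsilon> they lie in the ball, so the remainder lies in \<epsilon> times
  \<open>B\<close>; this yields convergence in the gauge and not only in \<open>X\<close>.\<close>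

lemma dilate_tail:
  assumes a: "a \<in> scalar_ball" and v: "v \<in> carrier X"
    and eq: "\<And>f. f \<in> dual K X \<Longrightarrow> f v = (\<Sum>k. a k * f (z k))"
    and \<epsilon>: "0 < \<epsilon>" and tail: "(\<Sum>k. cmod (a (k + n)) powr q) \<le> \<epsilon> powr q"
  shows "dilate \<epsilon> (v \<ominus> coord (partial_sum a n))"
proof -
  note aK = scalar_ballD(2)[OF a]
  define c where "c k = (if k < n then 0 else a k / complex_of_real \<epsilon>)" for k
  have w: "coord (partial_sum a n) \<in> carrier X"
    by (rule coord_in[OF partial_sum_in[OF aK]])
  have a_shift: "summable (\<lambda>k. cmod (a (k + n)) powr q)"
    using scalar_ballD(1)[OF a] summable_iff_shift[of "\<lambda>k. cmod (a k) powr q" n] by (simp add: lq_ball_def)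
  have c_shift: "cmod (c (k + n)) powr q = cmod (a (k + n)) powr q / \<epsilon> powr q" for k
    using \<epsilon> by (simp add: c_def norm_divide powr_divide)
  have "summable (\<lambda>k. cmod (c (k + n)) powr q)"
    unfolding c_shift by (rule summable_divide[OF a_shift])
  then have c_summable: "summable (\<lambda>k. cmod (c k) powr q)"
    using summable_iff_shift[of "\<lambda>k. cmod (c k) powr q" n] by simp
  have "(\<Sum>k. cmod (c k) powr q) = (\<Sum>k. cmod (c (k + n)) powr q) + (\<Sum>k<n. cmod (c k) powr q)"
    by (rule suminf_split_initial_segment[OF c_summable])
  also have "\<dots> = (\<Sum>k. cmod (a (k + n)) powr q) / \<epsilon> powr q"
    unfolding c_shift suminf_divide[OF a_shift] by (simp add: c_def)
  also have "\<dots> \<le> 1" using tail \<epsilon> by simp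
  finally have "c \<in> lq_ball q" using c_summable by (simp add: lq_ball_def)
  moreover have "c k \<in> K" for k
    unfolding c_def using aK K_closed(4)[OF aK K_of_real] K_closed(7) by simp
  ultimately have c: "c \<in> scalar_ball" by (auto simp: scalar_ball_def)
  have "complex_of_real (1 / \<epsilon>) \<odot> (v \<ominus> coord (partial_sum a n)) \<in> B"
  proof (rule mem_convI[OF _ c])
    show "complex_of_real (1 / \<epsilon>) \<odot> (v \<ominus> coord (partial_sum a n)) \<in> carrier X"
      by (intro smult_in_carrier K_of_real M.minus_closed v w)
    fix f assume f: "f \<in> dual K X"
    have af: "summable (\<lambda>k. a k * f (z k))" by (rule summable_dual_pairing[OF a f])
    have af_shift: "summable (\<lambda>k. a (k + n) * f (z (k + n)))"
      using af summable_iff_shift[of "\<lambda>k. a k * f (z k)" n] by simp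
    have "(\<Sum>k. c k * f (z k)) = (\<Sum>k. c (k + n) * f (z (k + n))) + (\<Sum>k<n. c k * f (z k))"
      by (rule suminf_split_initial_segment[OF summable_dual_pairing[OF c f]])
    also have "\<dots> = (\<Sum>k. complex_of_real (1 / \<epsilon>) * (a (k + n) * f (z (k + n))))"
      by (simp add: c_def)
    also have "\<dots> = complex_of_real (1 / \<epsilon>) * (\<Sum>k. a (k + n) * f (z (k + n)))"
      by (rule suminf_mult[OF af_shift])
    also have "(\<Sum>k. a (k + n) * f (z (k + n))) = f v - f (coord (partial_sum a n))"
      using suminf_split_initial_segment[OF af, of n]
      by (simp add: eq[OF f] dual_coord_partial_sum[OF f aK])
    finally show "f (complex_of_real (1 / \<epsilon>) \<odot> (v \<ominus> coord (partial_sum a n))) = (\<Sum>k. c k * f (z k))"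
      by (simp only: dual_smult[OF f K_of_real] dual_diff[OF f] M.minus_closed v w)
  qed
  then show ?thesis
    using dilate_pos_iff[OF \<epsilon> M.minus_closed[OF v w]] by blast
qed

lemma coord_minus:
  "u \<in> carrier disk_space \<Longrightarrow> v \<in> carrier disk_space \<Longrightarrow> coord (u \<ominus>\<^bsub>disk_space\<^esub> v) = coord u \<ominus> coord v"
  using coord_diff(2)[of u v] by (simp add: disk.smult_minus_1 disk.M.minus_eq)

lemma partial_sum_tendsto:
  assumes a: "a \<in> scalar_ball" and v: "v \<in> B"
    and eq: "\<And>f. f \<in> dual K X \<Longrightarrow> f v = (\<Sum>k. a k * f (z k))"
  shows "(\<lambda>n. nrm disk_space (partial_sum a n \<ominus>\<^bsub>disk_space\<^esub> emb v)) \<longlonglongrightarrow> 0"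
proof (rule LIMSEQ_I)
  note aK = scalar_ballD(2)[OF a]
  have u: "partial_sum a n \<in> carrier disk_space" for n
    by (rule partial_sum_in[OF aK])
  have vX: "v \<in> carrier X" using v conv_in_carrier by blast
  have ev: "emb v \<in> carrier disk_space" by (rule emb_B_in[OF v])
  fix e :: real assume e: "0 < e"
  then have "0 < (e / 2) powr q" by simp
  moreover have "summable (\<lambda>k. cmod (a k) powr q)"
    using scalar_ballD(1)[OF a] by (simp add: lq_ball_def)
  ultimately obtain N where N: "\<And>n. N \<le> n \<Longrightarrow> norm (\<Sum>k. cmod (a (k + n)) powr q) < (e / 2) powr q"
    using suminf_exist_split by blast
  have "norm (nrm disk_space (partial_sum a n \<ominus>\<^bsub>disk_space\<^esub> emb v) - 0) < e" if "N \<le> n" for n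
  proof -
    have "(\<Sum>k. cmod (a (k + n)) powr q) \<le> (e / 2) powr q" using N[OF that] by simp
    then have "dilate (e / 2) (v \<ominus> coord (partial_sum a n))"
      using e by (intro dilate_tail[OF a vX eq]) auto
    then have "nrm disk_space (emb v \<ominus>\<^bsub>disk_space\<^esub> partial_sum a n) \<le> e / 2"
      unfolding nrm_disk_space_le_iff[OF disk.minus_in_carrier[OF ev u]] coord_minus[OF ev u] coord_emb[OF vX] .
    moreover have "0 \<le> nrm disk_space (emb v \<ominus>\<^bsub>disk_space\<^esub> partial_sum a n)"
      by (rule disk.nrm_nonneg[OF disk.minus_in_carrier[OF ev u]])
    ultimately show ?thesis
      using e disk.nrm_diff_commute[OF ev u, of n] by simp
  qed
  then show "\<exists>N. \<forall>n\<ge>N. norm (nrm disk_space (partial_sum a n \<ominus>\<^bsub>disk_space\<^esub> emb v) - 0) < e"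
    by blast
qed

text \<open>Convergence of the series in the gauge lets \<open>g\<close> be applied termwise even if
  it is discontinuous for the norm of \<open>X\<close>.\<close>

lemma disk_dual_pairing:
  assumes g: "g \<in> dual K disk_space" and a: "a \<in> scalar_ball" and v: "v \<in> B"
    and eq: "\<And>f. f \<in> dual K X \<Longrightarrow> f v = (\<Sum>k. a k * f (z k))"
  shows "g (emb v) = (\<Sum>k. a k * g (emb (z k)))"
proof -
  note aK = scalar_ballD(2)[OF a]
  have "(\<lambda>n. g (partial_sum a n)) \<longlonglongrightarrow> g (emb v)"
    by (rule disk.dual_tendsto[OF g partial_sum_in[OF aK] emb_B_in[OF v] partial_sum_tendsto[OF a v eq]])
  then have "(\<lambda>k. a k * g (emb (z k))) sums g (emb v)"
    by (simp add: sums_def disk_dual_partial_sum[OF g aK])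
  then show ?thesis by (simp add: sums_iff)
qed

text \<open>Finite combinations with coefficients in the ball lie in \<open>B\<close>, so their
  gauge is at most 1 and \<open>g\<close> is bounded on them; the converse of Hoelder's inequality
  turns this into summability.\<close>

lemma disk_dual_summable:
  assumes g: "g \<in> dual K disk_space"
  shows "summable (\<lambda>k. cmod (g (emb (z k))) powr q')"
proof -
  obtain C where C: "0 < C" "\<And>u. u \<in> carrier disk_space \<Longrightarrow> cmod (g u) \<le> C * nrm disk_space u"
    by (rule disk.dual_bound[OF g]) blast
  show ?thesis
  proof (rule summable_of_bounded_pairing[OF K_cases])
    show "range (\<lambda>k. g (emb (z k))) \<subseteq> K"
      using disk.dual_in[OF g emb_z_in] by blast
    fix a m assume a: "a \<in> lq_ball q" "range a \<subseteq> K" and fin: "\<And>k. m \<le> k \<Longrightarrow> a k = 0"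
    have ball: "a \<in> scalar_ball" using a by (simp add: scalar_ball_def)
    note aK = scalar_ballD(2)[OF ball]
    have u: "partial_sum a n \<in> carrier disk_space" for n
    by (rule partial_sum_in[OF aK])
    have "coord (partial_sum a m) \<in> B"
    proof (rule mem_convI[OF coord_in[OF u] ball])
      show "f (coord (partial_sum a m)) = (\<Sum>k. a k * f (z k))" if "f \<in> dual K X" for f
        unfolding dual_coord_partial_sum[OF that aK]
        by (rule suminf_finite[symmetric]) (use fin in auto)
    qed
    then have "nrm disk_space (partial_sum a m) \<le> 1"
      using nrm_disk_space_le_iff[OF u] dilate_1_iff by blast
    then have "C * nrm disk_space (partial_sum a m) \<le> C" using C(1) by simp
    then show "cmod (\<Sum>k<m. a k * g (emb (z k))) \<le> C"
      using C(2)[OF u, of m] unfolding disk_dual_partial_sum[OF g aK] by linarith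
  qed
qed

text \<open>A coordinatewise limit of coefficient sequences of the \<open>x\<^sub>n\<close> represents the weak limit \<open>0\<close>
  of \<open>x\<close>; functionals on the disk space see such limits because \<open>q > 1\<close>.\<close>

theorem weakly_null_in_disk_space:
  assumes x: "weakly_null K X x" and conv: "\<And>n. x n \<in> B"
  shows "weakly_null K disk_space (\<lambda>n. emb (x n))"
  unfolding weakly_null_def
proof (intro conjI ballI)
  show "range (\<lambda>n. emb (x n)) \<subseteq> carrier disk_space"
    using emb_B_in[OF conv] by blast
  fix g assume g: "g \<in> dual K disk_space"
  have "\<exists>a. a \<in> scalar_ball \<and> (\<forall>f\<in>dual K X. f (x n) = (\<Sum>k. a k * f (z k)))" for n
    by (rule convE[OF conv[of n]]) blast
  then obtain a where a: "\<And>n. a n \<in> scalar_ball"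
    and eq: "\<And>n f. f \<in> dual K X \<Longrightarrow> f (x n) = (\<Sum>k. a n k * f (z k))"
    by metis
  \<comment> \<open>Only subsequences of the coefficients converge, so convergence to 0 is first
    obtained along a further subsequence of any given one.\<close>
  have subseq: "\<exists>\<sigma>. strict_mono \<sigma> \<and> (\<lambda>n. g (emb (x (\<tau> (\<sigma> n))))) \<longlonglongrightarrow> 0" if \<tau>: "strict_mono \<tau>" for \<tau> :: "nat \<Rightarrow> nat"
  proof -
    have lim: "(\<lambda>n. f (x (\<tau> n))) \<longlonglongrightarrow> f \<zero>" if f: "f \<in> dual K X" for f
      using LIMSEQ_subseq_LIMSEQ[of "\<lambda>n. f (x n)" 0 \<tau>] x f \<tau> by (simp add: weakly_null_def comp_def)
    obtain \<sigma> b where \<sigma>: "strict_mono \<sigma>" and b: "b \<in> scalar_ball"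
      and coord: "\<And>k. (\<lambda>n. a (\<tau> (\<sigma> n)) k) \<longlonglongrightarrow> b k"
      and zero: "\<And>f. f \<in> dual K X \<Longrightarrow> f \<zero> = (\<Sum>k. b k * f (z k))"
      by (rule weakly_convergent_subsequence[where s = "\<lambda>n. x (\<tau> n)" and a = "\<lambda>n. a (\<tau> n)",
            OF a eq lim M.zero_closed])
        (assumption+, rule that)
    have "(\<lambda>n. \<Sum>k. a (\<tau> (\<sigma> n)) k * g (emb (z k))) \<longlonglongrightarrow> (\<Sum>k. b k * g (emb (z k)))"
      by (rule pairing_tendsto[OF scalar_ballD(1)[OF a] scalar_ballD(1)[OF b] coord disk_dual_summable[OF g]])
    \<comment> \<open>The limit \<open>b\<close> need not vanish, but as a coefficient sequence of
      \<zero> in \<open>X\<close> it also represents the zero of the disk space.\<close>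
    moreover have "(\<Sum>k. b k * g (emb (z k))) = 0"
    proof -
      have "emb \<zero> = \<zero>\<^bsub>disk_space\<^esub>" by (simp add: disk_space_def)
      then show ?thesis
        using disk_dual_pairing[OF g b zero_in_conv zero] disk.dual_zero[OF g] by simp
    qed
    ultimately have "(\<lambda>n. g (emb (x (\<tau> (\<sigma> n))))) \<longlonglongrightarrow> 0"
      by (simp add: disk_dual_pairing[OF g a conv eq])
    with \<sigma> show ?thesis by blast
  qed
  show "(\<lambda>n. g (emb (x n))) \<longlonglongrightarrow> 0"
  proof (rule ccontr)
    assume "\<not> (\<lambda>n. g (emb (x n))) \<longlonglongrightarrow> 0"
    then obtain e where e: "0 < e" and far: "\<And>N. \<exists>n\<ge>N. e \<le> cmod (g (emb (x n)))"
      unfolding LIMSEQ_def dist_norm by (auto simp: not_less)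
    have "infinite {n. e \<le> cmod (g (emb (x n)))}"
      unfolding infinite_nat_iff_unbounded_le using far by blast
    then obtain \<tau> :: "nat \<Rightarrow> nat" where \<tau>: "strict_mono \<tau>" and far': "\<And>n. e \<le> cmod (g (emb (x (\<tau> n))))"
      using infinite_enumerate by blast
    obtain \<sigma> where "(\<lambda>n. g (emb (x (\<tau> (\<sigma> n))))) \<longlonglongrightarrow> 0"
      using subseq[OF \<tau>] by blast
    from LIMSEQ_D[OF this e] far' show False
      by (auto simp: not_less[symmetric])
  qed
qed

lemma coord_pr_compact:
  "z \<in> weakly_summable K p X \<Longrightarrow> coord \<in> weakly_pr_compact_operators K p (ereal q) disk_space X"
  using coord_linear coord_unit_ball
  by (auto simp: weakly_pr_compact_operators_def relatively_weakly_pr_compact_def)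

end

section \<open>Equivalence of the five conditions\<close>

theorem theorem4p8:
  fixes K :: "complex set"
    and X :: "'a normed_module"
    and x :: "nat \<Rightarrow> 'a"
    and p :: real and r :: ereal
    and emb :: "'a \<Rightarrow> 'b"
    and \<W> :: "'b normed_module \<Rightarrow> 'a normed_module \<Rightarrow> ('b \<Rightarrow> 'a) set"
  assumes "K = \<real> \<or> K = UNIV"
    and "banach_space K X"
    and "range x \<subseteq> carrier X"
    and "1 \<le> p" and "1 < r" and "r \<le> conj_index p" and "p = 1 \<Longrightarrow> r < \<infinity>"
    \<comment> \<open>the type \<open>'b\<close>, whose subsets carry the auxiliary Banach spaces in (c) and (d),
       is arbitrary but at least as large as \<open>X\<close>\<close>
    and "inj_on emb (carrier X)"
    and "\<W> = weakly_pr_compact_operators K p r"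
  shows "(weakly_pr_null K p r X x
            \<longleftrightarrow> weakly_null K X x \<and> relatively_weakly_pr_compact K p r X (range x))
       \<and> (weakly_null K X x \<and> relatively_weakly_pr_compact K p r X (range x)
            \<longleftrightarrow> weakly_null K X x \<and> weakly_ideal_compact K \<W> X (range x))
       \<and> (weakly_null K X x \<and> weakly_ideal_compact K \<W> X (range x)
            \<longleftrightarrow> weakly_ideal_null K \<W> X x)
       \<and> (weakly_ideal_null K \<W> X x
            \<longleftrightarrow> uniformly_weakly_pr_null K p r X x)"
proof -
  obtain q where r: "r = ereal q" and conj: "conjugate_exponents q (q / (q - 1))" and pq: "p \<le> q / (q - 1)"
    using conjugate_real_exponent[OF assms(4-7)] by blast
  \<comment> \<open>The type \<open>'c\<close> is kept free so that this covers both
    \<open>X\<close> and the auxiliary spaces.\<close>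
  have rc_banach: "real_or_complex_banach_space K Y" if "banach_space K Y" for Y :: "'c normed_module"
    using that assms(1) by (intro real_or_complex_banach_space.intro real_or_complex_banach_space_axioms.intro)
  interpret real_or_complex_banach_space K X by (rule rc_banach[OF assms(2)])
  interpret conjugate_banach_space K X q "q / (q - 1)" p
    by (intro conjugate_banach_space.intro conjugate_banach_space_axioms.intro conj pq assms(4)
        real_or_complex_banach_space_axioms)
  let ?a = "weakly_pr_null K p r X x"
  let ?b = "weakly_null K X x \<and> relatively_weakly_pr_compact K p r X (range x)"
  let ?c = "weakly_null K X x \<and> weakly_ideal_compact K \<W> X (range x)"
  let ?d = "weakly_ideal_null K \<W> X x"
  let ?e = "uniformly_weakly_pr_null K p r X x"
  have ab: "?b" if a: "?a"
  proof -
    have "(\<lambda>n. f (x n)) \<longlonglongrightarrow> 0" if f: "f \<in> dual K X" for f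
    proof (rule LIMSEQ_I)
      fix e :: real assume "0 < e"
      then have "0 < e / 2" by simp
      with a f obtain N where "\<And>n. N \<le> n \<Longrightarrow> cmod (f (x n)) \<le> e / 2"
        unfolding weakly_pr_null_def by blast
      then show "\<exists>N. \<forall>n\<ge>N. norm (f (x n) - 0) < e"
        using \<open>0 < e\<close> by (intro exI[of _ N]) force
    qed
    then have "weakly_null K X x" using assms(3) by (simp add: weakly_null_def)
    \<comment> \<open>The zero functional with \<epsilon> = 1 extracts from (a) one sequence
      \<open>z\<close> that serves all late terms.\<close>
    moreover obtain z N where "z \<in> weakly_summable K p X" "\<And>n. N \<le> n \<Longrightarrow> x n \<in> conv_r K r X z"
      using a zero_in_dual zero_less_one unfolding weakly_pr_null_def by metis
    then have "relatively_weakly_pr_compact K p r X (range x)"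
      unfolding r by (intro conv_prepend[OF _ assms(3)])
    ultimately show ?thesis ..
  qed
  have be: "?e" if b: "?b"
  proof -
    obtain z where z: "z \<in> weakly_summable K p X" and conv: "range x \<subseteq> conv_r K r X z"
      using b unfolding relatively_weakly_pr_compact_def by blast
    show ?thesis
      unfolding uniformly_weakly_pr_null_def
    proof (intro bexI[OF _ z] ballI allI impI)
      fix f and \<epsilon> :: real assume f: "f \<in> dual K X" and \<epsilon>: "0 < \<epsilon>"
      have "(\<lambda>n. f (x n)) \<longlonglongrightarrow> 0" using b f by (simp add: weakly_null_def)
      from LIMSEQ_D[OF this \<epsilon>] obtain N where "\<And>n. N \<le> n \<Longrightarrow> norm (f (x n) - 0) < \<epsilon>" by blast
      then show "\<exists>N. \<forall>n\<ge>N. cmod (f (x n)) \<le> \<epsilon> \<and> x n \<in> conv_r K r X z"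
        using conv by (intro exI[of _ N]) force
    qed
  qed
  have ea: "?a" if "?e"
    using that unfolding uniformly_weakly_pr_null_def weakly_pr_null_def by blast
  have bd: "?d" if b: "?b"
  proof -
    obtain z where z: "z \<in> weakly_summable K p X" and conv: "range x \<subseteq> conv_r K r X z"
      using b unfolding relatively_weakly_pr_compact_def by blast
    interpret conv_disk K X q "q / (q - 1)" z emb
      by (intro conv_disk.intro conv_disk_axioms.intro weakly_summable_sequence[OF z] assms(8))
    have "weakly_null K disk_space (\<lambda>n. emb (x n))"
      using b conv r by (intro weakly_null_in_disk_space) auto
    moreover have "coord \<in> \<W> disk_space X"
      unfolding assms(9) r by (rule coord_pr_compact[OF z])
    moreover have "x n = coord (emb (x n))" for n
      using assms(3) by (simp add: image_subset_iff)
    ultimately show ?thesis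
      unfolding weakly_ideal_null_def using banach_space_disk_space by blast
  qed
  have dc: "?c" if d: "?d"
  proof -
    obtain Y y T where Y: "banach_space K Y" and y: "weakly_null K Y y" and T: "T \<in> \<W> Y X"
      and x: "\<And>n. x n = T (y n)"
      using d unfolding weakly_ideal_null_def by blast
    interpret Y: real_or_complex_banach_space K Y by (rule rc_banach[OF Y])
    have "x = (\<lambda>n. T (y n))" using x by auto
    then have "weakly_null K X x"
      using weakly_null_image[OF Y.real_or_complex_banach_space_axioms y] T by (simp add: assms(9) r)
    moreover have "range x \<subseteq> T ` range y" using x by auto
    then have "weakly_ideal_compact K \<W> X (range x)"
      unfolding weakly_ideal_compact_def using Y T Y.weakly_null_relatively_weakly_compact[OF y] by blast
    ultimately show ?thesis ..
  qed
  have cb: "?b" if c: "?c"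
  proof -
    obtain Y F T where Y: "banach_space K Y" and F: "relatively_weakly_compact K Y F" and T: "T \<in> \<W> Y X"
      and x: "range x \<subseteq> T ` F"
      using c unfolding weakly_ideal_compact_def by blast
    interpret Y: real_or_complex_banach_space K Y by (rule rc_banach[OF Y])
    have "relatively_weakly_pr_compact K p r X (T ` F)"
      unfolding r
    proof (rule weakly_pr_compact_operator_bounded_image[OF Y.real_or_complex_banach_space_axioms])
      show "T \<in> weakly_pr_compact_operators K p (ereal q) Y X" using T by (simp add: assms(9) r)
      show "F \<subseteq> carrier Y" using F by (simp add: relatively_weakly_compact_def)
      show "\<exists>C>0. \<forall>u\<in>F. nrm Y u \<le> C" by (rule Y.relatively_weakly_compact_bounded[OF F])
    qed
    then have "relatively_weakly_pr_compact K p r X (range x)"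
      using x unfolding relatively_weakly_pr_compact_def by blast
    with c show ?thesis by blast
  qed
  \<comment> \<open>The implications form two cycles through (b): one by way of (e) and (a), the
    other by way of (d) and (c).\<close>
  show ?thesis using ab be ea bd dc cb by blast
qed

end
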